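(* Let $\theta_0=\tfrac{\pi}{4}$, let $\theta_1\in(\tfrac{\pi}{2},\tfrac{3\pi}{4})$, and let $c>0$ satisfy $$c^2<\frac{\pi}{5}\cot\left(\frac{19}{40}\pi\right)\left(1+\frac{\pi}{40}\cot\left(\frac{19}{40}\pi\right)\right)^{-1}.$$ Then the first two Dirichlet eigenvalues $\lambda_1<\lambda_2$ of $-\Delta$ on $\Omega_{c,\theta_0,\theta_1}$ satisfy $$\lambda_2-\lambda_1>\frac{3\pi^2}{2D^2},$$ where $D$ is the diameter of $\Omega_{c,\theta_0,\theta_1}$.
   Context: $\mathbb{H}^2$ is the Poincar\'e upper half-plane $\{(x,y):y>0\}=\{(r,\theta): r>0,\ \theta\in(0,\pi)\}$ (polar coordinates $x=r\cos\theta$, $y=r\sin\theta$) with metric $(dx^2+dy^2)/y^2$, and $\Delta$ is its Laplace--Beltrami operator. For $c>0$, $\theta_0\in(0,\tfrac{\pi}{2})$, $\theta_1\in(\tfrac{\pi}{2},\pi)$, $$\Omega_{c,\theta_0,\theta_1}=\{(r,\theta): 1<r<e^{\pi/c},\ \theta_0<\theta<\theta_1\}\subset\mathbb{H}^2.$$ Dirichlet eigenvalues of $-\Delta$ are listed in increasing order with multiplicity, $\lambda_1<\lambda_2\le\cdots$. The diameter is the supremum of hyperbolic distances between points of the domain. *)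

theory Defs
  imports "HOL-Analysis.Analysis"
begin

section \<open>Partial derivatives in the plane\<close>

definition partial_x :: "(real \<times> real \<Rightarrow> real) \<Rightarrow> real \<times> real \<Rightarrow> real" where
  "partial_x u p = deriv (\<lambda>s. u (s, snd p)) (fst p)"

definition partial_y :: "(real \<times> real \<Rightarrow> real) \<Rightarrow> real \<times> real \<Rightarrow> real" where
  "partial_y u p = deriv (\<lambda>s. u (fst p, s)) (snd p)"

text \<open>\<open>C1_on\<close> and \<open>C2_on\<close> are meant for open sets. Existence of the partial derivatives is
  required explicitly because \<open>deriv\<close> is total.\<close>

definition C1_on :: "(real \<times> real) set \<Rightarrow> (real \<times> real \<Rightarrow> real) \<Rightarrow> bool" where
  "C1_on S u \<longleftrightarrow>
     (\<forall>p\<in>S. (\<lambda>s. u (s, snd p)) field_differentiable at (fst p) \<and>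
            (\<lambda>s. u (fst p, s)) field_differentiable at (snd p)) \<and>
     continuous_on S (partial_x u) \<and> continuous_on S (partial_y u)"

definition C2_on :: "(real \<times> real) set \<Rightarrow> (real \<times> real \<Rightarrow> real) \<Rightarrow> bool" where
  "C2_on S u \<longleftrightarrow> C1_on S u \<and> C1_on S (partial_x u) \<and> C1_on S (partial_y u)"


section \<open>Riemannian metrics on subsets of the plane\<close>

text \<open>\<open>g p v w\<close> is the inner product of the tangent vectors \<open>v\<close> and \<open>w\<close> at the point \<open>p\<close>.\<close>

type_synonym metric2 = "real \<times> real \<Rightarrow> real \<times> real \<Rightarrow> real \<times> real \<Rightarrow> real"

definition metric_det :: "metric2 \<Rightarrow> real \<times> real \<Rightarrow> real" where
  "metric_det g p = g p (1, 0) (1, 0) * g p (0, 1) (0, 1) - (g p (1, 0) (0, 1))\<^sup>2"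

text \<open>The formula \<open>(1 / \<surd>det g) \<Sum>\<^sub>i \<partial>\<^sub>i (\<surd>det g \<Sum>\<^sub>j g\<^sup>i\<^sup>j \<partial>\<^sub>j u)\<close>, with the inverse matrix written out
  as the adjugate divided by the determinant, so that \<open>\<surd>det g / det g = 1 / \<surd>det g\<close>.\<close>

definition laplace_beltrami ::
    "metric2 \<Rightarrow> (real \<times> real \<Rightarrow> real) \<Rightarrow> real \<times> real \<Rightarrow> real" where
  "laplace_beltrami g u p =
     (partial_x (\<lambda>q. (g q (0, 1) (0, 1) * partial_x u q - g q (1, 0) (0, 1) * partial_y u q)
                       / sqrt (metric_det g q)) p +
      partial_y (\<lambda>q. (g q (1, 0) (1, 0) * partial_y u q - g q (1, 0) (0, 1) * partial_x u q)
                       / sqrt (metric_det g q)) p)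
     / sqrt (metric_det g p)"

definition curve_speed :: "metric2 \<Rightarrow> (real \<Rightarrow> real \<times> real) \<Rightarrow> real \<Rightarrow> real" where
  "curve_speed g \<gamma> t =
     sqrt (g (\<gamma> t) (vector_derivative \<gamma> (at t)) (vector_derivative \<gamma> (at t)))"

definition curve_length :: "metric2 \<Rightarrow> (real \<Rightarrow> real \<times> real) \<Rightarrow> real" where
  "curve_length g \<gamma> = integral {0..1} (curve_speed g \<gamma>)"

text \<open>The library's \<open>piecewise_C1_differentiable_on\<close> allows the derivative to blow up at the
  exceptional points. Integrability of the speed excludes curves of infinite length, for which
  \<open>curve_length\<close> would take the default value 0.\<close>

definition admissible_curve ::
    "metric2 \<Rightarrow> (real \<times> real) set \<Rightarrow> real \<times> real \<Rightarrow> real \<times> real \<Rightarrow> (real \<Rightarrow> real \<times> real) \<Rightarrow> bool" where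
  "admissible_curve g M p q \<gamma> \<longleftrightarrow>
     \<gamma> piecewise_C1_differentiable_on {0..1} \<and> path_image \<gamma> \<subseteq> M \<and>
     pathstart \<gamma> = p \<and> pathfinish \<gamma> = q \<and> curve_speed g \<gamma> integrable_on {0..1}"

definition riemannian_dist ::
    "metric2 \<Rightarrow> (real \<times> real) set \<Rightarrow> real \<times> real \<Rightarrow> real \<times> real \<Rightarrow> real" where
  "riemannian_dist g M p q = Inf {curve_length g \<gamma> |\<gamma>. admissible_curve g M p q \<gamma>}"

text \<open>Distances are those of the ambient manifold \<open>M\<close>, not of the subset \<open>S\<close>.\<close>

definition riemannian_diameter ::
    "metric2 \<Rightarrow> (real \<times> real) set \<Rightarrow> (real \<times> real) set \<Rightarrow> real" where
  "riemannian_diameter g M S = Sup {riemannian_dist g M p q |p q. p \<in> S \<and> q \<in> S}"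


section \<open>Dirichlet eigenvalues\<close>

definition dirichlet_eigenfunction ::
    "metric2 \<Rightarrow> (real \<times> real) set \<Rightarrow> real \<Rightarrow> (real \<times> real \<Rightarrow> real) \<Rightarrow> bool" where
  "dirichlet_eigenfunction g S \<mu> u \<longleftrightarrow>
     C2_on S u \<and> continuous_on (closure S) u \<and>
     (\<forall>p\<in>frontier S. u p = 0) \<and>
     (\<forall>p\<in>S. - laplace_beltrami g u p = \<mu> * u p) \<and>
     (\<exists>p\<in>S. u p \<noteq> 0)"

definition lin_indep_on ::
    "(real \<times> real) set \<Rightarrow> nat \<Rightarrow> (nat \<Rightarrow> real \<times> real \<Rightarrow> real) \<Rightarrow> bool" where
  "lin_indep_on S k u \<longleftrightarrow>
     (\<forall>a :: nat \<Rightarrow> real. (\<forall>p\<in>S. (\<Sum>i<k. a i * u i p) = 0) \<longrightarrow> (\<forall>i<k. a i = 0))"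

text \<open>The number of eigenvalues that are at most \<open>\<Lambda>\<close>, counted with multiplicity, is at least \<open>k\<close>
  iff there are \<open>k\<close> linearly independent eigenfunctions whose eigenvalues are at most \<open>\<Lambda>\<close>. The
  \<open>k\<close>-th entry (\<open>k \<ge> 1\<close>) of the increasing list with multiplicity is the least such \<open>\<Lambda>\<close>.\<close>

definition dirichlet_eigenvalue :: "metric2 \<Rightarrow> (real \<times> real) set \<Rightarrow> nat \<Rightarrow> real" where
  "dirichlet_eigenvalue g S k =
     Inf {\<Lambda>. \<exists>\<mu> u. (\<forall>i<k. \<mu> i \<le> \<Lambda> \<and> dirichlet_eigenfunction g S (\<mu> i) (u i)) \<and>
                  lin_indep_on S k u}"


section \<open>The hyperbolic plane and the domain\<close>

definition half_plane :: "(real \<times> real) set" where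
  "half_plane = {(x, y). y > 0}"

definition hyp_metric :: metric2 where
  "hyp_metric p v w = (fst v * fst w + snd v * snd w) / (snd p)\<^sup>2"

lemma laplace_beltrami_hyp_metric:
  assumes "p \<in> half_plane"
  shows "laplace_beltrami hyp_metric u p =
           (snd p)\<^sup>2 * (partial_x (partial_x u) p + partial_y (partial_y u) p)"
proof -
  obtain x y where p: "p = (x, y)" and y: "y > 0"
    using assms by (auto simp: half_plane_def)
  have W: "sqrt (metric_det hyp_metric (s, t)) = 1 / t\<^sup>2" for s t
  proof -
    have "metric_det hyp_metric (s, t) = (1 / t\<^sup>2)\<^sup>2"
      by (simp add: metric_det_def hyp_metric_def power2_eq_square)
    then show ?thesis by simp
  qed
  have "eventually (\<lambda>t. t \<in> {0<..}) (nhds y)"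
    using y by (intro eventually_nhds_in_open) auto
  then have "eventually (\<lambda>t. partial_y u (x, t) / t\<^sup>2 / (1 / t\<^sup>2) = partial_y u (x, t)) (nhds y)"
    by (rule eventually_mono) simp
  from deriv_cong_ev[OF this refl]
  have "partial_y (\<lambda>q. partial_y u q / (snd q)\<^sup>2 / (1 / (snd q)\<^sup>2)) p = partial_y (partial_y u) p"
    by (simp only: partial_y_def[of _ "(x, y)"] p fst_conv snd_conv)
  moreover have "partial_x (\<lambda>q. partial_x u q / (snd q)\<^sup>2 / (1 / (snd q)\<^sup>2)) p = partial_x (partial_x u) p"
    using y by (simp add: partial_x_def[of _ "(x, y)"] p)
  moreover have "sqrt (metric_det hyp_metric q) = 1 / (snd q)\<^sup>2" for q
    using W[of "fst q" "snd q"] by simp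
  moreover have "hyp_metric q (0, 1) (0, 1) * a - hyp_metric q (1, 0) (0, 1) * b = a / (snd q)\<^sup>2"
    and "hyp_metric q (1, 0) (1, 0) * a - hyp_metric q (1, 0) (0, 1) * b = a / (snd q)\<^sup>2"
    for q and a b :: real
    by (simp_all add: hyp_metric_def)
  ultimately have "laplace_beltrami hyp_metric u p =
      (partial_x (partial_x u) p + partial_y (partial_y u) p) / (1 / (snd p)\<^sup>2)"
    by (simp only: laplace_beltrami_def)
  then show ?thesis by simp
qed

definition Omega :: "real \<Rightarrow> real \<Rightarrow> real \<Rightarrow> (real \<times> real) set" where
  "Omega c \<theta>\<^sub>0 \<theta>\<^sub>1 =
     {(r * cos \<theta>, r * sin \<theta>) |r \<theta>. 1 < r \<and> r < exp (pi / c) \<and> \<theta>\<^sub>0 < \<theta> \<and> \<theta> < \<theta>\<^sub>1}"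

end

(* Writing s = ln r and v(s, theta) = u(r, theta), an eigenfunction satisfies v_ss + v_tt = - mu v / sin^2 t on a
   rectangle, so each sine coefficient a_n(t) of v(., t) solves a_n'' = - (mu / sin^2 t - (n c)^2) a_n with zero
   boundary values. Let lam_n be the lowest eigenvalue of this problem. Sturm comparison, with
   1 <= 1 / sin^2 <= 2 on [pi/4, 3 pi/4], shows that any eigenvalue other than lam_1 is at least lam_2 (when some
   a_n with n >= 2 does not vanish) or at least 2 pi^2 / L^2 + c^2 / 2 with L = theta_1 - theta_0 < pi / 2 (when
   a_1 changes sign), and that lam_2 - lam_1 > 3 c^2 / 2 and lam_1 <= c^2 + pi^2 / L^2. As c^2 < 1, the gap
   exceeds 3 c^2 / 2. The diameter is at least the length pi / c of the vertical segment, because ln y is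
   1-Lipschitz. *)

theory Submission
  imports Defs
begin

text \<open>The eigenvalues are defined through classical eigenfunctions that are only continuous up
  to the boundary, so the lower bound for the second one is obtained as a rigidity statement: every
  eigenfunction below the threshold is a multiple of sin (c s) phi(t), where phi is the positive
  solution for n = 1. Two linearly independent ones then cannot both lie below it. The same weak
  boundary regularity is the obstacle in the equation for a_n: integrating v_ss against a sine seems
  to require normal derivatives at the boundary. The equation is therefore proved for slightly
  compressed integrals and put into an integrated form without derivatives, which passes to the
  limit. Origin of the constants: 3 c^2 = (2 c)^2 - c^2 is the difference of the potentials for n =
  2 and n = 1; dividing by the upper bound 2 of the weight gives 3 c^2 / 2, which is 3 pi^2 / 2
  divided by (pi / c)^2. In 2 pi^2 / L^2 + c^2 / 2 the first term is half of (pi / (L / 2))^2: a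
  sign-changing a_1 keeps one sign on an interval of length at most L / 2 between two of its
  zeros.\<close>

section \<open>Twofold antiderivatives as integrals over a fixed interval\<close>

text \<open>Cauchy's formula for the twofold antiderivative, with the kernel cut off at zero: the
  range of integration no longer depends on \<open>x\<close>, so that continuity in \<open>x\<close>
  and in further parameters can be read off from the integrand.\<close>

lemma integral_max_kernel:
  fixes g :: "real \<Rightarrow> real"
  assumes "continuous_on {a..b} g" "x \<in> {a..b}"
  shows "integral {a..b} (\<lambda>t. max 0 (x - t) * g t) = integral {a..x} (\<lambda>t. (x - t) * g t)"
proof -
  have int: "(\<lambda>t. max 0 (x - t) * g t) integrable_on {a..b}"
    by (intro integrable_continuous_real continuous_intros assms)
  have "integral {a..b} (\<lambda>t. max 0 (x - t) * g t) =
      integral {a..x} (\<lambda>t. max 0 (x - t) * g t) + integral {x..b} (\<lambda>t. max 0 (x - t) * g t)"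
    using Henstock_Kurzweil_Integration.integral_combine[OF _ _ int, of x] assms(2) by simp
  also have "integral {x..b} (\<lambda>t. max 0 (x - t) * g t) = integral {x..b} (\<lambda>t. 0)"
    by (rule integral_cong) auto
  also have "integral {a..x} (\<lambda>t. max 0 (x - t) * g t) = integral {a..x} (\<lambda>t. (x - t) * g t)"
    by (rule integral_cong) auto
  finally show ?thesis by simp
qed

text \<open>Splitting the kernel as \<open>x - t\<close> and differentiating the product, the two
  terms \<open>x * g x\<close> cancel. The derivative is taken within \<open>{a..b}\<close>, hence
  is one-sided at the end points, as \<open>ode_solution\<close> requires.\<close>

lemma integral_max_kernel_has_derivative:
  fixes g :: "real \<Rightarrow> real"
  assumes g: "continuous_on {a..b} g" and x: "x \<in> {a..b}"
  shows "((\<lambda>x. integral {a..b} (\<lambda>t. max 0 (x - t) * g t)) has_real_derivative integral {a..x} g)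
           (at x within {a..b})"
proof -
  have eq: "integral {a..b} (\<lambda>t. max 0 (x - t) * g t) =
      x * integral {a..x} g - integral {a..x} (\<lambda>t. t * g t)" if "x \<in> {a..b}" for x
  proof -
    have c: "continuous_on {a..x} g" by (rule continuous_on_subset[OF g]) (use that in auto)
    have "integral {a..x} (\<lambda>t. (x - t) * g t) = integral {a..x} (\<lambda>t. x * g t - t * g t)"
      by (simp add: left_diff_distrib)
    also have "\<dots> = integral {a..x} (\<lambda>t. x * g t) - integral {a..x} (\<lambda>t. t * g t)"
      by (intro integral_diff integrable_continuous_real continuous_intros c)
    finally show ?thesis using integral_max_kernel[OF g that] by simp
  qed
  have "((\<lambda>x. x * integral {a..x} g - integral {a..x} (\<lambda>t. t * g t)) has_real_derivative
      (1 * integral {a..x} g + g x * x) - x * g x) (at x within {a..b})"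
    by (rule DERIV_diff[OF DERIV_mult'[OF DERIV_ident, THEN DERIV_cong]])
      (auto intro!: integral_has_real_derivative g x continuous_intros)
  then have "((\<lambda>x. x * integral {a..x} g - integral {a..x} (\<lambda>t. t * g t)) has_real_derivative
      integral {a..x} g) (at x within {a..b})"
    by (simp add: mult.commute)
  then show ?thesis
    by (rule has_field_derivative_transform_within[where d=1]) (use x eq in auto)
qed

section \<open>The equation \<open>y'' = - Q y\<close> on an interval\<close>

text \<open>The equation is encoded as a first-order system on the closed interval, with
  \<open>z\<close> for the derivative of \<open>y\<close>. The one-sided derivatives at the ends
  make the boundary values of Wronskians available.\<close>

definition ode_solution ::
    "real \<Rightarrow> real \<Rightarrow> (real \<Rightarrow> real) \<Rightarrow> (real \<Rightarrow> real) \<Rightarrow> (real \<Rightarrow> real) \<Rightarrow> bool" where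
  "ode_solution a b Q y z \<longleftrightarrow>
     (\<forall>x\<in>{a..b}. (y has_real_derivative z x) (at x within {a..b}) \<and>
                 (z has_real_derivative - Q x * y x) (at x within {a..b}))"

lemma ode_solution_subset:
  assumes "ode_solution a b Q y z" "a \<le> p" "q \<le> b"
  shows "ode_solution p q Q y z"
  using assms unfolding ode_solution_def
  by (auto intro!: has_field_derivative_subset[where s="{a..b}" and t="{p..q}"])

lemma ode_solution_continuous:
  assumes "ode_solution a b Q y z"
  shows "continuous_on {a..b} y" "continuous_on {a..b} z"
  using assms unfolding ode_solution_def
  by (auto intro!: DERIV_continuous_on)

lemma ode_solution_uminus:
  assumes "ode_solution a b Q y z"
  shows "ode_solution a b Q (\<lambda>x. - y x) (\<lambda>x. - z x)"
  using assms unfolding ode_solution_def by (auto intro!: derivative_eq_intros)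

lemma wronskian_has_derivative:
  assumes "ode_solution a b P f f'" "ode_solution a b Q g g'" "x \<in> {a..b}"
  shows "((\<lambda>x. f' x * g x - f x * g' x) has_real_derivative (Q x - P x) * (f x * g x))
           (at x within {a..b})"
proof -
  have "((\<lambda>x. f' x * g x - f x * g' x) has_real_derivative
      (- P x * f x * g x + f' x * g' x) - (f' x * g' x + f x * (- Q x * g x))) (at x within {a..b})"
    using assms unfolding ode_solution_def by (auto intro!: derivative_eq_intros)
  then show ?thesis by (rule DERIV_cong) (simp add: algebra_simps)
qed

lemma deriv_sign_at_ends:
  fixes f :: "real \<Rightarrow> real"
  assumes "a < b" "\<And>x. a < x \<Longrightarrow> x < b \<Longrightarrow> f x > 0"
  shows "f a = 0 \<Longrightarrow> (f has_real_derivative l) (at a within {a..b}) \<Longrightarrow> l \<ge> 0"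
    and "f b = 0 \<Longrightarrow> (f has_real_derivative l) (at b within {a..b}) \<Longrightarrow> l \<le> 0"
proof -
  assume "f a = 0" and d: "(f has_real_derivative l) (at a within {a..b})"
  show "l \<ge> 0"
  proof (rule ccontr)
    assume "\<not> l \<ge> 0"
    then obtain d where d: "d > 0" "\<And>h. h > 0 \<Longrightarrow> a + h \<in> {a..b} \<Longrightarrow> h < d \<Longrightarrow> f a > f (a + h)"
      using has_real_derivative_neg_dec_right[OF d] by force
    define h where "h = min d (b - a) / 2"
    have "h > 0" "h < d" "a + h < b" using d(1) assms(1) by (auto simp: h_def min_def field_simps)
    then show False using d(2)[of h] assms(2)[of "a + h"] \<open>f a = 0\<close> by auto
  qed
next
  assume "f b = 0" and d: "(f has_real_derivative l) (at b within {a..b})"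
  show "l \<le> 0"
  proof (rule ccontr)
    assume "\<not> l \<le> 0"
    then obtain d where d: "d > 0" "\<And>h. h > 0 \<Longrightarrow> b - h \<in> {a..b} \<Longrightarrow> h < d \<Longrightarrow> f (b - h) < f b"
      using has_real_derivative_pos_inc_left[OF d] by force
    define h where "h = min d (b - a) / 2"
    have "h > 0" "h < d" "a < b - h" using d(1) assms(1) by (auto simp: h_def min_def field_simps)
    then show False using d(2)[of h] assms(2)[of "b - h"] \<open>f b = 0\<close> by auto
  qed
qed

text \<open>If \<open>P < Q\<close> held throughout the interior, the Wronskian
  \<open>f' * g - f * g'\<close> would increase strictly. But \<open>f\<close> vanishes at both
  ends, where the Wronskian is therefore \<open>f' * g\<close>: nonnegative at \<open>p\<close> and
  nonpositive at \<open>q\<close>. The function \<open>g\<close> may vanish at the ends or not, so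
  the lemma compares with ground states on the same interval as well as on a larger one.\<close>

lemma sturm_comparison:
  assumes "p < q" and f: "ode_solution p q P f f'" and g: "ode_solution p q Q g g'"
    and f0: "f p = 0" "f q = 0"
    and fpos: "\<And>x. p < x \<Longrightarrow> x < q \<Longrightarrow> f x > 0"
    and gpos: "\<And>x. p < x \<Longrightarrow> x < q \<Longrightarrow> g x > 0"
  shows "\<exists>t. p < t \<and> t < q \<and> Q t \<le> P t"
proof (rule ccontr)
  assume "\<not> ?thesis"
  then have less: "P t < Q t" if "p < t" "t < q" for t using that by force
  define W where "W x = f' x * g x - f x * g' x" for x
  have dW: "(W has_real_derivative (Q x - P x) * (f x * g x)) (at x within {p..q})"
    if "x \<in> {p..q}" for x
    unfolding W_def using wronskian_has_derivative[OF f g that] .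
  have Wc: "continuous_on {p..q} W"
    by (rule DERIV_continuous_on) (rule dW)
  have "W p < W q"
  proof (rule DERIV_pos_imp_increasing_open[OF \<open>p < q\<close>])
    fix x assume x: "p < x" "x < q"
    then have "at x within {p..q} = at x" by (simp add: at_within_Icc_at)
    then show "\<exists>y. (W has_real_derivative y) (at x) \<and> 0 < y"
      using dW[of x] x less[OF x] fpos[OF x] gpos[OF x] by (auto intro!: exI mult_pos_pos)
  next
    show "continuous_on {p..q} W" by (rule Wc)
  qed
  moreover have "g p \<ge> 0" "g q \<ge> 0"
  proof -
    have c: "continuous_on {p..q} g" using ode_solution_continuous[OF g] by simp
    have cl: "closure {p<..<q} = {p..q}" using \<open>p < q\<close> by simp
    show "g p \<ge> 0" "g q \<ge> 0"
      using continuous_ge_on_closure[of "{p<..<q}" g _ 0] c gpos \<open>p < q\<close>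
      by (auto simp: cl less_imp_le)
  qed
  moreover have "f' p \<ge> 0" "f' q \<le> 0"
    using deriv_sign_at_ends[where f=f, OF \<open>p < q\<close> fpos] f0 f \<open>p < q\<close>
    unfolding ode_solution_def by auto
  ultimately show False by (simp add: W_def f0 mult_le_0_iff zero_le_mult_iff)
      (smt (verit) mult_nonneg_nonneg mult_nonpos_nonneg)
qed

text \<open>A Gronwall argument for the energy \<open>(y x)\<^sup>2 + (z x)\<^sup>2\<close>: its
  derivative is bounded by \<open>K\<close> times itself, so it decreases after multiplication by
  exp (- K x) and increases after multiplication by exp (K x). The first fact carries its zero at
  \<open>c\<close> to the right, the second to the left.\<close>

lemma ode_solution_unique_zero:
  assumes y: "ode_solution a b Q y z" and Q: "continuous_on {a..b} Q"
    and c: "c \<in> {a..b}" "y c = 0" "z c = 0" and x: "x \<in> {a..b}"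
  shows "y x = 0"
proof -
  obtain M where M: "\<And>x. x \<in> {a..b} \<Longrightarrow> \<bar>Q x\<bar> \<le> M"
    using compact_imp_bounded[OF compact_continuous_image[OF Q compact_Icc]]
    unfolding bounded_iff by (metis imageI real_norm_def)
  define E where "E x = (y x)\<^sup>2 + (z x)\<^sup>2" for x
  define K where "K = 1 + M"
  have dE: "(E has_real_derivative 2 * y x * z x * (1 - Q x)) (at x within {a..b})"
    if "x \<in> {a..b}" for x
  proof -
    have "(E has_real_derivative (2 * y x * z x + 2 * z x * (- Q x * y x))) (at x within {a..b})"
      unfolding E_def using y that unfolding ode_solution_def
      by (auto intro!: derivative_eq_intros)
    then show ?thesis by (rule DERIV_cong) (simp add: algebra_simps)
  qed
  have bd: "\<bar>2 * y x * z x * (1 - Q x)\<bar> \<le> K * E x" if "x \<in> {a..b}" for x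
  proof -
    have "\<bar>2 * y x * z x\<bar> \<le> E x"
      using sum_squares_bound[of "\<bar>y x\<bar>" "\<bar>z x\<bar>"] by (simp add: E_def abs_mult)
    moreover have "\<bar>1 - Q x\<bar> \<le> K" using M[OF that] by (simp add: K_def)
    ultimately have "\<bar>2 * y x * z x\<bar> * \<bar>1 - Q x\<bar> \<le> E x * K"
      by (intro mult_mono) (auto simp: E_def)
    then show ?thesis by (simp add: abs_mult mult.commute)
  qed
  have at: "at x within {a..b} = at x" if "a < x" "x < b" for x
    using that by (simp add: at_within_Icc_at)
  have Ec: "continuous_on {a..b} E" by (rule DERIV_continuous_on) (rule dE)
  have "E x \<le> 0"
  proof (cases "c \<le> x")
    case True
    have "E x * exp (- K * x) \<le> E c * exp (- K * c)"
    proof (rule DERIV_nonpos_imp_decreasing_open[OF True])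
      show "continuous_on {c..x} (\<lambda>x. E x * exp (- K * x))"
        by (intro continuous_intros continuous_on_subset[OF Ec]) (use c x in auto)
      fix t assume t: "c < t" "t < x"
      then have ti: "a < t" "t < b" "t \<in> {a..b}" using c x by auto
      have "((\<lambda>x. E x * exp (- K * x)) has_real_derivative
          2 * y t * z t * (1 - Q t) * exp (- K * t) + (- K * exp (- K * t)) * E t) (at t)"
        using dE[OF ti(3)] at[OF ti(1,2)] by (auto intro!: derivative_eq_intros)
      moreover have "2 * y t * z t * (1 - Q t) * exp (- K * t) + (- K * exp (- K * t)) * E t =
          (2 * y t * z t * (1 - Q t) - K * E t) * exp (- K * t)" by (simp add: algebra_simps)
      moreover have "\<dots> \<le> 0" using bd[OF ti(3)] by (intro mult_nonpos_nonneg) auto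
      ultimately show "\<exists>l. ((\<lambda>x. E x * exp (- K * x)) has_real_derivative l) (at t) \<and> l \<le> 0"
        by metis
    qed
    then show ?thesis using c by (simp add: E_def mult_le_0_iff)
  next
    case False
    then have "x \<le> c" by simp
    have "E x * exp (K * x) \<le> E c * exp (K * c)"
    proof (rule DERIV_nonneg_imp_increasing_open[OF \<open>x \<le> c\<close>])
      show "continuous_on {x..c} (\<lambda>x. E x * exp (K * x))"
        by (intro continuous_intros continuous_on_subset[OF Ec]) (use c x in auto)
      fix t assume t: "x < t" "t < c"
      then have ti: "a < t" "t < b" "t \<in> {a..b}" using c x by auto
      have "((\<lambda>x. E x * exp (K * x)) has_real_derivative
          2 * y t * z t * (1 - Q t) * exp (K * t) + (K * exp (K * t)) * E t) (at t)"
        using dE[OF ti(3)] at[OF ti(1,2)] by (auto intro!: derivative_eq_intros)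
      moreover have "2 * y t * z t * (1 - Q t) * exp (K * t) + (K * exp (K * t)) * E t =
          (2 * y t * z t * (1 - Q t) + K * E t) * exp (K * t)" by (simp add: algebra_simps)
      moreover have "\<dots> \<ge> 0" using bd[OF ti(3)] by (intro mult_nonneg_nonneg) auto
      ultimately show "\<exists>l. ((\<lambda>x. E x * exp (K * x)) has_real_derivative l) (at t) \<and> l \<ge> 0"
        by metis
    qed
    then show ?thesis using c by (simp add: E_def mult_le_0_iff)
  qed
  then show "y x = 0" by (simp add: E_def sum_power2_le_zero_iff)
qed

text \<open>Made for shooting: joint continuity allows limits in the parameter. The quadratic
  estimate, with one \<open>K\<close> for all parameters, gives positivity on a common interval to
  the right of \<open>a\<close>; there joint continuity alone says nothing, because every solution
  vanishes at \<open>a\<close>.\<close>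

lemma linear_ivp_with_parameter:
  fixes Q :: "real \<Rightarrow> real \<Rightarrow> real"
  assumes "a < b" and "compact T" and Q: "continuous_on (T \<times> {a..b}) (\<lambda>(p, x). Q p x)"
  obtains y z K where "continuous_on (T \<times> {a..b}) (\<lambda>(p, x). y p x)"
    and "\<And>p. p \<in> T \<Longrightarrow> ode_solution a b (Q p) (y p) (z p)"
    and "\<And>p. p \<in> T \<Longrightarrow> y p a = 0" and "\<And>p. p \<in> T \<Longrightarrow> z p a = 1"
    and "\<And>p x. p \<in> T \<Longrightarrow> x \<in> {a..b} \<Longrightarrow> \<bar>y p x - (x - a)\<bar> \<le> K * (x - a)\<^sup>2"
proof -
  have comp: "compact (T \<times> {a..b})" using \<open>compact T\<close> by (intro compact_Times) auto
  obtain M where M0: "M > 0" and M: "\<And>p x. p \<in> T \<Longrightarrow> x \<in> {a..b} \<Longrightarrow> \<bar>Q p x\<bar> \<le> M"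
    using compact_imp_bounded[OF compact_continuous_image[OF Q comp]]
    unfolding bounded_pos by (auto simp: Bex_def)
  define L where "L = b - a"
  have L: "L > 0" using \<open>a < b\<close> by (simp add: L_def)
  define \<kappa> where "\<kappa> = 2 * M * L"
  have \<kappa>: "\<kappa> > 0" using M0 L by (simp add: \<kappa>_def)
  \<comment> \<open>Neumann series; the weight \<open>exp (\<kappa> (x - a))\<close> makes the Volterra operator a contraction with
    factor 1/2.\<close>
  define Y where "Y = rec_nat (\<lambda>p x. x - a)
      (\<lambda>k Yk p x. integral {a..b} (\<lambda>t. max 0 (x - t) * (- Q p t * Yk p t)))"
  have Y0: "Y 0 = (\<lambda>p x. x - a)" by (simp add: Y_def)
  have YS: "Y (Suc k) = (\<lambda>p x. integral {a..b} (\<lambda>t. max 0 (x - t) * (- Q p t * Y k p t)))" for k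
    by (simp add: Y_def)
  have param: "continuous_on (T \<times> {a..b})
      (\<lambda>(p, x). integral {a..b} (\<lambda>t. max 0 (x - t) * (- Q p t * f p t)))"
    if f: "continuous_on (T \<times> {a..b}) (\<lambda>(p, x). f p x)" for f
  proof -
    have "continuous_on (T \<times> {a..b}) (\<lambda>px. integral (cbox a b)
        (\<lambda>t. max 0 (snd px - t) * (- Q (fst px) t * f (fst px) t)))"
    proof (rule integral_continuous_on_param)
      have *: "continuous_on ((T \<times> {a..b}) \<times> cbox a b) (\<lambda>w. (fst (fst w), snd w))"
        by (intro continuous_intros)
      show "continuous_on ((T \<times> {a..b}) \<times> cbox a b)
          (\<lambda>(px, t). max 0 (snd px - t) * (- Q (fst px) t * f (fst px) t))"
        using continuous_on_compose2[OF Q *] continuous_on_compose2[OF f *]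
        unfolding case_prod_beta by (intro continuous_intros) (auto simp: image_subset_iff)
    qed
    then show ?thesis by (simp add: case_prod_beta)
  qed
  have Yc: "continuous_on (T \<times> {a..b}) (\<lambda>(p, x). Y k p x)" for k
  proof (induction k)
    case 0
    show ?case unfolding Y0 case_prod_beta by (intro continuous_intros)
  next
    case (Suc k)
    show ?case unfolding YS by (rule param[OF Suc])
  qed
  have slice: "continuous_on {a..b} (f p)"
    if "continuous_on (T \<times> {a..b}) (\<lambda>(p, x). f p x)" "p \<in> T" for f :: "real \<Rightarrow> real \<Rightarrow> real" and p
  proof -
    have "continuous_on {a..b} (\<lambda>x. (\<lambda>(p, x). f p x) (p, x))"
      by (rule continuous_on_compose2[OF that(1)]) (use that(2) in \<open>auto intro!: continuous_intros\<close>)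
    then show ?thesis by simp
  qed
  have Yb: "\<bar>Y k p x\<bar> \<le> L * (1/2)^k * exp (\<kappa> * (x - a))" if "p \<in> T" "x \<in> {a..b}" for k p x
    using that
  proof (induction k arbitrary: x)
    case 0
    then have "x - a \<le> L * 1" "0 \<le> x - a" by (auto simp: L_def)
    moreover have "L * 1 \<le> L * exp (\<kappa> * (x - a))"
      using L \<kappa> 0 by (intro mult_left_mono) auto
    ultimately show ?case by (simp add: Y0)
  next
    case (Suc k)
    have c: "continuous_on {a..b} (\<lambda>t. - Q p t * Y k p t)"
      by (intro continuous_intros slice[OF Q] slice[OF Yc] Suc.prems)
    have "Y (Suc k) p x = integral {a..x} (\<lambda>t. (x - t) * (- Q p t * Y k p t))"
      unfolding YS by (rule integral_max_kernel[OF c]) (use Suc in auto)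
    also have "norm \<dots> \<le> integral {a..x} (\<lambda>t. L * (M * (L * (1/2)^k * exp (\<kappa> * (t - a)))))"
    proof (rule integral_norm_bound_integral)
      show "(\<lambda>t. (x - t) * (- Q p t * Y k p t)) integrable_on {a..x}"
        by (rule integrable_continuous_real, rule continuous_on_mult, intro continuous_intros,
            rule continuous_on_subset[OF c]) (use Suc.prems in auto)
      show "(\<lambda>t. L * (M * (L * (1/2)^k * exp (\<kappa> * (t - a))))) integrable_on {a..x}"
        by (intro integrable_continuous_real continuous_intros)
      fix t assume t: "t \<in> {a..x}"
      then have t': "t \<in> {a..b}" using Suc.prems by auto
      have "\<bar>x - t\<bar> * (\<bar>Q p t\<bar> * \<bar>Y k p t\<bar>) \<le> L * (M * (L * (1/2)^k * exp (\<kappa> * (t - a))))"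
        using Suc.IH[OF Suc.prems(1) t'] M[OF Suc.prems(1) t'] t Suc.prems M0 L
        by (intro mult_mono) (auto simp: L_def)
      then show "norm ((x - t) * (- Q p t * Y k p t)) \<le> L * (M * (L * (1/2)^k * exp (\<kappa> * (t - a))))"
        by (simp add: abs_mult)
    qed
    also have "\<dots> = L * M * (L * (1/2)^k) * (exp (\<kappa> * (x - a)) / \<kappa> - exp (\<kappa> * (a - a)) / \<kappa>)"
    proof -
      have "((\<lambda>t. exp (\<kappa> * (t - a))) has_integral
          (exp (\<kappa> * (x - a)) / \<kappa> - exp (\<kappa> * (a - a)) / \<kappa>)) {a..x}"
        by (rule fundamental_theorem_of_calculus)
          (use Suc.prems \<kappa> in \<open>auto intro!: derivative_eq_intros
            simp flip: has_real_derivative_iff_has_vector_derivative\<close>)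
      from integral_unique[OF has_integral_mult_right[OF this, of "L * M * (L * (1/2)^k)"]]
      show ?thesis by (simp add: mult.assoc)
    qed
    \<comment> \<open>Integrating the exponential weight gains a factor 1 / \<kappa>, while the
      kernel and \<open>Q\<close> cost \<open>L * M\<close>; the choice of \<kappa> makes the
      product 1/2.\<close>
    also have "\<dots> \<le> L * M * (L * (1/2)^k) * (exp (\<kappa> * (x - a)) / \<kappa>)"
      using L M0 \<kappa> by (intro mult_left_mono) auto
    also have "\<dots> = L * (1/2)^Suc k * exp (\<kappa> * (x - a))"
      using L M0 by (simp add: \<kappa>_def field_simps)
    finally show ?case by simp
  qed
  define C where "C = L * exp (\<kappa> * L)"
  have C: "C > 0" using L by (simp add: C_def)
  have Yb': "\<bar>Y k p x\<bar> \<le> C * (1/2)^k" if "p \<in> T" "x \<in> {a..b}" for k p x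
  proof -
    have "L * (1/2)^k * exp (\<kappa> * (x - a)) \<le> L * (1/2)^k * exp (\<kappa> * L)"
      using that L \<kappa> by (intro mult_left_mono) (auto simp: L_def)
    then show ?thesis using Yb[OF that, of k] by (simp add: C_def mult.assoc mult.commute mult.left_commute)
  qed
  have Csum: "summable (\<lambda>k. C * (1/2)^k)" by (intro summable_mult summable_geometric) auto
  define y where "y p x = (\<Sum>k. Y k p x)" for p x
  have Ysum: "summable (\<lambda>k. Y k p x)" if "p \<in> T" "x \<in> {a..b}" for p x
    by (rule summable_comparison_test'[OF Csum]) (use Yb'[OF that] in auto)
  have yc: "continuous_on (T \<times> {a..b}) (\<lambda>(p, x). y p x)"
  proof (rule uniform_limit_theorem)
    show "uniform_limit (T \<times> {a..b}) (\<lambda>n w. \<Sum>k<n. (case w of (p, x) \<Rightarrow> Y k p x)) (\<lambda>(p, x). y p x) sequentially"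
      unfolding y_def case_prod_beta
      by (rule Weierstrass_m_test[OF _ Csum]) (use Yb' in auto)
    show "\<forall>\<^sub>F n in sequentially. continuous_on (T \<times> {a..b}) (\<lambda>w. \<Sum>k<n. (case w of (p, x) \<Rightarrow> Y k p x))"
      by (intro always_eventually allI continuous_on_sum Yc)
  qed simp
  have eqn: "y p x = (x - a) + integral {a..b} (\<lambda>t. max 0 (x - t) * (- Q p t * y p t))"
    if p: "p \<in> T" and x: "x \<in> {a..b}" for p x
  proof -
    \<comment> \<open>Uniform convergence permits termwise integration, which turns the recursion
      for \<open>Y\<close> into the integral equation for the sum \<open>y\<close>.\<close>
    have ul: "uniform_limit {a..b} (\<lambda>n t. \<Sum>k<n. max 0 (x - t) * (- Q p t * Y k p t))
        (\<lambda>t. \<Sum>k. max 0 (x - t) * (- Q p t * Y k p t)) sequentially"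
    proof (rule Weierstrass_m_test)
      show "summable (\<lambda>k. L * (M * (C * (1/2)^k)))" by (intro summable_mult Csum)
      fix k t assume t: "t \<in> {a..b}"
      have "\<bar>max 0 (x - t)\<bar> * (\<bar>Q p t\<bar> * \<bar>Y k p t\<bar>) \<le> L * (M * (C * (1/2)^k))"
        using Yb'[OF p t] M[OF p t] x t M0 L by (intro mult_mono) (auto simp: L_def)
      then show "norm (max 0 (x - t) * (- Q p t * Y k p t)) \<le> L * (M * (C * (1/2)^k))"
        by (simp add: abs_mult)
    qed
    have lim: "(\<Sum>k. max 0 (x - t) * (- Q p t * Y k p t)) = max 0 (x - t) * (- Q p t * y p t)"
      if t: "t \<in> {a..b}" for t
      unfolding y_def using Ysum[OF p t]
      by (subst suminf_mult, intro summable_mult, assumption)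
         (subst suminf_mult, assumption, rule refl)
    have c: "continuous_on {a..b} (\<lambda>t. max 0 (x - t) * (- Q p t * Y k p t))" for k
      by (intro continuous_intros slice[OF Q] slice[OF Yc] p)
    obtain I J where I: "\<And>n. ((\<lambda>t. \<Sum>k<n. max 0 (x - t) * (- Q p t * Y k p t)) has_integral I n) {a..b}"
      and J: "((\<lambda>t. \<Sum>k. max 0 (x - t) * (- Q p t * Y k p t)) has_integral J) {a..b}"
      and IJ: "I \<longlonglongrightarrow> J"
      by (rule uniform_limit_integral[OF ul continuous_on_sum[OF c] sequentially_bot]) (rule that)
    have "I n = (\<Sum>k<n. Y (Suc k) p x)" for n
      unfolding integral_unique[OF I, symmetric] YS
      by (rule integral_sum, simp, rule integrable_continuous_real, rule c)
    then have "I = (\<lambda>n. \<Sum>k<n. Y (Suc k) p x)" by (rule ext)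
    then have "(\<lambda>k. Y (Suc k) p x) sums J" using IJ by (simp add: sums_def)
    then have "y p x = Y 0 p x + J"
      using suminf_split_head[OF Ysum[OF p x]] by (simp add: y_def sums_iff)
    moreover have "J = integral {a..b} (\<lambda>t. max 0 (x - t) * (- Q p t * y p t))"
      unfolding integral_unique[OF J, symmetric] by (rule integral_cong) (rule lim)
    ultimately show ?thesis by (simp add: Y0)
  qed
  define z where "z p x = 1 + integral {a..x} (\<lambda>t. - Q p t * y p t)" for p x
  have gc: "continuous_on {a..b} (\<lambda>t. - Q p t * y p t)" if "p \<in> T" for p
    by (intro continuous_intros slice[OF Q] slice[OF yc] that)
  \<comment> \<open>A bound on \<open>Q p x * y p x\<close> over the whole compact set: this makes
    the constant of the quadratic estimate independent of the parameter.\<close>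
  have "continuous_on (T \<times> {a..b}) (\<lambda>w. (case w of (p, x) \<Rightarrow> Q p x) * (case w of (p, x) \<Rightarrow> y p x))"
    by (intro continuous_on_mult yc Q)
  from compact_imp_bounded[OF compact_continuous_image[OF this comp]]
  obtain K where K0: "K > 0" and K': "\<forall>v\<in>(\<lambda>w. (case w of (p, x) \<Rightarrow> Q p x) * (case w of (p, x) \<Rightarrow> y p x)) `
      (T \<times> {a..b}). norm v \<le> K"
    unfolding bounded_pos by (elim exE conjE) (rule that)
  have K: "\<bar>Q p x * y p x\<bar> \<le> K" if "p \<in> T" "x \<in> {a..b}" for p x
    using bspec[OF K' imageI[of "(p, x)"]] that by simp
  show ?thesis
  proof (rule that[of y z K])
    show "continuous_on (T \<times> {a..b}) (\<lambda>(p, x). y p x)" by (rule yc)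
    fix p assume p: "p \<in> T"
    show "z p a = 1" by (simp add: z_def)
    show "y p a = 0"
      using eqn[OF p, of a] integral_max_kernel[OF gc[OF p], of a] \<open>a < b\<close> by simp
    show "ode_solution a b (Q p) (y p) (z p)"
      unfolding ode_solution_def
    proof (intro ballI conjI)
      fix x assume x: "x \<in> {a..b}"
      have "((\<lambda>x. (x - a) + integral {a..b} (\<lambda>t. max 0 (x - t) * (- Q p t * y p t))) has_real_derivative
          (1 - 0) + integral {a..x} (\<lambda>t. - Q p t * y p t)) (at x within {a..b})"
        by (intro derivative_intros integral_max_kernel_has_derivative gc p x)
      then show "(y p has_real_derivative z p x) (at x within {a..b})"
        unfolding z_def diff_0_right
        by (rule has_field_derivative_transform_within[where d=1, OF _ _ x eqn[OF p, symmetric]]) simp_all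
      have "((\<lambda>x. 1 + integral {a..x} (\<lambda>t. - Q p t * y p t)) has_real_derivative
          0 + - Q p x * y p x) (at x within {a..b})"
        by (intro derivative_intros integral_has_real_derivative gc p x)
      then show "(z p has_real_derivative - Q p x * y p x) (at x within {a..b})"
        by (simp add: z_def[abs_def])
    qed
    fix x assume x: "x \<in> {a..b}"
    have "\<bar>y p x - (x - a)\<bar> = norm (integral {a..x} (\<lambda>t. (x - t) * (- Q p t * y p t)))"
      using eqn[OF p x] integral_max_kernel[OF gc[OF p] x] by simp
    also have "\<dots> \<le> integral {a..x} (\<lambda>t. (x - a) * K)"
    proof (rule integral_norm_bound_integral)
      show "(\<lambda>t. (x - t) * (- Q p t * y p t)) integrable_on {a..x}"
        by (rule integrable_continuous_real, rule continuous_on_mult, intro continuous_intros,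
            rule continuous_on_subset[OF gc[OF p]]) (use x in auto)
      fix t assume t: "t \<in> {a..x}"
      have "\<bar>x - t\<bar> * \<bar>Q p t * y p t\<bar> \<le> (x - a) * K"
        using K[OF p, of t] t x K0 by (intro mult_mono) auto
      then show "norm ((x - t) * (- Q p t * y p t)) \<le> (x - a) * K" by (simp add: abs_mult)
    qed auto
    also have "\<dots> = K * (x - a)\<^sup>2" using x by (simp add: power2_eq_square)
    finally show "\<bar>y p x - (x - a)\<bar> \<le> K * (x - a)\<^sup>2" .
  qed
qed

section \<open>Nodal intervals, ground states and comparison\<close>

lemma ode_solution_has_derivative_at:
  assumes "ode_solution a b Q y z" "a < x" "x < b"
  shows "(y has_real_derivative z x) (at x)"
proof -
  have "(y has_real_derivative z x) (at x within {a..b})"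
    using assms by (simp add: ode_solution_def)
  then show ?thesis using at_within_Icc_at[of a x b] assms by simp
qed

lemma first_zero_right:
  fixes f :: "real \<Rightarrow> real"
  assumes "continuous_on {x..b} f" "x \<le> b" "f x > 0" "f b \<le> 0"
  obtains q where "x < q" "q \<le> b" "f q = 0" "\<And>t. x \<le> t \<Longrightarrow> t < q \<Longrightarrow> f t > 0"
proof -
  define S where "S = {x..b} \<inter> f -` {..0}"
  have "closed S"
    unfolding S_def by (rule continuous_closed_preimage[OF assms(1)]) auto
  moreover have "bounded S"
    unfolding S_def by (rule bounded_subset[OF bounded_closed_interval Int_lower1])
  ultimately have "compact S" by (simp add: compact_eq_bounded_closed)
  moreover have "b \<in> S" using assms by (simp add: S_def)
  ultimately obtain q where q: "q \<in> S" "\<And>t. t \<in> S \<Longrightarrow> q \<le> t"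
    using compact_attains_inf[of S] by blast
  have qb: "x \<le> q" "q \<le> b" "f q \<le> 0" using q by (auto simp: S_def)
  obtain t where t: "x \<le> t" "t \<le> q" "f t = 0"
    using IVT2'[of f q 0 x] assms(3) qb continuous_on_subset[OF assms(1), of "{x..q}"] by auto
  then have "t \<in> S" using qb by (simp add: S_def)
  then have "f q = 0" using q(2)[of t] t by auto
  moreover have "x < q" using qb \<open>f q = 0\<close> assms(3) by (cases "x = q") auto
  moreover have "f t > 0" if "x \<le> t" "t < q" for t
  proof (rule ccontr)
    assume "\<not> f t > 0"
    then have "t \<in> S" using that qb by (simp add: S_def)
    then show False using q(2)[of t] that by simp
  qed
  ultimately show ?thesis using that qb by blast
qed

text \<open>The interval is the component of the set \<open>f > 0\<close> that contains
  \<open>x\<close>. Its left end is the first zero of the reflected function t -> f (- t).\<close>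

lemma positivity_interval:
  fixes f :: "real \<Rightarrow> real"
  assumes f: "continuous_on {a..b} f" and "f a \<le> 0" "f b \<le> 0" and x: "x \<in> {a..b}" "f x > 0"
  obtains p q where "a \<le> p" "p < x" "x < q" "q \<le> b" "f p = 0" "f q = 0"
    "\<And>t. p < t \<Longrightarrow> t < q \<Longrightarrow> f t > 0"
proof -
  have "continuous_on {x..b} f" by (rule continuous_on_subset[OF f]) (use x in auto)
  then obtain q where q: "x < q" "q \<le> b" "f q = 0" "\<And>t. x \<le> t \<Longrightarrow> t < q \<Longrightarrow> f t > 0"
    using first_zero_right[of x b f] assms by auto
  have "continuous_on {- x..- a} (\<lambda>t. f (- t))"
    by (rule continuous_on_compose2[OF f]) (use x in \<open>auto intro!: continuous_intros\<close>)
  then obtain p where p: "- x < p" "p \<le> - a" "f (- p) = 0"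
      "\<And>t. - x \<le> t \<Longrightarrow> t < p \<Longrightarrow> f (- t) > 0"
    using first_zero_right[of "- x" "- a" "\<lambda>t. f (- t)"] assms by auto
  show ?thesis
  proof (rule that[of "- p" q])
    fix t assume "- p < t" "t < q"
    then show "f t > 0" using p(4)[of "- t"] q(4)[of t] by (cases "t \<le> x") auto
  qed (use p q in auto)
qed

text \<open>With \<open>k = pi / (q - p)\<close> this is the ground state of a constant potential on
  \<open>{p..q}\<close>. It serves as explicit comparison function twice: in the upper bound for the
  ground state energy and in the lower bound for solutions that change sign.\<close>

lemma ode_solution_sine:
  "ode_solution p q (\<lambda>_. k\<^sup>2) (\<lambda>x. sin (k * (x - p))) (\<lambda>x. k * cos (k * (x - p)))"
  unfolding ode_solution_def
proof (intro ballI conjI)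
  fix x
  have lin: "((\<lambda>x. k * (x - p)) has_real_derivative k) (at x within {p..q})"
    using DERIV_cmult[OF DERIV_diff[OF DERIV_ident DERIV_const[of p]], of k x "{p..q}"] by simp
  show "((\<lambda>x. sin (k * (x - p))) has_real_derivative k * cos (k * (x - p))) (at x within {p..q})"
    using DERIV_chain2[OF DERIV_sin lin] by (simp add: mult.commute)
  show "((\<lambda>x. k * cos (k * (x - p))) has_real_derivative - k\<^sup>2 * sin (k * (x - p))) (at x within {p..q})"
    by (rule DERIV_cong[OF DERIV_cmult[OF DERIV_chain2[OF DERIV_cos lin], of k]])
      (simp add: power2_eq_square)
qed

lemma sine_bump_pos:
  fixes p q x :: real
  assumes "p < x" "x < q"
  shows "sin (pi / (q - p) * (x - p)) > 0"
proof (rule sin_gt_zero)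
  show "0 < pi / (q - p) * (x - p)" using assms by simp
  have "(x - p) / (q - p) < 1" using assms by simp
  then have "pi * ((x - p) / (q - p)) < pi * 1" by (intro mult_strict_left_mono) auto
  then show "pi / (q - p) * (x - p) < pi" by simp
qed

lemma ground_state_exists:
  fixes w :: "real \<Rightarrow> real"
  assumes ab: "a < b" and w: "continuous_on {a..b} w" and w1: "\<And>x. x \<in> {a..b} \<Longrightarrow> 1 \<le> w x"
    and \<nu>: "\<nu> > 0"
  obtains lam y z where "lam \<le> \<nu> + (pi / (b - a))\<^sup>2"
    and "ode_solution a b (\<lambda>x. lam * w x - \<nu>) y z" and "y a = 0" and "y b = 0"
    and "\<And>x. a < x \<Longrightarrow> x < b \<Longrightarrow> y x > 0"
proof -
  \<comment> \<open>Shooting: \<open>lam\<close> is the supremum of the parameters in \<open>[0, \<Lambda> + 1]\<close> for which the solution with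
    \<open>y a = 0\<close>, \<open>y' a = 1\<close> stays positive on \<open>(a, b]\<close>.\<close>
  define \<Lambda> where "\<Lambda> = \<nu> + (pi / (b - a))\<^sup>2"
  \<comment> \<open>The supremum \<open>lam\<close> will be at most \<Lambda>; the extra 1 leaves
    parameters in \<open>T\<close> above it, one of which yields the contradiction at the right end
    point.\<close>
  define T where "T = {0..\<Lambda> + 1}"
  have \<Lambda>0: "\<Lambda> \<ge> 0" using \<nu> by (simp add: \<Lambda>_def)
  have Tab: "compact (T \<times> {a..b})" unfolding T_def by (intro compact_Times) auto
  have Qc: "continuous_on (T \<times> {a..b}) (\<lambda>(p, x). p * w x - \<nu>)"
    unfolding case_prod_beta
    by (intro continuous_intros continuous_on_compose2[OF w continuous_on_snd]) auto
  have "compact T" by (simp add: T_def)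
  obtain y z K where yc: "continuous_on (T \<times> {a..b}) (\<lambda>(p, x). y p x)"
    and ode: "\<And>p. p \<in> T \<Longrightarrow> ode_solution a b (\<lambda>x. p * w x - \<nu>) (y p) (z p)"
    and ya: "\<And>p. p \<in> T \<Longrightarrow> y p a = 0"
    and "\<And>p. p \<in> T \<Longrightarrow> z p a = 1"
    and K: "\<And>p x. p \<in> T \<Longrightarrow> x \<in> {a..b} \<Longrightarrow> \<bar>y p x - (x - a)\<bar> \<le> K * (x - a)\<^sup>2"
    by (rule linear_ivp_with_parameter[OF ab \<open>compact T\<close> Qc]) (rule that)
  \<comment> \<open>Since \<open>\<bar>K\<bar> * \<delta> < 1\<close>, the quadratic error is
    smaller than the linear term \<open>x - a\<close> up to \<open>a + \<delta>\<close>, for all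
    parameters at once.\<close>
  define \<delta> where "\<delta> = min (b - a) (1 / (\<bar>K\<bar> + 1))"
  have \<delta>: "0 < \<delta>" "\<delta> \<le> b - a" "\<bar>K\<bar> * \<delta> < 1"
  proof -
    show "0 < \<delta>" "\<delta> \<le> b - a" using ab by (auto simp: \<delta>_def)
    have "\<bar>K\<bar> * \<delta> \<le> \<bar>K\<bar> * (1 / (\<bar>K\<bar> + 1))" by (intro mult_left_mono) (auto simp: \<delta>_def)
    also have "\<dots> < 1" by simp
    finally show "\<bar>K\<bar> * \<delta> < 1" .
  qed
  have near: "y p x > 0" if "p \<in> T" "a < x" "x \<le> a + \<delta>" for p x
  proof -
    have "K * (x - a)\<^sup>2 \<le> \<bar>K\<bar> * (x - a)\<^sup>2" by (intro mult_right_mono) auto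
    also have "\<dots> = (\<bar>K\<bar> * (x - a)) * (x - a)" by (simp add: power2_eq_square)
    also have "\<dots> < 1 * (x - a)"
    proof (rule mult_strict_right_mono)
      have "\<bar>K\<bar> * (x - a) \<le> \<bar>K\<bar> * \<delta>" using that by (intro mult_left_mono) auto
      then show "\<bar>K\<bar> * (x - a) < 1" using \<delta> by simp
    qed (use that in simp)
    finally show ?thesis using K[of p x] that \<delta> by (auto simp: abs_le_iff)
  qed
  have yx: "continuous_on {a..b} (y p)" if "p \<in> T" for p
    using ode_solution_continuous[OF ode[OF that]] by simp
  define G where "G = {p \<in> T. \<forall>x. a < x \<longrightarrow> x \<le> b \<longrightarrow> y p x > 0}"
  have "0 \<in> T" using \<Lambda>0 by (simp add: T_def)
  have "0 \<in> G"
  proof (rule ccontr)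
    assume "0 \<notin> G"
    then obtain x where x: "a < x" "x \<le> b" "y 0 x \<le> 0" using \<open>0 \<in> T\<close> by (auto simp: G_def not_less)
    define x0 where "x0 = min x (a + \<delta>)"
    have x0: "y 0 x0 > 0" "a < x0" "x0 \<le> x"
      using near[OF \<open>0 \<in> T\<close>, of x0] x \<delta> by (auto simp: x0_def)
    have c: "continuous_on {a..x} (y 0)"
      by (rule continuous_on_subset[OF yx[OF \<open>0 \<in> T\<close>]]) (use x in auto)
    obtain p q where pq: "a \<le> p" "p < x0" "x0 < q" "q \<le> x" "y 0 p = 0" "y 0 q = 0"
        "\<And>t. p < t \<Longrightarrow> t < q \<Longrightarrow> y 0 t > 0"
      using positivity_interval[OF c, of x0] x x0 ya[OF \<open>0 \<in> T\<close>] by auto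
    \<comment> \<open>For the parameter 0 the potential is - \<nu> < 0. Comparison with the constant
      solution 1 of y'' = 0 shows that the solution cannot return to zero.\<close>
    have "ode_solution p q (\<lambda>_. 0) (\<lambda>_. 1) (\<lambda>_. 0)"
      by (auto simp: ode_solution_def)
    from sturm_comparison[OF _ ode_solution_subset[OF ode[OF \<open>0 \<in> T\<close>]] this pq(5,6,7)]
    show False using pq x \<nu> by auto
  qed
  \<comment> \<open>Above \<Lambda> the potential exceeds (pi / (b - a))^2 everywhere because
    \<open>w\<close> is at least 1, so comparison with the sine forces a zero in the
    interior.\<close>
  have GL: "p \<le> \<Lambda>" if p: "p \<in> G" for p
  proof (rule ccontr)
    assume "\<not> p \<le> \<Lambda>"
    have "\<exists>t. a < t \<and> t < b \<and> p * w t - \<nu> \<le> (pi / (b - a))\<^sup>2"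
    proof (rule sturm_comparison[OF ab ode_solution_sine[where k="pi / (b - a)"] ode])
      show "p \<in> T" using p by (simp add: G_def)
      show "0 < y p x" if "a < x" "x < b" for x using p that by (simp add: G_def)
    qed (use sine_bump_pos[of a _ b] ab in auto)
    then obtain t where t: "a < t" "t < b" "p * w t \<le> \<Lambda>" by (auto simp: \<Lambda>_def)
    have "p * 1 \<le> p * w t" using t w1[of t] \<Lambda>0 \<open>\<not> p \<le> \<Lambda>\<close> by (intro mult_left_mono) auto
    then show False using t \<open>\<not> p \<le> \<Lambda>\<close> by simp
  qed
  define lam where "lam = Sup G"
  have bdd: "bdd_above G" using GL by (auto intro!: bdd_aboveI)
  have lam: "lam \<le> \<Lambda>" "0 \<le> lam"
    unfolding lam_def using GL \<open>0 \<in> G\<close> bdd by (auto intro!: cSup_least cSup_upper)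
  then have lT: "lam \<in> T" by (simp add: T_def)
  have unif: "\<exists>d>0. \<forall>p\<in>T. \<bar>p - lam\<bar> < d \<longrightarrow> (\<forall>x\<in>{a..b}. \<bar>y p x - y lam x\<bar> < e)"
    if "e > 0" for e
  proof -
    have "uniformly_continuous_on (T \<times> {a..b}) (\<lambda>(p, x). y p x)"
      by (rule compact_uniformly_continuous[OF yc Tab])
    then obtain d where d: "d > 0"
      "\<And>v v'. v \<in> T \<times> {a..b} \<Longrightarrow> v' \<in> T \<times> {a..b} \<Longrightarrow> dist v' v < d \<Longrightarrow>
         dist (case v' of (p, x) \<Rightarrow> y p x) (case v of (p, x) \<Rightarrow> y p x) < e"
      using \<open>e > 0\<close> unfolding uniformly_continuous_on_def by metis
    show ?thesis
      using d(1) d(2)[of "(lam, x)" "(p, x)" for p x] lT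
      by (intro exI[of _ d]) (auto simp: dist_Pair_Pair dist_real_def)
  qed
  \<comment> \<open>A negative value would persist for parameters close to \<open>lam\<close>, but
    elements of \<open>G\<close> come arbitrarily close to the supremum.\<close>
  have nonneg: "y lam x \<ge> 0" if x: "a < x" "x \<le> b" for x
  proof (rule ccontr)
    assume neg: "\<not> y lam x \<ge> 0"
    then obtain d where d: "d > 0"
      "\<And>p. p \<in> T \<Longrightarrow> \<bar>p - lam\<bar> < d \<Longrightarrow> \<bar>y p x - y lam x\<bar> < - y lam x"
      using unif[of "- y lam x"] x by (auto simp: Ball_def)
    obtain p where p: "p \<in> G" "lam - d < p"
      using less_cSup_iff[of G "lam - d"] \<open>0 \<in> G\<close> bdd \<open>d > 0\<close> by (auto simp: lam_def)
    have "p \<le> lam" unfolding lam_def using p bdd by (intro cSup_upper)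
    then have "\<bar>y p x - y lam x\<bar> < - y lam x" using p d(2)[of p] by (auto simp: G_def)
    moreover have "y p x > 0" using p x by (simp add: G_def)
    ultimately show False using neg by simp
  qed
  \<comment> \<open>An interior zero of a nonnegative solution is a minimum, hence a double zero,
    and uniqueness would make the solution vanish at \<open>a + \<delta>\<close> as well.\<close>
  have pos: "y lam x > 0" if x: "a < x" "x < b" for x
  proof (rule ccontr)
    assume "\<not> y lam x > 0"
    then have y0: "y lam x = 0" using nonneg[of x] x by simp
    have "(y lam has_real_derivative z lam x) (at x)"
      using ode_solution_has_derivative_at[OF ode[OF lT] x] .
    then have "z lam x = 0"
      using x nonneg by (intro DERIV_local_min[of _ _ x "min (x - a) (b - x)"]) (auto simp: y0)
    moreover have "continuous_on {a..b} (\<lambda>x. lam * w x - \<nu>)" by (intro continuous_intros w)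
    ultimately have "y lam (a + \<delta>) = 0"
      using ode_solution_unique_zero[OF ode[OF lT], of x "a + \<delta>"] y0 x \<delta> by auto
    then show False using near[OF lT, of "a + \<delta>"] \<delta> by simp
  qed
  \<comment> \<open>Otherwise the solution has a positive minimum on
    \<open>{a + \<delta>..b}\<close>. Slightly larger parameters then stay positive there by uniform
    continuity and left of \<open>a + \<delta>\<close> by the choice of \<delta>, contrary to the
    supremum.\<close>
  have "y lam b = 0"
  proof (rule ccontr)
    assume "y lam b \<noteq> 0"
    then have pos': "y lam x > 0" if "a < x" "x \<le> b" for x
      using pos[of x] nonneg[of x] that by (cases "x = b") auto
    have "continuous_on {a + \<delta>..b} (y lam)"
      by (rule continuous_on_subset[OF yx[OF lT]]) (use \<delta> in auto)
    then obtain xm where xm: "xm \<in> {a + \<delta>..b}" "\<And>x. x \<in> {a + \<delta>..b} \<Longrightarrow> y lam xm \<le> y lam x"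
      using continuous_attains_inf[of "{a + \<delta>..b}" "y lam"] \<delta> by auto
    have "y lam xm > 0" using xm \<delta> by (intro pos') auto
    then obtain d where d: "d > 0"
      "\<And>p x. p \<in> T \<Longrightarrow> \<bar>p - lam\<bar> < d \<Longrightarrow> x \<in> {a..b} \<Longrightarrow> \<bar>y p x - y lam x\<bar> < y lam xm"
      using unif[of "y lam xm"] by blast
    define p where "p = lam + min (d / 2) 1"
    have p: "p \<in> T" "\<bar>p - lam\<bar> < d" "lam < p" using d(1) lam by (auto simp: p_def T_def)
    have "y p x > 0" if x: "a < x" "x \<le> b" for x
    proof (cases "x \<le> a + \<delta>")
      case False
      then show ?thesis using d(2)[OF p(1,2), of x] xm(2)[of x] x by auto
    qed (use near p x in auto)
    then have "p \<in> G" using p by (simp add: G_def)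
    then have "p \<le> lam" unfolding lam_def using bdd by (intro cSup_upper)
    then show False using p by simp
  qed
  then show ?thesis using that[of lam "y lam" "z lam"] lam ode[OF lT] ya[OF lT] pos by (auto simp: \<Lambda>_def)
qed

text \<open>Sturm comparison on one nodal interval of \<open>f\<close> or of \<open>- f\<close>; no
  sign condition on \<open>f\<close> is left, and \<open>g\<close> is positive on the smaller
  interval too.\<close>

lemma dirichlet_solution_comparison:
  assumes "ode_solution a b P f f'" and "ode_solution a b Q g g'"
    and "f a = 0" "f b = 0" and "x \<in> {a..b}" "f x \<noteq> 0"
    and "\<And>x. a < x \<Longrightarrow> x < b \<Longrightarrow> g x > 0"
  shows "\<exists>t. a < t \<and> t < b \<and> Q t \<le> P t"
proof -
  have pos: ?thesis if f: "ode_solution a b P f f'" "f a = 0" "f b = 0" "f x > 0" for f f'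
  proof -
    obtain p q where pq: "a \<le> p" "p < x" "x < q" "q \<le> b" "f p = 0" "f q = 0"
        "\<And>t. p < t \<Longrightarrow> t < q \<Longrightarrow> f t > 0"
      using positivity_interval[OF ode_solution_continuous(1)[OF f(1)], of x] f assms(5) by auto
    have "\<exists>t. p < t \<and> t < q \<and> Q t \<le> P t"
      by (rule sturm_comparison[OF _ ode_solution_subset[OF f(1)] ode_solution_subset[OF assms(2)] pq(5,6,7)])
        (use pq assms(7) in auto)
    then obtain t where "p < t" "t < q" "Q t \<le> P t" by blast
    then show ?thesis using pq by (intro exI[of _ t]) auto
  qed
  show ?thesis
    using pos[OF assms(1,3,4)] pos[OF ode_solution_uminus[OF assms(1)]] assms(3,4,6)
    by (cases "f x > 0") auto
qed

text \<open>The derivative form of "a nonnegative function with integral zero vanishes": a monotone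
  \<open>h\<close> with zero end values is constant. It is applied to Wronskians.\<close>

lemma zero_deriv_if_monotone_and_zero_ends:
  fixes h :: "real \<Rightarrow> real"
  assumes d: "\<And>x. x \<in> {a..b} \<Longrightarrow> (h has_real_derivative h' x) (at x within {a..b})"
    and nn: "\<And>x. x \<in> {a..b} \<Longrightarrow> h' x \<ge> 0" and "h a = 0" "h b = 0" and x: "a < x" "x < b"
  shows "h' x = 0"
proof -
  have at: "(h has_real_derivative h' t) (at t)" if "a < t" "t < b" for t
    using d[of t] that at_within_Icc_at[of a t b] by simp
  have hc: "continuous_on {a..b} h" by (rule DERIV_continuous_on) (rule d)
  have mono: "h s \<le> h t" if st: "a \<le> s" "s \<le> t" "t \<le> b" for s t
  proof (rule DERIV_nonneg_imp_increasing_open[OF st(2)])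
    show "continuous_on {s..t} h" by (rule continuous_on_subset[OF hc]) (use st in auto)
    show "\<exists>y. (h has_real_derivative y) (at r) \<and> 0 \<le> y" if "s < r" "r < t" for r
      using at[of r] nn[of r] st that by (intro exI[of _ "h' r"]) auto
  qed
  have "h t = 0" if "a < t" "t < b" for t using mono[of a t] mono[of t b] that assms by auto
  then have "\<forall>\<^sub>F t in nhds x. h t = 0"
    using eventually_nhds_in_open[of "{a<..<b}" x] x by (auto elim!: eventually_mono)
  then have "(h has_real_derivative 0) (at x)"
    using DERIV_cong_ev[OF refl, of h "\<lambda>_. 0" x 0 0] by auto
  then show ?thesis using at[OF x] DERIV_unique by blast
qed

text \<open>For equal parameters the Wronskian is identically zero, so \<open>f x / g x\<close> is
  constant. For different parameters a solution \<open>f\<close> of one sign makes the Wronskian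
  monotone with zero end values, which forces \<open>f * g = 0\<close>. A solution that changes sign
  has two disjoint nodal intervals, and the shorter one has at most half the length.\<close>

lemma dirichlet_solution_cases:
  fixes w :: "real \<Rightarrow> real"
  assumes ab: "a < b"
    and f: "ode_solution a b (\<lambda>x. \<mu> * w x - \<nu>) f f'" "f a = 0" "f b = 0"
    and g: "ode_solution a b (\<lambda>x. lam * w x - \<nu>) g g'" "g a = 0" "g b = 0"
    and gpos: "\<And>x. a < x \<Longrightarrow> x < b \<Longrightarrow> g x > 0"
    and w: "\<And>x. x \<in> {a..b} \<Longrightarrow> 1 \<le> w x \<and> w x \<le> 2" and \<nu>: "\<nu> > 0"
  shows "(\<mu> = lam \<and> (\<exists>k. \<forall>x\<in>{a..b}. f x = k * g x)) \<or> (\<forall>x\<in>{a..b}. f x = 0) \<or>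
         (2 * pi / (b - a))\<^sup>2 + \<nu> \<le> 2 * \<mu>"
proof -
  have dW: "((\<lambda>x. f' x * g x - f x * g' x) has_real_derivative ((lam - \<mu>) * w x) * (f x * g x))
      (at x within {a..b})" if "x \<in> {a..b}" for x
    using wronskian_has_derivative[OF f(1) g(1) that] by (simp add: algebra_simps)
  have gnn: "g x \<ge> 0" if "x \<in> {a..b}" for x
    using gpos[of x] g that by (cases "x = a"; cases "x = b") auto
  show ?thesis
  proof (cases "\<mu> = lam")
    case True
    have "\<exists>c. \<forall>x\<in>{a..b}. f' x * g x - f x * g' x = c"
      using dW True by (intro has_field_derivative_zero_constant) auto
    then obtain c where c: "\<And>x. x \<in> {a..b} \<Longrightarrow> f' x * g x - f x * g' x = c" by blast
    then have W0: "f' x * g x - f x * g' x = 0" if "x \<in> {a..b}" for x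
      using c[OF that] c[of a] f(2) g(2) ab by simp
    have "\<exists>k. \<forall>x\<in>{a<..<b}. f x / g x = k"
    proof (rule has_field_derivative_zero_constant)
      fix x assume x: "x \<in> {a<..<b}"
      then have "(f has_real_derivative f' x) (at x)" "(g has_real_derivative g' x) (at x)"
        using ode_solution_has_derivative_at f(1) g(1) by auto
      moreover have "g x \<noteq> 0" using gpos[of x] x by auto
      ultimately have "((\<lambda>x. f x / g x) has_real_derivative 0) (at x)"
        using W0[of x] x by (auto intro!: derivative_eq_intros)
      then show "((\<lambda>x. f x / g x) has_real_derivative 0) (at x within {a<..<b})"
        by (rule has_field_derivative_at_within)
    qed simp
    then obtain k where k: "\<And>x. a < x \<Longrightarrow> x < b \<Longrightarrow> f x / g x = k" by auto
    have "f x = k * g x" if "x \<in> {a..b}" for x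
      using k[of x] gpos[of x] that f g by (cases "x = a"; cases "x = b") (auto simp: field_simps)
    then show ?thesis using True by blast
  next
    case False
    have signed: "\<forall>x\<in>{a..b}. f x = 0"
      if f: "ode_solution a b (\<lambda>x. \<mu> * w x - \<nu>) f f'" "f a = 0" "f b = 0"
        and fnn: "\<And>x. x \<in> {a..b} \<Longrightarrow> f x \<ge> 0" for f f'
    proof
      fix x assume x: "x \<in> {a..b}"
      \<comment> \<open>The sign turns the Wronskian into an increasing function whichever of the
        two parameters is larger.\<close>
      define \<sigma> where "\<sigma> = sgn (lam - \<mu>)"
      have \<sigma>: "\<sigma> * (lam - \<mu>) > 0" using False by (auto simp: \<sigma>_def sgn_if)
      have dW: "((\<lambda>x. \<sigma> * (f' x * g x - f x * g' x)) has_real_derivative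
          (\<sigma> * (lam - \<mu>)) * (w x * (f x * g x))) (at x within {a..b})" if "x \<in> {a..b}" for x
        using DERIV_cmult[OF wronskian_has_derivative[OF f(1) g(1) that], of \<sigma>] by (simp add: algebra_simps)
      have nn: "(\<sigma> * (lam - \<mu>)) * (w x * (f x * g x)) \<ge> 0" if x: "x \<in> {a..b}" for x
      proof (rule mult_nonneg_nonneg[OF less_imp_le[OF \<sigma>]])
        show "0 \<le> w x * (f x * g x)" using w[OF x] fnn[OF x] gnn[OF x] by simp
      qed
      have "(\<sigma> * (lam - \<mu>)) * (w x * (f x * g x)) = 0" if "a < x" "x < b"
        by (rule zero_deriv_if_monotone_and_zero_ends[OF dW nn])
          (use that f(2,3) g(2,3) in auto)
      then show "f x = 0"
        using \<sigma> w[OF x] gpos[of x] x f(2,3) by (cases "x = a"; cases "x = b") auto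
    qed
    show ?thesis
    proof (cases "(\<forall>x\<in>{a..b}. f x \<ge> 0) \<or> (\<forall>x\<in>{a..b}. f x \<le> 0)")
      case True
      then have "\<forall>x\<in>{a..b}. f x = 0"
      proof
        assume "\<forall>x\<in>{a..b}. f x \<ge> 0"
        then show ?thesis by (intro signed[OF f]) blast
      next
        assume "\<forall>x\<in>{a..b}. f x \<le> 0"
        then have "\<forall>x\<in>{a..b}. - f x = 0"
          by (intro signed[OF ode_solution_uminus[OF f(1)]]) (simp_all add: f(2,3))
        then show ?thesis by simp
      qed
      then show ?thesis by blast
    next
      case False
      then obtain x1 x2 where x: "x1 \<in> {a..b}" "f x1 > 0" "x2 \<in> {a..b}" "f x2 < 0"
        by (auto simp: not_le)
      obtain p q where pq: "a \<le> p" "p < x1" "x1 < q" "q \<le> b" "f p = 0" "f q = 0"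
          "\<And>t. p < t \<Longrightarrow> t < q \<Longrightarrow> f t > 0"
        using positivity_interval[OF ode_solution_continuous(1)[OF f(1)], of x1] f x by auto
      obtain r s where rs: "a \<le> r" "r < x2" "x2 < s" "s \<le> b" "f r = 0" "f s = 0"
          "\<And>t. r < t \<Longrightarrow> t < s \<Longrightarrow> - f t > 0"
        using positivity_interval[OF ode_solution_continuous(1)[OF ode_solution_uminus[OF f(1)]], of x2] f x
        by auto
      have disj: "q \<le> r \<or> s \<le> p"
      proof (rule ccontr)
        assume "\<not> ?thesis"
        then have "max p r < min q s" using pq rs by auto
        then obtain t where "max p r < t" "t < min q s" using dense by blast
        then show False using pq(7)[of t] rs(7)[of t] by auto
      qed
      \<comment> \<open>Stated for an arbitrary solution, because the shorter nodal interval may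
        belong to \<open>f\<close> or to its negative.\<close>
      have short: ?thesis
        if pq: "a \<le> p" "p < q" "q \<le> b" "f p = 0" "f q = 0" "\<And>t. p < t \<Longrightarrow> t < q \<Longrightarrow> f t > 0"
          and len: "q - p \<le> (b - a) / 2" and f: "ode_solution a b (\<lambda>x. \<mu> * w x - \<nu>) f f'"
        for p q f f'
      proof -
        have "\<exists>t. p < t \<and> t < q \<and> (pi / (q - p))\<^sup>2 \<le> \<mu> * w t - \<nu>"
          by (rule sturm_comparison[OF pq(2) ode_solution_subset[OF f pq(1,3)]
                ode_solution_sine[where k="pi / (q - p)"] pq(4,5)])
            (use pq(6) sine_bump_pos in auto)
        then obtain t where t: "p < t" "t < q" "(pi / (q - p))\<^sup>2 \<le> \<mu> * w t - \<nu>" by blast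
        have "pi * (2 * (q - p)) \<le> pi * (b - a)" using len by (intro mult_left_mono) auto
        then have "2 * pi / (b - a) \<le> pi / (q - p)" using pq(2) ab by (simp add: field_simps)
        then have "(2 * pi / (b - a))\<^sup>2 \<le> (pi / (q - p))\<^sup>2" using ab by (intro power_mono) auto
        then have le: "(2 * pi / (b - a))\<^sup>2 + \<nu> \<le> \<mu> * w t" using t by simp
        have wt: "1 \<le> w t" "w t \<le> 2" using w[of t] t pq by auto
        \<comment> \<open>The sign of \<mu> has to be settled before \<open>w t \<le> 2\<close> can
          be multiplied by it.\<close>
        have "0 < \<mu> * w t" using le \<nu> by (smt (verit) zero_le_power2)
        then have "\<mu> > 0" using wt by (simp add: zero_less_mult_iff)
        then have "\<mu> * w t \<le> \<mu> * 2" using wt by (intro mult_left_mono) auto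
        then show ?thesis using le by simp
      qed
      show ?thesis
      proof (cases "q - p \<le> (b - a) / 2")
        case True
        then show ?thesis using short[OF pq(1) _ pq(4-7) _ f(1)] pq by simp
      next
        case False
        then have "s - r \<le> (b - a) / 2" using disj pq rs by auto
        then show ?thesis using short[OF rs(1) _ rs(4) _ _ rs(7) _ ode_solution_uminus[OF f(1)]] rs by simp
      qed
    qed
  qed
qed

section \<open>Completeness of the sine system\<close>

text \<open>The products sin (n c s) cos (c s)^m are combinations of sines, so \<open>g\<close> is
  orthogonal to sin (c s) times every polynomial in cos (c s). Since cos is injective on [0, pi],
  \<open>g\<close> itself is a uniform limit of such polynomials. Hence the integral of sin (c s)
  g(s)^2 is zero, and the weight is positive inside.\<close>

lemma sine_coefficients_determine:
  fixes g :: "real \<Rightarrow> real"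
  assumes c: "c > 0" and g: "continuous_on {0..pi / c} g"
    and coeff: "\<And>n :: nat. n \<ge> 1 \<Longrightarrow> integral {0..pi / c} (\<lambda>s. g s * sin (real n * c * s)) = 0"
    and s: "0 < s" "s < pi / c"
  shows "g s = 0"
proof -
  define S where "S = pi / c"
  have S: "S > 0" using c by (simp add: S_def)
  have gS: "continuous_on {0..S} g" using g by (simp add: S_def)
  have intc: "continuous_on {0..S} h \<Longrightarrow> (\<lambda>s. g s * h s) integrable_on {0..S}" for h
    by (intro integrable_continuous_real continuous_intros gS)
  \<comment> \<open>One factor cosine replaces the frequency n by the average of n + 1 and n - 1, so
    n varies in the induction. The trivial frequency 0 is included because it arises from n =
    1.\<close>
  have pow: "integral {0..S} (\<lambda>s. g s * (sin (real n * c * s) * cos (c * s) ^ m)) = 0" for n m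
  proof (induction m arbitrary: n)
    case 0
    then show ?case using coeff[of n] by (cases "n = 0") (auto simp: S_def)
  next
    case (Suc m)
    show ?case
    proof (cases "n = 0")
      case False
      define n' where "n' = n - 1"
      have n: "n = Suc n'" using False by (simp add: n'_def)
      have id: "g s * (sin (real n * c * s) * cos (c * s) ^ Suc m) =
          (1/2) * (g s * (sin (real (Suc n) * c * s) * cos (c * s) ^ m) +
                   g s * (sin (real n' * c * s) * cos (c * s) ^ m))" for s
      proof -
        have "sin (real (Suc n) * c * s) + sin (real n' * c * s) = 2 * sin (real n * c * s) * cos (c * s)"
        proof -
          have "real (Suc n) * c * s = real n * c * s + c * s" "real n' * c * s = real n * c * s - c * s"
            by (simp_all add: n algebra_simps)
          then show ?thesis by (simp only: sin_add sin_diff)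
        qed
        then have "g s * cos (c * s) ^ m * (sin (real (Suc n) * c * s) + sin (real n' * c * s)) =
            g s * cos (c * s) ^ m * (2 * sin (real n * c * s) * cos (c * s))" by simp
        then show ?thesis by (simp add: algebra_simps)
      qed
      have "integral {0..S} (\<lambda>s. g s * (sin (real n * c * s) * cos (c * s) ^ Suc m)) =
          (1/2) * (integral {0..S} (\<lambda>s. g s * (sin (real (Suc n) * c * s) * cos (c * s) ^ m)) +
            integral {0..S} (\<lambda>s. g s * (sin (real n' * c * s) * cos (c * s) ^ m)))"
        unfolding id
        by (subst integral_mult_right, subst Henstock_Kurzweil_Integration.integral_add)
          (auto intro!: intc continuous_intros)
      then show ?thesis by (simp only: Suc.IH) simp
    qed auto
  qed
  have poly: "integral {0..S} (\<lambda>s. g s * (sin (c * s) * (\<Sum>i\<le>k. a i * cos (c * s) ^ i))) = 0"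
    for a :: "nat \<Rightarrow> real" and k
  proof -
    have "integral {0..S} (\<lambda>s. g s * (sin (c * s) * (\<Sum>i\<le>k. a i * cos (c * s) ^ i))) =
        integral {0..S} (\<lambda>s. \<Sum>i\<le>k. a i * (g s * (sin (c * s) * cos (c * s) ^ i)))"
      by (simp add: sum_distrib_left mult.left_commute)
    also have "\<dots> = (\<Sum>i\<le>k. integral {0..S} (\<lambda>s. a i * (g s * (sin (c * s) * cos (c * s) ^ i))))"
      by (intro integral_sum finite_atMost integrable_on_mult_right intc continuous_intros)
    also have "\<dots> = 0" using pow[of 1] by simp
    finally show ?thesis .
  qed
  obtain B where B: "B > 0" "\<And>s. s \<in> {0..S} \<Longrightarrow> \<bar>g s\<bar> \<le> B"
    using compact_imp_bounded[OF compact_continuous_image[OF gS compact_Icc]]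
    unfolding bounded_pos by (metis imageI real_norm_def)
  have cs: "c * s \<in> {0..pi}" if "s \<in> {0..S}" for s
    using that c by (simp add: S_def field_simps)
  have "\<bar>integral {0..S} (\<lambda>s. g s * (sin (c * s) * g s))\<bar> \<le> e" if e: "e > 0" for e
  proof -
    define \<epsilon> where "\<epsilon> = e / (B * S)"
    have \<epsilon>: "\<epsilon> > 0" using e B S by (simp add: \<epsilon>_def)
    \<comment> \<open>The substitution x = cos (c s) carries \<open>g\<close> to a continuous
      function on \<open>{-1..1}\<close>, where polynomials are dense.\<close>
    have cg: "continuous_on {-1..1} (\<lambda>x. g (arccos x / c))"
      by (rule continuous_on_compose2[OF gS])
        (use c arccos_lbound arccos_ubound in \<open>auto intro!: continuous_intros continuous_on_arccos simp: S_def field_simps\<close>)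
    obtain P where "real_polynomial_function P"
      and P: "\<And>x. x \<in> {-1..1} \<Longrightarrow> \<bar>g (arccos x / c) - P x\<bar> < \<epsilon>"
      using Stone_Weierstrass_real_polynomial_function[OF _ cg \<epsilon>] by auto
    then obtain a k where Pk: "P = (\<lambda>x. \<Sum>i\<le>k. a i * x ^ i)"
      unfolding real_polynomial_function_iff_sum by blast
    have close: "\<bar>g s - P (cos (c * s))\<bar> \<le> \<epsilon>" if "s \<in> {0..S}" for s
      using P[of "cos (c * s)"] cs[OF that] c by (simp add: arccos_cos)
    have "integral {0..S} (\<lambda>s. g s * (sin (c * s) * g s)) =
        integral {0..S} (\<lambda>s. g s * (sin (c * s) * g s)) - integral {0..S} (\<lambda>s. g s * (sin (c * s) * P (cos (c * s))))"
      using poly[of a k] by (simp add: Pk)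
    also have "\<dots> = integral {0..S} (\<lambda>s. g s * (sin (c * s) * g s) - g s * (sin (c * s) * P (cos (c * s))))"
      unfolding Pk by (intro integral_diff[symmetric] intc continuous_intros gS)
    also have "norm \<dots> \<le> integral {0..S} (\<lambda>s. B * (1 * \<epsilon>))"
    proof (rule integral_norm_bound_integral)
      show "(\<lambda>s. g s * (sin (c * s) * g s) - g s * (sin (c * s) * P (cos (c * s)))) integrable_on {0..S}"
        unfolding Pk by (intro integrable_diff intc continuous_intros gS)
      fix s assume s: "s \<in> {0..S}"
      have "\<bar>g s\<bar> * (\<bar>sin (c * s)\<bar> * \<bar>g s - P (cos (c * s))\<bar>) \<le> B * (1 * \<epsilon>)"
        using B s close[OF s] by (intro mult_mono) auto
      then show "norm (g s * (sin (c * s) * g s) - g s * (sin (c * s) * P (cos (c * s)))) \<le> B * (1 * \<epsilon>)"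
        by (simp add: abs_mult[symmetric] right_diff_distrib)
    qed auto
    also have "\<dots> = e" using B S by (simp add: \<epsilon>_def)
    finally show ?thesis by simp
  qed
  then have "\<bar>integral {0..S} (\<lambda>s. g s * (sin (c * s) * g s))\<bar> \<le> 0"
    by (rule dense_ge)
  then have "integral {0..S} (\<lambda>s. g s * (sin (c * s) * g s)) = 0" by simp
  moreover have "continuous_on {0..S} (\<lambda>s. g s * (sin (c * s) * g s))" by (intro continuous_intros gS)
  moreover have "g s * (sin (c * s) * g s) \<ge> 0" if "s \<in> {0..S}" for s
  proof -
    have "sin (c * s) * (g s * g s) \<ge> 0" using cs[OF that]
      by (intro mult_nonneg_nonneg[OF sin_ge_zero]) auto
    then show ?thesis by (simp add: mult.left_commute)
  qed
  ultimately have "g s * (sin (c * s) * g s) = 0"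
    using integral_eq_0_iff[of 0 S "\<lambda>s. g s * (sin (c * s) * g s)"] S s by (auto simp: S_def)
  moreover have "sin (c * s) > 0" using s c by (intro sin_gt_zero) (auto simp: field_simps)
  ultimately show "g s = 0" by simp
qed

section \<open>The equation for the sine coefficients\<close>

text \<open>The conclusion is a relation between three values of \<open>P\<close> and contains
  neither a derivative nor a division, so it survives limits in which derivatives are not
  controlled.\<close>

lemma affine_if_second_derivative_zero:
  fixes P p :: "real \<Rightarrow> real"
  assumes ab: "a < b" and c: "continuous_on {a..b} P"
    and P: "\<And>x. a < x \<Longrightarrow> x < b \<Longrightarrow> (P has_real_derivative p x) (at x)"
    and p: "\<And>x. a < x \<Longrightarrow> x < b \<Longrightarrow> (p has_real_derivative 0) (at x)"
    and x: "x \<in> {a..b}"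
  shows "(b - a) * P x = (b - x) * P a + (x - a) * P b"
proof -
  have "\<exists>c. \<forall>x\<in>{a<..<b}. p x = c"
    by (rule has_field_derivative_zero_constant) (auto intro: has_field_derivative_at_within p)
  then obtain C where C: "\<And>x. a < x \<Longrightarrow> x < b \<Longrightarrow> p x = C" by auto
  have const: "P y - C * y = P a - C * a" if y: "y \<in> {a..b}" for y
  proof (rule DERIV_isconst2[OF ab, of "\<lambda>y. P y - C * y"])
    show "continuous_on {a..b} (\<lambda>y. P y - C * y)" by (intro continuous_intros c)
    fix x assume x: "a < x" "x < b"
    have "((\<lambda>y. P y - C * y) has_real_derivative p x - C * 1) (at x)"
      by (intro DERIV_diff P x DERIV_cmult DERIV_ident)
    then show "((\<lambda>y. P y - C * y) has_real_derivative 0) (at x)" using C[OF x] by simp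
  qed (use y in auto)
  have Px: "P x = P a + C * (x - a)" using const[OF x] by (simp add: algebra_simps)
  have Pb: "P b = P a + C * (b - a)" using const[of b] ab by (simp add: algebra_simps)
  show ?thesis unfolding Px Pb by (simp add: algebra_simps)
qed

text \<open>The rescaling \<open>s = S/2 + (1 - d) (t - S/2)\<close> pushes the domain of integration into the interior,
  where \<open>v\<close> is smooth, while \<open>sin (k t)\<close> still vanishes at both ends. Hence only values of \<open>v\<close>, and
  no normal derivatives, survive in the boundary terms, and \<open>d \<rightarrow> 0\<close> is harmless.\<close>

lemma sine_coefficient_ode:
  fixes v vs vss vt vtt :: "real \<Rightarrow> real \<Rightarrow> real" and w :: "real \<Rightarrow> real" and n :: nat
  assumes c: "c > 0" and ab: "a < b" and S: "S = pi / c" and k: "k = real n * c"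
    and vc: "continuous_on ({0..S} \<times> {a..b}) (\<lambda>(s, t). v s t)"
    and v0: "\<And>t. t \<in> {a..b} \<Longrightarrow> v 0 t = 0" "\<And>t. t \<in> {a..b} \<Longrightarrow> v S t = 0"
    and va: "\<And>s. s \<in> {0..S} \<Longrightarrow> v s a = 0" "\<And>s. s \<in> {0..S} \<Longrightarrow> v s b = 0"
    and dvs: "\<And>s t. s \<in> {0<..<S} \<Longrightarrow> t \<in> {a<..<b} \<Longrightarrow> ((\<lambda>s. v s t) has_real_derivative vs s t) (at s)"
    and dvss: "\<And>s t. s \<in> {0<..<S} \<Longrightarrow> t \<in> {a<..<b} \<Longrightarrow> ((\<lambda>s. vs s t) has_real_derivative vss s t) (at s)"
    and dvt: "\<And>s t. s \<in> {0<..<S} \<Longrightarrow> t \<in> {a<..<b} \<Longrightarrow> ((\<lambda>t. v s t) has_real_derivative vt s t) (at t)"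
    and dvtt: "\<And>s t. s \<in> {0<..<S} \<Longrightarrow> t \<in> {a<..<b} \<Longrightarrow> ((\<lambda>t. vt s t) has_real_derivative vtt s t) (at t)"
    and vtc: "continuous_on ({0<..<S} \<times> {a<..<b}) (\<lambda>(s, t). vt s t)"
    and vttc: "continuous_on ({0<..<S} \<times> {a<..<b}) (\<lambda>(s, t). vtt s t)"
    and wc: "continuous_on {a..b} w"
    and pde: "\<And>s t. s \<in> {0<..<S} \<Longrightarrow> t \<in> {a<..<b} \<Longrightarrow> vss s t + vtt s t = - \<mu> * w t * v s t"
  defines "A \<equiv> \<lambda>t. integral {0..S} (\<lambda>s. v s t * sin (k * s))"
  shows "\<exists>A'. ode_solution a b (\<lambda>t. \<mu> * w t - k\<^sup>2) A A'" and "A a = 0" and "A b = 0"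
proof -
  have S0: "S > 0" using c by (simp add: S)
  have "integral {0..S} (\<lambda>s. v s t * sin (k * s)) = integral {0..S} (\<lambda>_. 0)"
    if "\<And>s. s \<in> {0..S} \<Longrightarrow> v s t = 0" for t
    by (rule integral_cong) (simp add: that)
  then show "A a = 0" "A b = 0"
    unfolding A_def using va by auto
  define \<sigma> where "\<sigma> d \<tau> = S / 2 + (1 - d) * (\<tau> - S / 2)" for d \<tau> :: real
  have \<sigma>0: "\<sigma> 0 \<tau> = \<tau>" for \<tau> by (simp add: \<sigma>_def)
  have \<sigma>in: "\<sigma> d \<tau> \<in> {d * S / 2..S - d * S / 2}" if "d \<in> {0..1/2}" "\<tau> \<in> {0..S}" for d \<tau>
  proof -
    have "(1 - d) * (\<tau> - S / 2) \<le> (1 - d) * (S / 2)" "(1 - d) * (- (S / 2)) \<le> (1 - d) * (\<tau> - S / 2)"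
      using that by (intro mult_left_mono; simp)+
    moreover have "(1 - d) * (S / 2) = S / 2 - d * S / 2" "(1 - d) * (- (S / 2)) = d * S / 2 - S / 2"
      by (simp_all add: field_simps)
    ultimately show ?thesis unfolding \<sigma>_def atLeastAtMost_iff by linarith
  qed
  have \<sigma>cl: "\<sigma> d \<tau> \<in> {0..S}" if "d \<in> {0..1/2}" "\<tau> \<in> {0..S}" for d \<tau>
  proof -
    have "0 \<le> d * S / 2" using that S0 by simp
    then show ?thesis using \<sigma>in[OF that] by auto
  qed
  have \<sigma>op: "\<sigma> d \<tau> \<in> {0<..<S}" if "d \<in> {0<..1/2}" "\<tau> \<in> {0..S}" for d \<tau>
  proof -
    have "0 < d * S / 2" using that S0 by simp
    then show ?thesis using \<sigma>in[of d \<tau>] that by auto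
  qed
  define F where "F d t = integral {0..S} (\<lambda>\<tau>. v (\<sigma> d \<tau>) t * sin (k * \<tau>))" for d t
  \<comment> \<open>For \<open>d > 0\<close> this will be the second derivative of
    \<open>F d\<close>: integrating by parts twice in \<tau> leaves boundary values of
    \<open>v\<close>, and the rescaling contributes \<open>1 / (1 - d)\<^sup>2\<close>. At
    \<open>d = 0\<close> the boundary values vanish and the expected right-hand side
    remains.\<close>
  define f where "f d t = (k\<^sup>2 * F d t + k * ((-1) ^ n * v (\<sigma> d S) t - v (\<sigma> d 0) t)) / (1 - d)\<^sup>2
      - \<mu> * w t * F d t" for d t
  have vcomp: "continuous_on X (\<lambda>x. v (p x) (q x))"
    if "continuous_on X p" "continuous_on X q" "\<And>x. x \<in> X \<Longrightarrow> p x \<in> {0..S} \<and> q x \<in> {a..b}"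
    for X :: "'z::topological_space set" and p q
  proof -
    have "continuous_on X (\<lambda>x. (\<lambda>(s, t). v s t) (p x, q x))"
      by (rule continuous_on_compose2[OF vc]) (use that in \<open>auto intro!: continuous_intros\<close>)
    then show ?thesis by simp
  qed
  have Fc: "continuous_on ({0..1/2} \<times> {a..b}) (\<lambda>x. F (fst x) (snd x))"
  proof -
    have "continuous_on ({0..1/2} \<times> {a..b})
        (\<lambda>x. integral (cbox 0 S) (\<lambda>\<tau>. v (\<sigma> (fst x) \<tau>) (snd x) * sin (k * \<tau>)))"
    proof (rule integral_continuous_on_param)
      show "continuous_on (({0..1/2} \<times> {a..b}) \<times> cbox 0 S)
          (\<lambda>(x, \<tau>). v (\<sigma> (fst x) \<tau>) (snd x) * sin (k * \<tau>))"
        unfolding case_prod_beta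
      proof (rule continuous_on_mult)
        show "continuous_on (({0..1/2} \<times> {a..b}) \<times> cbox 0 S)
            (\<lambda>x. v (\<sigma> (fst (fst x)) (snd x)) (snd (fst x)))"
        proof (rule vcomp)
          show "continuous_on (({0..1/2} \<times> {a..b}) \<times> cbox 0 S) (\<lambda>x. \<sigma> (fst (fst x)) (snd x))"
            unfolding \<sigma>_def by (intro continuous_intros)
          fix x assume "x \<in> ({0..1/2::real} \<times> {a..b}) \<times> cbox 0 S"
          then show "\<sigma> (fst (fst x)) (snd x) \<in> {0..S} \<and> snd (fst x) \<in> {a..b}"
            using \<sigma>cl[of "fst (fst x)" "snd x"] by (auto simp: mem_Times_iff)
        qed (intro continuous_intros)
      qed (intro continuous_intros)
    qed
    then show ?thesis by (simp add: F_def)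
  qed
  have fc: "continuous_on ({0..1/2} \<times> {a..b}) (\<lambda>x. f (fst x) (snd x))"
  proof -
    have "continuous_on ({0..1/2} \<times> {a..b}) (\<lambda>x. w (snd x))"
      by (rule continuous_on_compose2[OF wc]) (auto intro!: continuous_intros)
    moreover have "continuous_on ({0..1/2} \<times> {a..b}) (\<lambda>x. v (\<sigma> (fst x) \<tau>) (snd x))" if "\<tau> \<in> {0..S}" for \<tau>
    proof (rule vcomp)
      show "continuous_on ({0..1/2} \<times> {a..b}) (\<lambda>x. \<sigma> (fst x) \<tau>)"
        unfolding \<sigma>_def by (intro continuous_intros)
      fix x assume "x \<in> {0..1/2::real} \<times> {a..b}"
      then show "\<sigma> (fst x) \<tau> \<in> {0..S} \<and> snd x \<in> {a..b}"
        using \<sigma>cl[of "fst x" \<tau>] that by (auto simp: mem_Times_iff)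
    qed (intro continuous_intros)
    ultimately show ?thesis
      unfolding f_def using S0 by (intro continuous_intros Fc) auto
  qed
  have slice: "continuous_on {a..b} (\<lambda>t. g d t)"
    if "continuous_on ({0..1/2} \<times> {a..b}) (\<lambda>x. g (fst x) (snd x))" "d \<in> {0..1/2}"
    for g :: "real \<Rightarrow> real \<Rightarrow> real" and d
  proof -
    have "continuous_on {a..b} (\<lambda>t. (\<lambda>x. g (fst x) (snd x)) (d, t))"
      by (rule continuous_on_compose2[OF that(1)]) (use that(2) in \<open>auto intro!: continuous_intros\<close>)
    then show ?thesis by simp
  qed
  \<comment> \<open>\<open>P d\<close> being affine is the integrated form of the equation F'' = f.
    It speaks about values only, which depend continuously on \<open>d\<close> down to 0.\<close>
  define P where "P d x = F d x - integral {a..b} (\<lambda>t. max 0 (x - t) * f d t)" for d x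
  have Pc: "continuous_on {0..1/2} (\<lambda>d. P d x)" if x: "x \<in> {a..b}" for x
  proof -
    have "continuous_on {0..1/2} (\<lambda>d. (\<lambda>x. F (fst x) (snd x)) (d, x))"
      by (rule continuous_on_compose2[OF Fc]) (use x in \<open>auto intro!: continuous_intros\<close>)
    moreover have "continuous_on {0..1/2} (\<lambda>d. integral (cbox a b) (\<lambda>t. max 0 (x - t) * f d t))"
    proof (rule integral_continuous_on_param)
      show "continuous_on ({0..1/2} \<times> cbox a b) (\<lambda>(d, t). max 0 (x - t) * f d t)"
        unfolding case_prod_beta using fc by (intro continuous_intros) simp
    qed
    ultimately show ?thesis unfolding P_def by (intro continuous_intros) auto
  qed
  have sinS: "sin (k * S) = 0" and cosS: "cos (k * S) = (-1) ^ n"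
    using c by (simp_all add: S k mult.commute[of _ pi])
  have affine: "(b - a) * P d x = (b - x) * P d a + (x - a) * P d b"
    if d: "d \<in> {0<..1/2}" and x: "x \<in> {a..b}" for d x
  proof -
    have d': "d \<in> {0..1/2}" using d by auto
    define F1 where "F1 t = integral {0..S} (\<lambda>\<tau>. vt (\<sigma> d \<tau>) t * sin (k * \<tau>))" for t
    define F2 where "F2 t = integral {0..S} (\<lambda>\<tau>. vtt (\<sigma> d \<tau>) t * sin (k * \<tau>))" for t
    have comp: "continuous_on ({a<..<b} \<times> cbox 0 S) (\<lambda>(t, \<tau>). g (\<sigma> d \<tau>) t * sin (k * \<tau>))"
      if g: "continuous_on ({0<..<S} \<times> {a<..<b}) (\<lambda>(s, t). g s t)" for g
    proof -
      have "continuous_on ({a<..<b} \<times> cbox 0 S) (\<lambda>x. (\<lambda>(s, t). g s t) (\<sigma> d (snd x), fst x))"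
      proof (rule continuous_on_compose2[OF g])
        show "continuous_on ({a<..<b} \<times> cbox 0 S) (\<lambda>x. (\<sigma> d (snd x), fst x))"
          unfolding \<sigma>_def by (intro continuous_intros)
        show "(\<lambda>x. (\<sigma> d (snd x), fst x)) ` ({a<..<b} \<times> cbox 0 S) \<subseteq> {0<..<S} \<times> {a<..<b}"
          using \<sigma>op[OF d] by fastforce
      qed
      then show ?thesis unfolding case_prod_beta by (intro continuous_intros) simp
    qed
    have \<sigma>c: "continuous_on X (\<sigma> d)" for X unfolding \<sigma>_def by (intro continuous_intros)
    have vci: "continuous_on {0..S} (\<lambda>\<tau>. v (\<sigma> d \<tau>) t * sin (k * \<tau>))" if "t \<in> {a..b}" for t
    proof (rule continuous_on_mult)
      show "continuous_on {0..S} (\<lambda>\<tau>. v (\<sigma> d \<tau>) t)"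
        by (rule vcomp[OF \<sigma>c continuous_on_const]) (simp add: \<sigma>cl[OF d'] that del: atLeastAtMost_iff)
    qed (intro continuous_intros)
    have dF: "(F d has_real_derivative F1 t) (at t)" if t: "a < t" "t < b" for t
    proof -
      have "((\<lambda>t. integral (cbox 0 S) (\<lambda>\<tau>. v (\<sigma> d \<tau>) t * sin (k * \<tau>))) has_real_derivative
          integral (cbox 0 S) (\<lambda>\<tau>. vt (\<sigma> d \<tau>) t * sin (k * \<tau>))) (at t within {a<..<b})"
      proof (rule leibniz_rule_field_derivative)
        fix t \<tau> assume t: "t \<in> {a<..<b}" "\<tau> \<in> cbox 0 S"
        then show "((\<lambda>t. v (\<sigma> d \<tau>) t * sin (k * \<tau>)) has_real_derivative vt (\<sigma> d \<tau>) t * sin (k * \<tau>))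
            (at t within {a<..<b})"
          using dvt[OF \<sigma>op[OF d] t(1)]
          by (intro DERIV_cmult_right) (simp add: has_field_derivative_at_within)
      next
        fix t assume "t \<in> {a<..<b}"
        then show "(\<lambda>\<tau>. v (\<sigma> d \<tau>) t * sin (k * \<tau>)) integrable_on cbox 0 S"
          using vci[of t] by (auto intro: integrable_continuous_real)
      qed (use t comp[OF vtc] in auto)
      then show ?thesis using t by (simp add: F_def[abs_def] F1_def at_within_open[of _ "{a<..<b}"])
    qed
    have dF1: "(F1 has_real_derivative F2 t) (at t)" if t: "a < t" "t < b" for t
    proof -
      have "((\<lambda>t. integral (cbox 0 S) (\<lambda>\<tau>. vt (\<sigma> d \<tau>) t * sin (k * \<tau>))) has_real_derivative
          integral (cbox 0 S) (\<lambda>\<tau>. vtt (\<sigma> d \<tau>) t * sin (k * \<tau>))) (at t within {a<..<b})"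
      proof (rule leibniz_rule_field_derivative)
        fix t \<tau> assume t: "t \<in> {a<..<b}" "\<tau> \<in> cbox 0 S"
        then show "((\<lambda>t. vt (\<sigma> d \<tau>) t * sin (k * \<tau>)) has_real_derivative vtt (\<sigma> d \<tau>) t * sin (k * \<tau>))
            (at t within {a<..<b})"
          using dvtt[OF \<sigma>op[OF d] t(1)]
          by (intro DERIV_cmult_right) (simp add: has_field_derivative_at_within)
      next
        fix t assume t: "t \<in> {a<..<b}"
        have "continuous_on (cbox 0 S) (\<lambda>\<tau>. (\<lambda>(t, \<tau>). vt (\<sigma> d \<tau>) t * sin (k * \<tau>)) (t, \<tau>))"
          by (rule continuous_on_compose2[OF comp[OF vtc]]) (use t in \<open>auto intro!: continuous_intros\<close>)
        then show "(\<lambda>\<tau>. vt (\<sigma> d \<tau>) t * sin (k * \<tau>)) integrable_on cbox 0 S"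
          by (intro integrable_continuous) simp
      qed (use t comp[OF vttc] in auto)
      then show ?thesis using t by (simp add: F1_def[abs_def] F2_def at_within_open[of _ "{a<..<b}"])
    qed
    have F2f: "F2 t = f d t" if t: "a < t" "t < b" for t
    proof -
      define e where "e = 1 - d"
      have e: "e > 0" using d by (simp add: e_def)
      \<comment> \<open>The antiderivative behind both integrations by parts: the terms with
        \<open>vs\<close> and the cosine cancel in its derivative, and the sine removes
        \<open>vs\<close> at both ends.\<close>
      define H where "H \<tau> = vs (\<sigma> d \<tau>) t * sin (k * \<tau>) / e - k * v (\<sigma> d \<tau>) t * cos (k * \<tau>) / e\<^sup>2" for \<tau>
      have d\<sigma>: "(\<sigma> d has_real_derivative e) (at \<tau>)" for \<tau>
        unfolding \<sigma>_def[abs_def] e_def by (auto intro!: derivative_eq_intros)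
      have dH: "(H has_real_derivative
            vss (\<sigma> d \<tau>) t * sin (k * \<tau>) + (k\<^sup>2 / e\<^sup>2) * (v (\<sigma> d \<tau>) t * sin (k * \<tau>))) (at \<tau>)"
        if \<tau>: "\<tau> \<in> {0..S}" for \<tau>
      proof -
        have t': "t \<in> {a<..<b}" using t by simp
        have 1: "((\<lambda>\<tau>. v (\<sigma> d \<tau>) t) has_real_derivative vs (\<sigma> d \<tau>) t * e) (at \<tau>)"
          using DERIV_chain2[OF dvs[OF \<sigma>op[OF d \<tau>] t'] d\<sigma>] .
        have 2: "((\<lambda>\<tau>. vs (\<sigma> d \<tau>) t) has_real_derivative vss (\<sigma> d \<tau>) t * e) (at \<tau>)"
          using DERIV_chain2[OF dvss[OF \<sigma>op[OF d \<tau>] t'] d\<sigma>] .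
        have 3: "((\<lambda>\<tau>. sin (k * \<tau>)) has_real_derivative cos (k * \<tau>) * k) (at \<tau>)"
          "((\<lambda>\<tau>. cos (k * \<tau>)) has_real_derivative - sin (k * \<tau>) * k) (at \<tau>)"
          by (auto intro!: derivative_eq_intros)
        have "(H has_real_derivative
            (vss (\<sigma> d \<tau>) t * e * sin (k * \<tau>) + cos (k * \<tau>) * k * vs (\<sigma> d \<tau>) t) / e -
            (k * (vs (\<sigma> d \<tau>) t * e) * cos (k * \<tau>) + - sin (k * \<tau>) * k * (k * v (\<sigma> d \<tau>) t)) / e\<^sup>2) (at \<tau>)"
          unfolding H_def by (intro DERIV_diff DERIV_cdivide DERIV_mult DERIV_cmult 1 2 3)
        then show ?thesis
          by (rule DERIV_cong) (use e in \<open>simp add: field_simps power2_eq_square\<close>)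
      qed
      have hi: "((\<lambda>\<tau>. vss (\<sigma> d \<tau>) t * sin (k * \<tau>) + (k\<^sup>2 / e\<^sup>2) * (v (\<sigma> d \<tau>) t * sin (k * \<tau>)))
          has_integral (H S - H 0)) {0..S}"
        by (rule fundamental_theorem_of_calculus)
          (use S0 has_field_derivative_at_within[OF dH] in
            \<open>simp_all add: has_real_derivative_iff_has_vector_derivative\<close>)
      have Fi: "((\<lambda>\<tau>. v (\<sigma> d \<tau>) t * sin (k * \<tau>)) has_integral F d t) {0..S}"
        unfolding F_def using vci[of t] t by (intro integrable_integral integrable_continuous_real) auto
      have "((\<lambda>\<tau>. (k\<^sup>2 / e\<^sup>2 - \<mu> * w t) * (v (\<sigma> d \<tau>) t * sin (k * \<tau>)) -
          (vss (\<sigma> d \<tau>) t * sin (k * \<tau>) + (k\<^sup>2 / e\<^sup>2) * (v (\<sigma> d \<tau>) t * sin (k * \<tau>))))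
          has_integral (k\<^sup>2 / e\<^sup>2 - \<mu> * w t) * F d t - (H S - H 0)) {0..S}"
        by (intro has_integral_diff has_integral_mult_right Fi hi)
      moreover have "(k\<^sup>2 / e\<^sup>2 - \<mu> * w t) * (v (\<sigma> d \<tau>) t * sin (k * \<tau>)) -
          (vss (\<sigma> d \<tau>) t * sin (k * \<tau>) + (k\<^sup>2 / e\<^sup>2) * (v (\<sigma> d \<tau>) t * sin (k * \<tau>))) =
          vtt (\<sigma> d \<tau>) t * sin (k * \<tau>)" if "\<tau> \<in> {0..S}" for \<tau>
      proof -
        have "vtt (\<sigma> d \<tau>) t = - \<mu> * w t * v (\<sigma> d \<tau>) t - vss (\<sigma> d \<tau>) t"
          using pde[OF \<sigma>op[OF d that], of t] t by simp
        then show ?thesis by (simp only:) (simp add: algebra_simps)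
      qed
      ultimately have "((\<lambda>\<tau>. vtt (\<sigma> d \<tau>) t * sin (k * \<tau>)) has_integral
          (k\<^sup>2 / e\<^sup>2 - \<mu> * w t) * F d t - (H S - H 0)) {0..S}"
        by (subst has_integral_cong[of _ _ "\<lambda>\<tau>. (k\<^sup>2 / e\<^sup>2 - \<mu> * w t) * (v (\<sigma> d \<tau>) t * sin (k * \<tau>)) -
          (vss (\<sigma> d \<tau>) t * sin (k * \<tau>) + (k\<^sup>2 / e\<^sup>2) * (v (\<sigma> d \<tau>) t * sin (k * \<tau>)))"]) auto
      then have "F2 t = (k\<^sup>2 / e\<^sup>2 - \<mu> * w t) * F d t - (H S - H 0)"
        unfolding F2_def by (rule integral_unique)
      also have "\<dots> = f d t"
      proof -
        have "H S = - (k * v (\<sigma> d S) t * (-1) ^ n / e\<^sup>2)" "H 0 = - (k * v (\<sigma> d 0) t / e\<^sup>2)"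
          by (simp_all add: H_def sinS cosS)
        then show ?thesis using e by (simp add: f_def e_def[symmetric] field_simps)
      qed
      finally show ?thesis .
    qed
    show ?thesis
    proof (rule affine_if_second_derivative_zero[OF ab _ _ _ x, where p="\<lambda>x. F1 x - integral {a..x} (f d)"])
      note fd = slice[OF fc d']
      show "continuous_on {a..b} (P d)"
        unfolding P_def
        by (intro continuous_on_diff slice[OF Fc d'] DERIV_continuous_on[OF integral_max_kernel_has_derivative[OF fd]])
      fix x assume x: "a < x" "x < b"
      have at: "at x within {a..b} = at x" using x by (simp add: at_within_Icc_at)
      have xi: "x \<in> {a..b}" using x by simp
      show "(P d has_real_derivative F1 x - integral {a..x} (f d)) (at x)"
        unfolding P_def
        by (intro DERIV_diff dF x integral_max_kernel_has_derivative[OF fd xi, unfolded at])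
      have "((\<lambda>x. F1 x - integral {a..x} (f d)) has_real_derivative F2 x - f d x) (at x)"
        by (intro DERIV_diff dF1 x integral_has_real_derivative[OF fd xi, unfolded at])
      then show "((\<lambda>x. F1 x - integral {a..x} (f d)) has_real_derivative 0) (at x)"
        using F2f[OF x] by simp
    qed
  qed
  have affine0: "(b - a) * P 0 x = (b - x) * P 0 a + (x - a) * P 0 b" if x: "x \<in> {a..b}" for x
  proof -
    \<comment> \<open>The defect from being affine is continuous on \<open>{0..1/2}\<close> and
      vanishes for \<open>d > 0\<close>, hence also at \<open>d = 0\<close>.\<close>
    define h where "h d = (b - a) * P d x - ((b - x) * P d a + (x - a) * P d b)" for d
    have cl: "closure {0<..1/2::real} = {0..1/2}" by simp
    have "h 0 = 0"
    proof (rule continuous_constant_on_closure[of "{0<..1/2}" h 0])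
      show "continuous_on (closure {0<..1/2}) h"
        unfolding cl h_def using ab by (intro continuous_intros Pc x) auto
      show "h d = 0" if "d \<in> {0<..1/2}" for d
        using affine[OF that x] by (simp add: h_def)
    qed (simp add: cl)
    then show ?thesis by (simp add: h_def)
  qed
  have F0: "F 0 = A" by (simp add: F_def[abs_def] A_def \<sigma>0)
  have f0: "f 0 t = - (\<mu> * w t - k\<^sup>2) * A t" if "t \<in> {a..b}" for t
    using v0[OF that] by (simp add: f_def \<sigma>0 F0 algebra_simps)
  have fc0: "continuous_on {a..b} (f 0)" using slice[OF fc, of 0] by simp
  define C where "C = (P 0 b - P 0 a) / (b - a)"
  \<comment> \<open>Read as an integral equation, this yields differentiability of \<open>A\<close>
    up to the end points, although \<open>v\<close> is only continuous there.\<close>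
  have Ax: "A x = P 0 a + C * (x - a) + integral {a..b} (\<lambda>t. max 0 (x - t) * f 0 t)" if "x \<in> {a..b}" for x
  proof -
    have "P 0 x = P 0 a + C * (x - a)"
      using affine0[OF that] ab by (simp add: C_def field_simps)
    then show ?thesis by (simp add: P_def F0)
  qed
  define A' where "A' x = C + integral {a..x} (f 0)" for x
  have "ode_solution a b (\<lambda>t. \<mu> * w t - k\<^sup>2) A A'"
    unfolding ode_solution_def
  proof (intro ballI conjI)
    fix x assume x: "x \<in> {a..b}"
    have "((\<lambda>x. P 0 a + C * (x - a) + integral {a..b} (\<lambda>t. max 0 (x - t) * f 0 t)) has_real_derivative
        0 + C * (1 - 0) + integral {a..x} (f 0)) (at x within {a..b})"
      by (intro DERIV_add DERIV_const DERIV_cmult DERIV_diff DERIV_ident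
          integral_max_kernel_has_derivative fc0 x)
    then have "((\<lambda>x. P 0 a + C * (x - a) + integral {a..b} (\<lambda>t. max 0 (x - t) * f 0 t)) has_real_derivative
        A' x) (at x within {a..b})"
      by (simp add: A'_def)
    then show "(A has_real_derivative A' x) (at x within {a..b})"
      by (rule has_field_derivative_transform_within[where d=1, OF _ _ x Ax[symmetric]]) simp_all
    have "(A' has_real_derivative 0 + f 0 x) (at x within {a..b})"
      unfolding A'_def by (intro DERIV_add DERIV_const integral_has_real_derivative fc0 x)
    then show "(A' has_real_derivative - (\<mu> * w x - k\<^sup>2) * A x) (at x within {a..b})"
      using f0[OF x] by simp
  qed
  then show "\<exists>A'. ode_solution a b (\<lambda>t. \<mu> * w t - k\<^sup>2) A A'" by blast
qed

section \<open>Chain rules for \<open>C1_on\<close>\<close>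

lemma C1_onI:
  assumes "\<And>p. p \<in> T \<Longrightarrow> ((\<lambda>s. u (s, snd p)) has_real_derivative ux p) (at (fst p))"
    and "\<And>p. p \<in> T \<Longrightarrow> ((\<lambda>s. u (fst p, s)) has_real_derivative uy p) (at (snd p))"
    and "continuous_on T ux" "continuous_on T uy"
  shows "C1_on T u" and "\<And>p. p \<in> T \<Longrightarrow> partial_x u p = ux p"
    and "\<And>p. p \<in> T \<Longrightarrow> partial_y u p = uy p"
proof -
  show px: "partial_x u p = ux p" and py: "partial_y u p = uy p" if "p \<in> T" for p
    using assms(1,2)[OF that] by (simp_all add: partial_x_def partial_y_def DERIV_imp_deriv)
  have "continuous_on T (partial_x u)" "continuous_on T (partial_y u)"
    by (rule continuous_on_eq[OF assms(3) px[symmetric]], assumption,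
        rule continuous_on_eq[OF assms(4) py[symmetric]], assumption)
  then show "C1_on T u"
    unfolding C1_on_def field_differentiable_def using assms(1,2) by blast
qed

lemma C1_onD:
  assumes "C1_on T u" "p \<in> T"
  shows "((\<lambda>s. u (s, snd p)) has_real_derivative partial_x u p) (at (fst p))"
    and "((\<lambda>s. u (fst p, s)) has_real_derivative partial_y u p) (at (snd p))"
  using assms unfolding C1_on_def partial_x_def partial_y_def
  by (simp_all add: DERIV_deriv_iff_field_differentiable)

text \<open>Openness makes every coordinate slice through a point of \<open>T\<close> a
  neighbourhood of it, so agreement on \<open>T\<close> alone determines the partial derivatives.
  This replaces \<open>partial_x u\<close> by an explicit formula that is valid only on the
  domain.\<close>

lemma C1_on_cong:
  assumes T: "open T" and eq: "\<And>p. p \<in> T \<Longrightarrow> u p = v p" and u: "C1_on T u"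
  shows "C1_on T v" and "\<And>p. p \<in> T \<Longrightarrow> partial_x v p = partial_x u p"
    and "\<And>p. p \<in> T \<Longrightarrow> partial_y v p = partial_y u p"
proof -
  have x: "((\<lambda>s. v (s, snd p)) has_real_derivative partial_x u p) (at (fst p))" if "p \<in> T" for p
  proof (rule has_field_derivative_transform_within_open[OF C1_onD(1)[OF u that]])
    show "open ((\<lambda>s. (s, snd p)) -` T)" by (intro open_vimage T continuous_intros)
  qed (use that eq in auto)
  have y: "((\<lambda>s. v (fst p, s)) has_real_derivative partial_y u p) (at (snd p))" if "p \<in> T" for p
  proof (rule has_field_derivative_transform_within_open[OF C1_onD(2)[OF u that]])
    show "open ((\<lambda>s. (fst p, s)) -` T)" by (intro open_vimage T continuous_intros)
  qed (use that eq in auto)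
  have c: "continuous_on T (partial_x u)" "continuous_on T (partial_y u)"
    using u by (simp_all add: C1_on_def)
  show "C1_on T v" "\<And>p. p \<in> T \<Longrightarrow> partial_x v p = partial_x u p"
    "\<And>p. p \<in> T \<Longrightarrow> partial_y v p = partial_y u p"
    using C1_onI[OF x y c] by blast+
qed

text \<open>Continuous partial derivatives give a total derivative; this is the passage from the
  coordinatewise definition of \<open>C1_on\<close> to a chain rule along curves.\<close>

lemma C1_on_has_derivative:
  assumes T: "open T" and u: "C1_on T u" and p: "p \<in> T"
  shows "(u has_derivative (\<lambda>h. partial_x u p * fst h + partial_y u p * snd h)) (at p)"
proof -
  obtain x y where xy: "p = (x, y)" by (cases p)
  obtain A B where AB: "open A" "open B" "p \<in> A \<times> B" "A \<times> B \<subseteq> T"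
    using open_prod_elim[OF T p] by blast
  \<comment> \<open>The ball supplies a convex neighbourhood in the second variable, as the
    criterion for partial derivatives demands.\<close>
  obtain e where e: "e > 0" "ball y e \<subseteq> B"
    using AB open_contains_ball[of B] xy by auto
  have sub: "A \<times> ball y e \<subseteq> T" using AB e by auto
  have "((\<lambda>(x, y). u (x, y)) has_derivative
      (\<lambda>(tx, ty). (*) (partial_x u p) tx + blinfun_apply (blinfun_mult_right (partial_y u (x, y))) ty))
      (at (x, y) within A \<times> ball y e)"
  proof (rule has_derivative_partialsI[where fy="\<lambda>x y. blinfun_mult_right (partial_y u (x, y))"])
    show "((\<lambda>x. u (x, y)) has_derivative (*) (partial_x u p)) (at x within A)"
      using has_field_derivative_at_within[OF C1_onD(1)[OF u p]]
      unfolding has_field_derivative_def by (simp add: xy)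
    fix x' y' assume "x' \<in> A" "y' \<in> ball y e"
    then have "(x', y') \<in> T" using sub by auto
    from has_field_derivative_at_within[OF C1_onD(2)[OF u this]]
    show "((\<lambda>y. u (x', y)) has_derivative blinfun_apply (blinfun_mult_right (partial_y u (x', y'))))
        (at y' within ball y e)"
      unfolding has_field_derivative_def by simp
  next
    have c: "continuous_on (A \<times> ball y e) (partial_y u)"
      using u sub continuous_on_subset unfolding C1_on_def by blast
    have "continuous_on (A \<times> ball y e) (\<lambda>q. blinfun_mult_right (partial_y u q))"
      by (rule bounded_linear.continuous_on[OF bounded_linear_blinfun_mult_right c])
    then show "continuous (at (x, y) within A \<times> ball y e)
        (\<lambda>(x, y). blinfun_mult_right (partial_y u (x, y)))"
      using AB xy e by (auto simp: continuous_on_eq_continuous_within case_prod_beta')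
  qed (use e in auto)
  moreover have "at (x, y) within A \<times> ball y e = at (x, y)"
    by (rule at_within_open) (use AB xy e in \<open>auto intro: open_Times\<close>)
  ultimately show ?thesis by (simp add: xy case_prod_beta')
qed

lemma C1_on_chain:
  assumes "open T" "C1_on T u" "(X s, Y s) \<in> T"
    and X: "(X has_real_derivative X') (at s)" and Y: "(Y has_real_derivative Y') (at s)"
  shows "((\<lambda>s. u (X s, Y s)) has_real_derivative
           (partial_x u (X s, Y s) * X' + partial_y u (X s, Y s) * Y')) (at s)"
proof -
  have "((\<lambda>s. (X s, Y s)) has_derivative (\<lambda>h. (X' * h, Y' * h))) (at s)"
    using X Y unfolding has_field_derivative_def by (rule has_derivative_Pair)
  from has_derivative_compose[OF this C1_on_has_derivative[OF assms(1-3)]]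
  show ?thesis unfolding has_field_derivative_def
    by (rule has_derivative_eq_rhs) (simp add: fun_eq_iff algebra_simps)
qed

section \<open>Logarithmic polar coordinates\<close>

text \<open>The complex exponential of s + i t in real coordinates. It is conformal, so the
  Euclidean Laplacian only acquires the factor exp (- 2 s).\<close>

definition polar :: "real \<times> real \<Rightarrow> real \<times> real" where
  "polar q = (exp (fst q) * cos (snd q), exp (fst q) * sin (snd q))"

definition log_radius :: "real \<times> real \<Rightarrow> real" where
  "log_radius p = ln ((fst p)\<^sup>2 + (snd p)\<^sup>2) / 2"

text \<open>The arccotangent of x / y: unlike arctan (y / x) it is smooth on the whole upper
  half-plane, including the vertical axis.\<close>

definition angle :: "real \<times> real \<Rightarrow> real" where
  "angle p = pi / 2 - arctan (fst p / snd p)"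

definition polar_coords :: "real \<times> real \<Rightarrow> real \<times> real" where
  "polar_coords p = (log_radius p, angle p)"

lemma exp_log_radius: "snd p > 0 \<Longrightarrow> exp (log_radius p) = sqrt ((fst p)\<^sup>2 + (snd p)\<^sup>2)"
proof -
  assume "snd p > 0"
  then have "(fst p)\<^sup>2 + (snd p)\<^sup>2 > 0" by (simp add: sum_power2_gt_zero_iff)
  then show ?thesis by (simp add: log_radius_def exp_ln flip: ln_sqrt)
qed

lemma angle_cos_sin:
  assumes "snd p > 0"
  shows "exp (log_radius p) * cos (angle p) = fst p" and "exp (log_radius p) * sin (angle p) = snd p"
proof -
  define \<rho> where "\<rho> = sqrt ((fst p)\<^sup>2 + (snd p)\<^sup>2)"
  have pos: "(fst p)\<^sup>2 + (snd p)\<^sup>2 > 0" using assms by (simp add: sum_power2_gt_zero_iff)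
  then have \<rho>: "\<rho> > 0" by (simp add: \<rho>_def)
  have "1 + (fst p / snd p)\<^sup>2 = ((fst p)\<^sup>2 + (snd p)\<^sup>2) / (snd p)\<^sup>2"
    using assms by (simp add: field_simps)
  then have "sqrt (1 + (fst p / snd p)\<^sup>2) = \<rho> / snd p"
    using assms by (simp add: real_sqrt_divide \<rho>_def)
  then have "sin (angle p) = snd p / \<rho>" "cos (angle p) = fst p / \<rho>"
    using assms \<rho> by (simp_all add: angle_def sin_diff cos_diff cos_arctan sin_arctan)
  then show "exp (log_radius p) * cos (angle p) = fst p" "exp (log_radius p) * sin (angle p) = snd p"
    using \<rho> exp_log_radius[OF assms] by (simp_all add: \<rho>_def)
qed

lemma polar_polar_coords: "snd p > 0 \<Longrightarrow> polar (polar_coords p) = p"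
  using angle_cos_sin[of p] by (simp add: polar_def polar_coords_def)

lemma polar_coords_polar:
  assumes "0 < snd q" "snd q < pi"
  shows "polar_coords (polar q) = q"
proof -
  have "sin (snd q) > 0" using assms by (rule sin_gt_zero)
  have "(exp (fst q) * cos (snd q))\<^sup>2 + (exp (fst q) * sin (snd q))\<^sup>2 = (exp (fst q))\<^sup>2"
    by (simp add: power_mult_distrib flip: distrib_left)
  then have "log_radius (polar q) = fst q"
    by (simp add: log_radius_def polar_def ln_realpow)
  moreover have "angle (polar q) = snd q"
  proof -
    have "cos (snd q) / sin (snd q) = tan (pi / 2 - snd q)"
      by (simp add: tan_def sin_diff cos_diff)
    then have "arctan (cos (snd q) / sin (snd q)) = pi / 2 - snd q"
      using assms by (simp add: arctan_tan)
    then show ?thesis by (simp add: angle_def polar_def)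
  qed
  ultimately show ?thesis by (simp add: polar_coords_def)
qed

lemma continuous_on_polar: "continuous_on X polar"
  unfolding polar_def[abs_def] by (intro continuous_intros)

lemma continuous_on_polar_coords:
  assumes "X \<subseteq> {p. snd p > 0}"
  shows "continuous_on X polar_coords"
  unfolding polar_coords_def[abs_def] log_radius_def[abs_def] angle_def[abs_def]
  using assms by (intro continuous_intros) (auto simp: sum_power2_eq_zero_iff)

text \<open>The derivatives are expressed through the polar coordinates themselves, so that first
  derivatives of a pulled-back function are again functions of these coordinates. The four formulas
  show the Cauchy-Riemann equations.\<close>

lemma polar_coords_has_derivative:
  assumes p: "snd p > 0"
  shows "((\<lambda>x. log_radius (x, snd p)) has_real_derivative exp (- log_radius p) * cos (angle p)) (at (fst p))"
    and "((\<lambda>y. log_radius (fst p, y)) has_real_derivative exp (- log_radius p) * sin (angle p)) (at (snd p))"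
    and "((\<lambda>x. angle (x, snd p)) has_real_derivative - (exp (- log_radius p) * sin (angle p))) (at (fst p))"
    and "((\<lambda>y. angle (fst p, y)) has_real_derivative exp (- log_radius p) * cos (angle p)) (at (snd p))"
proof -
  define x y where xy: "x = fst p" "y = snd p"
  have pos: "x\<^sup>2 + y\<^sup>2 > 0" using p by (simp add: xy sum_power2_gt_zero_iff)
  have y: "y > 0" using p by (simp add: xy)
  have e: "exp (- log_radius p) * exp (- log_radius p) = 1 / (x\<^sup>2 + y\<^sup>2)"
    using exp_log_radius[OF p] pos by (simp add: exp_minus xy field_simps)
  have c: "exp (- log_radius p) * cos (angle p) = x / (x\<^sup>2 + y\<^sup>2)"
  proof -
    have "exp (- log_radius p) * cos (angle p) =
        (exp (- log_radius p) * exp (- log_radius p)) * (exp (log_radius p) * cos (angle p))"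
      by (simp add: exp_minus)
    then show ?thesis unfolding e angle_cos_sin[OF p] by (simp add: xy)
  qed
  have s: "exp (- log_radius p) * sin (angle p) = y / (x\<^sup>2 + y\<^sup>2)"
  proof -
    have "exp (- log_radius p) * sin (angle p) =
        (exp (- log_radius p) * exp (- log_radius p)) * (exp (log_radius p) * sin (angle p))"
      by (simp add: exp_minus)
    then show ?thesis unfolding e angle_cos_sin[OF p] by (simp add: xy)
  qed
  have sq: "((\<lambda>x. x\<^sup>2) has_real_derivative 2 * x) (at x)" for x :: real
    using DERIV_pow[of 2 x] by simp
  have q: "1 + (x / y)\<^sup>2 = (x\<^sup>2 + y\<^sup>2) / y\<^sup>2" using y by (simp add: field_simps)
  have inv: "inverse (1 + (x / y)\<^sup>2) = y\<^sup>2 / (x\<^sup>2 + y\<^sup>2)" unfolding q by simp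
  show "((\<lambda>x. log_radius (x, snd p)) has_real_derivative exp (- log_radius p) * cos (angle p)) (at (fst p))"
    unfolding c unfolding log_radius_def xy(1,2)[symmetric] fst_conv snd_conv
    by (rule DERIV_cong[OF DERIV_cdivide[OF DERIV_chain2[OF DERIV_ln_divide[OF pos]
            DERIV_add[OF sq DERIV_const]]]]) (use pos in \<open>simp add: divide_simps\<close>)
  show "((\<lambda>y. log_radius (fst p, y)) has_real_derivative exp (- log_radius p) * sin (angle p)) (at (snd p))"
    unfolding s unfolding log_radius_def xy(1,2)[symmetric] fst_conv snd_conv
    by (rule DERIV_cong[OF DERIV_cdivide[OF DERIV_chain2[OF DERIV_ln_divide[OF pos]
            DERIV_add[OF DERIV_const sq]]]]) (use pos in \<open>simp add: divide_simps\<close>)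
  have "((\<lambda>x. pi / 2 - arctan (x / y)) has_real_derivative 0 - inverse (1 + (x / y)\<^sup>2) * (1 / y)) (at x)"
    by (intro DERIV_diff DERIV_const DERIV_chain2[OF DERIV_arctan] DERIV_cdivide DERIV_ident)
  then show "((\<lambda>x. angle (x, snd p)) has_real_derivative - (exp (- log_radius p) * sin (angle p))) (at (fst p))"
    unfolding s unfolding angle_def inv xy(1,2)[symmetric] fst_conv snd_conv
    by (rule DERIV_cong) (use y in \<open>simp add: power2_eq_square\<close>)
  have "((\<lambda>y. pi / 2 - arctan (x / y)) has_real_derivative
      0 - inverse (1 + (x / y)\<^sup>2) * ((0 * y - x * 1) / (y * y))) (at y)"
    using y by (intro DERIV_diff DERIV_const DERIV_chain2[OF DERIV_arctan] DERIV_divide DERIV_ident) auto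
  then show "((\<lambda>y. angle (fst p, y)) has_real_derivative exp (- log_radius p) * cos (angle p)) (at (snd p))"
    unfolding c unfolding angle_def inv xy(1,2)[symmetric] fst_conv snd_conv
    by (rule DERIV_cong) (use y in \<open>simp add: power2_eq_square\<close>)
qed

section \<open>Sectors as images of rectangles\<close>

locale polar_rectangle =
  fixes S a b :: real
  assumes S: "0 < S" and a: "0 < a" and ab: "a < b" and b: "b < pi"
begin

definition rect :: "(real \<times> real) set" where
  "rect = {0<..<S} \<times> {a<..<b}"

definition crect :: "(real \<times> real) set" where
  "crect = {0..S} \<times> {a..b}"

definition sector :: "(real \<times> real) set" where
  "sector = polar ` rect"

lemma rect_subset: "rect \<subseteq> crect"
  by (auto simp: rect_def crect_def)

lemma open_rect: "open rect"
  unfolding rect_def by (intro open_Times) auto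

lemma crect_angle: "q \<in> crect \<Longrightarrow> 0 < snd q \<and> snd q < pi"
  using a b by (auto simp: crect_def)

lemma polar_crect_upper: "q \<in> crect \<Longrightarrow> snd (polar q) > 0"
  using crect_angle[of q] by (simp add: polar_def sin_gt_zero)

lemma polar_coords_polar': "q \<in> crect \<Longrightarrow> polar_coords (polar q) = q"
  using crect_angle polar_coords_polar by blast

lemma sector_iff: "p \<in> sector \<longleftrightarrow> snd p > 0 \<and> polar_coords p \<in> rect"
proof
  assume "p \<in> sector"
  then obtain q where "q \<in> rect" "p = polar q" by (auto simp: sector_def)
  then show "snd p > 0 \<and> polar_coords p \<in> rect"
    using subsetD[OF rect_subset, of q] polar_crect_upper[of q] polar_coords_polar'[of q] by simp
next
  assume "snd p > 0 \<and> polar_coords p \<in> rect"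
  then show "p \<in> sector" unfolding sector_def by (metis imageI polar_polar_coords)
qed

lemma polar_in_sector_iff: "q \<in> crect \<Longrightarrow> polar q \<in> sector \<longleftrightarrow> q \<in> rect"
  by (simp add: sector_iff polar_crect_upper polar_coords_polar')

lemma open_upper: "open {p :: real \<times> real. snd p > 0}"
  by (intro open_Collect_less continuous_intros)

lemma open_sector: "open sector"
proof -
  have "sector = {p. snd p > 0} \<inter> polar_coords -` rect" by (auto simp: sector_iff)
  moreover have "open \<dots>"
    by (rule continuous_open_preimage[OF continuous_on_polar_coords open_upper open_rect]) auto
  ultimately show ?thesis by simp
qed

lemma closure_sector: "closure sector = polar ` crect"
proof
  have "compact (polar ` crect)"
    unfolding crect_def
    by (intro compact_continuous_image continuous_on_polar compact_Times) auto
  then show "closure sector \<subseteq> polar ` crect"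
    using rect_subset by (intro closure_minimal compact_imp_closed) (auto simp: sector_def)
  have "closure rect = crect"
    using S ab by (simp add: rect_def crect_def closure_Times)
  moreover have "polar ` closure rect \<subseteq> closure sector"
    by (rule image_closure_subset[OF continuous_on_polar closed_closure])
      (simp add: sector_def closure_subset)
  ultimately show "polar ` crect \<subseteq> closure sector" by simp
qed

text \<open>\<open>polar\<close> is injective on the closed rectangle, so no boundary point of the
  rectangle lands inside the open sector.\<close>

lemma frontier_sector: "frontier sector = polar ` (crect - rect)"
proof -
  have "frontier sector = polar ` crect - sector"
    by (simp add: frontier_def closure_sector interior_open[OF open_sector])
  also have "\<dots> = polar ` (crect - rect)"
    using polar_in_sector_iff by auto
  finally show ?thesis .
qed

text \<open>The derivatives enter as given functions on the rectangle, and the results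
  \<open>Wx\<close> and \<open>Wy\<close> have the same shape; the lemma can therefore be applied
  again to obtain second derivatives.\<close>

lemma push_forward:
  assumes Vs: "\<And>q. q \<in> rect \<Longrightarrow> ((\<lambda>s. V (s, snd q)) has_real_derivative Vs q) (at (fst q))"
    and Vt: "\<And>q. q \<in> rect \<Longrightarrow> ((\<lambda>t. V (fst q, t)) has_real_derivative Vt q) (at (snd q))"
    and cs: "continuous_on rect Vs" and ct: "continuous_on rect Vt"
  defines "Wx \<equiv> \<lambda>q. exp (- fst q) * (cos (snd q) * Vs q - sin (snd q) * Vt q)"
    and "Wy \<equiv> \<lambda>q. exp (- fst q) * (sin (snd q) * Vs q + cos (snd q) * Vt q)"
  shows "C1_on sector (\<lambda>p. V (polar_coords p))"
    and "\<And>p. p \<in> sector \<Longrightarrow> partial_x (\<lambda>p. V (polar_coords p)) p = Wx (polar_coords p)"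
    and "\<And>p. p \<in> sector \<Longrightarrow> partial_y (\<lambda>p. V (polar_coords p)) p = Wy (polar_coords p)"
proof -
  have V: "C1_on rect V" "\<And>q. q \<in> rect \<Longrightarrow> partial_x V q = Vs q" "\<And>q. q \<in> rect \<Longrightarrow> partial_y V q = Vt q"
    by (rule C1_onI[OF Vs Vt cs ct]; assumption)+
  have Wx: "((\<lambda>x. V (polar_coords (x, snd p))) has_real_derivative Wx (polar_coords p)) (at (fst p))"
    if p: "p \<in> sector" for p
  proof -
    have up: "snd p > 0" and q: "polar_coords p \<in> rect" using p by (auto simp: sector_iff)
    have "((\<lambda>x. V (log_radius (x, snd p), angle (x, snd p))) has_real_derivative
        (partial_x V (polar_coords p) * (exp (- log_radius p) * cos (angle p)) +
         partial_y V (polar_coords p) * - (exp (- log_radius p) * sin (angle p)))) (at (fst p))"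
      using C1_on_chain[OF open_rect V(1), of "\<lambda>x. log_radius (x, snd p)" "fst p" "\<lambda>x. angle (x, snd p)",
          OF _ polar_coords_has_derivative(1,3)[OF up]] q
      by (simp add: polar_coords_def)
    then show ?thesis
      unfolding polar_coords_def
      by (rule DERIV_cong) (use V(2,3)[OF q] in \<open>simp add: Wx_def polar_coords_def algebra_simps\<close>)
  qed
  have Wy: "((\<lambda>y. V (polar_coords (fst p, y))) has_real_derivative Wy (polar_coords p)) (at (snd p))"
    if p: "p \<in> sector" for p
  proof -
    have up: "snd p > 0" and q: "polar_coords p \<in> rect" using p by (auto simp: sector_iff)
    have "((\<lambda>y. V (log_radius (fst p, y), angle (fst p, y))) has_real_derivative
        (partial_x V (polar_coords p) * (exp (- log_radius p) * sin (angle p)) +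
         partial_y V (polar_coords p) * (exp (- log_radius p) * cos (angle p)))) (at (snd p))"
      using C1_on_chain[OF open_rect V(1), of "\<lambda>y. log_radius (fst p, y)" "snd p" "\<lambda>y. angle (fst p, y)",
          OF _ polar_coords_has_derivative(2,4)[OF up]] q
      by (simp add: polar_coords_def)
    then show ?thesis
      unfolding polar_coords_def
      by (rule DERIV_cong) (use V(2,3)[OF q] in \<open>simp add: Wy_def polar_coords_def algebra_simps\<close>)
  qed
  have pc: "continuous_on sector polar_coords"
    by (rule continuous_on_polar_coords) (auto simp: sector_iff)
  have im: "polar_coords ` sector \<subseteq> rect" by (auto simp: sector_iff)
  have "continuous_on rect Wx" "continuous_on rect Wy"
    unfolding Wx_def Wy_def by (intro continuous_intros cs ct)+
  then have c: "continuous_on sector (\<lambda>p. Wx (polar_coords p))" "continuous_on sector (\<lambda>p. Wy (polar_coords p))"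
    using continuous_on_compose2[OF _ pc im] by blast+
  show "C1_on sector (\<lambda>p. V (polar_coords p))"
    "\<And>p. p \<in> sector \<Longrightarrow> partial_x (\<lambda>p. V (polar_coords p)) p = Wx (polar_coords p)"
    "\<And>p. p \<in> sector \<Longrightarrow> partial_y (\<lambda>p. V (polar_coords p)) p = Wy (polar_coords p)"
    by (rule C1_onI[of sector "\<lambda>p. V (polar_coords p)", OF Wx Wy c]; assumption)+
qed

text \<open>In the sum of the pure second derivatives all first-order and mixed terms cancel,
  leaving exp (- 2 s) (Vss + Vtt). The hyperbolic factor y^2 = exp (2 s) sin^2 t removes the
  exponential.\<close>

lemma push_forward_C2:
  assumes Vs: "\<And>q. q \<in> rect \<Longrightarrow> ((\<lambda>s. V (s, snd q)) has_real_derivative Vs q) (at (fst q))"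
    and Vt: "\<And>q. q \<in> rect \<Longrightarrow> ((\<lambda>t. V (fst q, t)) has_real_derivative Vt q) (at (snd q))"
    and Vss: "\<And>q. q \<in> rect \<Longrightarrow> ((\<lambda>s. Vs (s, snd q)) has_real_derivative Vss q) (at (fst q))"
    and Vst: "\<And>q. q \<in> rect \<Longrightarrow> ((\<lambda>t. Vs (fst q, t)) has_real_derivative Vst q) (at (snd q))"
    and Vts: "\<And>q. q \<in> rect \<Longrightarrow> ((\<lambda>s. Vt (s, snd q)) has_real_derivative Vst q) (at (fst q))"
    and Vtt: "\<And>q. q \<in> rect \<Longrightarrow> ((\<lambda>t. Vt (fst q, t)) has_real_derivative Vtt q) (at (snd q))"
    and c: "continuous_on rect Vs" "continuous_on rect Vt" "continuous_on rect Vss"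
      "continuous_on rect Vst" "continuous_on rect Vtt"
  defines "u \<equiv> \<lambda>p. V (polar_coords p)"
  shows "C2_on sector u"
    and "\<And>p. p \<in> sector \<Longrightarrow> laplace_beltrami hyp_metric u p =
           (sin (angle p))\<^sup>2 * (Vss (polar_coords p) + Vtt (polar_coords p))"
proof -
  have u: "C1_on sector u"
    unfolding u_def by (rule push_forward(1)[OF Vs Vt c(1,2)])
  define Wx where "Wx q = exp (- fst q) * (cos (snd q) * Vs q - sin (snd q) * Vt q)" for q
  define Wy where "Wy q = exp (- fst q) * (sin (snd q) * Vs q + cos (snd q) * Vt q)" for q
  define Wxs where "Wxs q = - exp (- fst q) * (cos (snd q) * Vs q - sin (snd q) * Vt q) +
      exp (- fst q) * (cos (snd q) * Vss q - sin (snd q) * Vst q)" for q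
  define Wys where "Wys q = - exp (- fst q) * (sin (snd q) * Vs q + cos (snd q) * Vt q) +
      exp (- fst q) * (sin (snd q) * Vss q + cos (snd q) * Vst q)" for q
  define Wxt where "Wxt q = exp (- fst q) * (- sin (snd q) * Vs q + cos (snd q) * Vst q
      - (cos (snd q) * Vt q + sin (snd q) * Vtt q))" for q
  define Wyt where "Wyt q = exp (- fst q) * (cos (snd q) * Vs q + sin (snd q) * Vst q
      + (- sin (snd q) * Vt q + cos (snd q) * Vtt q))" for q
  have dexp: "((\<lambda>s. exp (- s)) has_real_derivative - exp (- s)) (at s)" for s :: real
    using DERIV_chain2[OF DERIV_exp DERIV_minus[OF DERIV_ident]] by simp
  have dWxs: "((\<lambda>s. Wx (s, snd q)) has_real_derivative Wxs q) (at (fst q))"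
    and dWys: "((\<lambda>s. Wy (s, snd q)) has_real_derivative Wys q) (at (fst q))" if q: "q \<in> rect" for q
    unfolding Wx_def Wy_def Wxs_def Wys_def fst_conv snd_conv
    by (rule DERIV_cong[OF DERIV_mult[OF dexp DERIV_diff[OF DERIV_cmult[OF Vss[OF q]]
            DERIV_cmult[OF Vts[OF q]]]]], simp add: algebra_simps)
       (rule DERIV_cong[OF DERIV_mult[OF dexp DERIV_add[OF DERIV_cmult[OF Vss[OF q]]
            DERIV_cmult[OF Vts[OF q]]]]], simp add: algebra_simps)
  have dWxt: "((\<lambda>t. Wx (fst q, t)) has_real_derivative Wxt q) (at (snd q))"
    and dWyt: "((\<lambda>t. Wy (fst q, t)) has_real_derivative Wyt q) (at (snd q))" if q: "q \<in> rect" for q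
    unfolding Wx_def Wy_def Wxt_def Wyt_def fst_conv snd_conv
    by (rule DERIV_cong[OF DERIV_cmult[OF DERIV_diff[OF DERIV_mult[OF DERIV_cos Vst[OF q]]
            DERIV_mult[OF DERIV_sin Vtt[OF q]]]]], simp add: algebra_simps)
       (rule DERIV_cong[OF DERIV_cmult[OF DERIV_add[OF DERIV_mult[OF DERIV_sin Vst[OF q]]
            DERIV_mult[OF DERIV_cos Vtt[OF q]]]]], simp add: algebra_simps)
  have cW: "continuous_on rect Wxs" "continuous_on rect Wys" "continuous_on rect Wxt" "continuous_on rect Wyt"
    unfolding Wxs_def Wys_def Wxt_def Wyt_def by (intro continuous_intros c)+
  have ux: "C1_on sector (\<lambda>p. Wx (polar_coords p))" and uy: "C1_on sector (\<lambda>p. Wy (polar_coords p))"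
    by (rule push_forward(1)[OF dWxs dWxt cW(1,3)] push_forward(1)[OF dWys dWyt cW(2,4)]; assumption)+
  have px: "Wx (polar_coords p) = partial_x u p" and py: "Wy (polar_coords p) = partial_y u p" if "p \<in> sector" for p
    unfolding u_def Wx_def Wy_def
    by (rule push_forward(2)[OF Vs Vt c(1,2) that, symmetric] push_forward(3)[OF Vs Vt c(1,2) that, symmetric]; assumption)+
  have "C1_on sector (partial_x u)" by (rule C1_on_cong(1)[OF open_sector px ux])
  moreover have "C1_on sector (partial_y u)" by (rule C1_on_cong(1)[OF open_sector py uy])
  ultimately show "C2_on sector u" unfolding C2_on_def using u by blast
  fix p assume p: "p \<in> sector"
  then have up: "snd p > 0" by (simp add: sector_iff)
  obtain s t where q: "polar_coords p = (s, t)" by (cases "polar_coords p")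
  have st: "log_radius p = s" "angle p = t" using q by (auto simp: polar_coords_def)
  have xx: "partial_x (partial_x u) p = exp (- s) * (cos t * Wxs (s, t) - sin t * Wxt (s, t))"
  proof -
    have "partial_x (partial_x u) p = partial_x (\<lambda>p. Wx (polar_coords p)) p"
      by (rule C1_on_cong(2)[OF open_sector px ux p])
    also have "\<dots> = exp (- fst (polar_coords p)) * (cos (snd (polar_coords p)) * Wxs (polar_coords p)
        - sin (snd (polar_coords p)) * Wxt (polar_coords p))"
      by (rule push_forward(2)[OF dWxs dWxt cW(1,3) p])
    finally show ?thesis by (simp add: q)
  qed
  have yy: "partial_y (partial_y u) p = exp (- s) * (sin t * Wys (s, t) + cos t * Wyt (s, t))"
  proof -
    have "partial_y (partial_y u) p = partial_y (\<lambda>p. Wy (polar_coords p)) p"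
      by (rule C1_on_cong(3)[OF open_sector py uy p])
    also have "\<dots> = exp (- fst (polar_coords p)) * (sin (snd (polar_coords p)) * Wys (polar_coords p)
        + cos (snd (polar_coords p)) * Wyt (polar_coords p))"
      by (rule push_forward(3)[OF dWys dWyt cW(2,4) p])
    finally show ?thesis by (simp add: q)
  qed
  have y: "snd p = exp s * sin t" using angle_cos_sin(2)[OF up] by (simp add: st)
  define si co where "si = sin t" and "co = cos t"
  have "partial_x (partial_x u) p + partial_y (partial_y u) p =
      exp (- s) * exp (- s) * (Vss (s, t) + Vtt (s, t)) * (si\<^sup>2 + co\<^sup>2)"
    unfolding xx yy Wxs_def Wxt_def Wys_def Wyt_def fst_conv snd_conv si_def[symmetric] co_def[symmetric]
    by (simp add: algebra_simps power2_eq_square)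
  then have sum: "partial_x (partial_x u) p + partial_y (partial_y u) p =
      exp (- s) * exp (- s) * (Vss (s, t) + Vtt (s, t))"
    by (simp add: si_def co_def)
  have "p \<in> half_plane" using up by (cases p) (simp add: half_plane_def)
  then have "laplace_beltrami hyp_metric u p =
      (exp s * exp (- s))\<^sup>2 * (sin t)\<^sup>2 * (Vss (s, t) + Vtt (s, t))"
    unfolding laplace_beltrami_hyp_metric[OF \<open>p \<in> half_plane\<close>] sum y
    by (simp add: power2_eq_square)
  then show "laplace_beltrami hyp_metric u p =
      (sin (angle p))\<^sup>2 * (Vss (polar_coords p) + Vtt (polar_coords p))"
    by (simp add: q st flip: exp_add)
qed

end

section \<open>Separation of variables\<close>

lemma integral_sine_products:
  fixes n :: nat
  assumes c: "c > 0" and n: "n \<ge> 1"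
  shows "((\<lambda>s. sin (c * s) * sin (real n * c * s)) has_integral (if n = 1 then pi / c / 2 else 0)) {0..pi / c}"
proof (cases "n = 1")
  case True
  have "((\<lambda>s. (1 - cos (2 * c * s)) / 2) has_integral
      ((pi / c - sin (2 * c * (pi / c)) / (2 * c)) / 2 - (0 - sin (2 * c * 0) / (2 * c)) / 2)) {0..pi / c}"
  proof (rule fundamental_theorem_of_calculus)
    fix s assume "s \<in> {0..pi / c}"
    have "((\<lambda>s. sin (2 * c * s)) has_real_derivative cos (2 * c * s) * (2 * c * 1)) (at s within {0..pi / c})"
      by (rule DERIV_chain2[OF DERIV_sin DERIV_cmult[OF DERIV_ident]])
    from DERIV_cdivide[OF DERIV_diff[OF DERIV_ident DERIV_cdivide[OF this, of "2 * c"]], of 2]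
    have "((\<lambda>s. (s - sin (2 * c * s) / (2 * c)) / 2) has_real_derivative (1 - cos (2 * c * s)) / 2)
        (at s within {0..pi / c})" using c by simp
    then show "((\<lambda>s. (s - sin (2 * c * s) / (2 * c)) / 2) has_vector_derivative (1 - cos (2 * c * s)) / 2)
        (at s within {0..pi / c})"
      by (simp add: has_real_derivative_iff_has_vector_derivative)
  qed (use c in simp)
  moreover have "(1 - cos (2 * c * s)) / 2 = sin (c * s) * sin (real n * c * s)" for s
    using cos_double_sin[of "c * s"] True by (simp add: power2_eq_square mult.assoc)
  moreover have "sin (2 * c * (pi / c)) = 0" using c by simp
  ultimately show ?thesis using True by simp
next
  case False
  \<comment> \<open>Product-to-sum frequencies. The antiderivative divides by \<open>p\<close>,
    which is zero exactly for n = 1; hence the separate case.\<close>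
  define p q where "p = (real n - 1) * c" and "q = (real n + 1) * c"
  have pq: "p \<noteq> 0" "q \<noteq> 0" using False n c by (auto simp: p_def q_def)
  have "((\<lambda>s. (cos (p * s) - cos (q * s)) / 2) has_integral
      ((sin (p * (pi / c)) / p - sin (q * (pi / c)) / q) / 2 - (sin (p * 0) / p - sin (q * 0) / q) / 2)) {0..pi / c}"
  proof (rule fundamental_theorem_of_calculus)
    fix s assume "s \<in> {0..pi / c}"
    have d: "((\<lambda>s. sin (r * s)) has_real_derivative cos (r * s) * (r * 1)) (at s within {0..pi / c})" for r
      by (rule DERIV_chain2[OF DERIV_sin DERIV_cmult[OF DERIV_ident]])
    from DERIV_cdivide[OF DERIV_diff[OF DERIV_cdivide[OF d, of p p] DERIV_cdivide[OF d, of q q]], of 2]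
    have "((\<lambda>s. (sin (p * s) / p - sin (q * s) / q) / 2) has_real_derivative (cos (p * s) - cos (q * s)) / 2)
        (at s within {0..pi / c})" using pq by simp
    then show "((\<lambda>s. (sin (p * s) / p - sin (q * s) / q) / 2) has_vector_derivative (cos (p * s) - cos (q * s)) / 2)
        (at s within {0..pi / c})"
      by (simp add: has_real_derivative_iff_has_vector_derivative)
  qed (use c in simp)
  moreover have "(cos (p * s) - cos (q * s)) / 2 = sin (c * s) * sin (real n * c * s)" for s
  proof -
    have "p * s = real n * c * s - c * s" "q * s = real n * c * s + c * s"
      by (simp_all add: p_def q_def algebra_simps)
    then show ?thesis by (simp only: cos_add cos_diff) simp
  qed
  moreover have "sin (p * (pi / c)) = 0" "sin (q * (pi / c)) = 0"
  proof -
    have "p * (pi / c) = real (n - 1) * pi" "q * (pi / c) = real (n + 1) * pi"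
      using c n by (simp_all add: p_def q_def)
    then show "sin (p * (pi / c)) = 0" "sin (q * (pi / c)) = 0" by (simp_all only: sin_npi)
  qed
  ultimately show ?thesis using False by simp
qed

context polar_rectangle
begin

lemma separated_eigenfunction:
  assumes ode: "ode_solution a b (\<lambda>t. lam * (1 / (sin t)\<^sup>2) - k\<^sup>2) \<phi> \<phi>'"
    and \<phi>0: "\<phi> a = 0" "\<phi> b = 0" and pos: "\<And>t. a < t \<Longrightarrow> t < b \<Longrightarrow> \<phi> t > 0"
    and k: "k > 0" "sin (k * S) = 0"
  shows "dirichlet_eigenfunction hyp_metric sector lam (\<lambda>p. sin (k * log_radius p) * \<phi> (angle p))"
proof -
  define V where "V q = sin (k * fst q) * \<phi> (snd q)" for q :: "real \<times> real"
  define Vs where "Vs q = k * cos (k * fst q) * \<phi> (snd q)" for q :: "real \<times> real"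
  define Vt where "Vt q = sin (k * fst q) * \<phi>' (snd q)" for q :: "real \<times> real"
  define Vss where "Vss q = - k\<^sup>2 * sin (k * fst q) * \<phi> (snd q)" for q :: "real \<times> real"
  define Vst where "Vst q = k * cos (k * fst q) * \<phi>' (snd q)" for q :: "real \<times> real"
  define Vtt where "Vtt q = sin (k * fst q) * (- (lam * (1 / (sin (snd q))\<^sup>2) - k\<^sup>2) * \<phi> (snd q))"
    for q :: "real \<times> real"
  have d\<phi>: "(\<phi> has_real_derivative \<phi>' t) (at t)" if "a < t" "t < b" for t
    using ode_solution_has_derivative_at[OF ode that] .
  have d\<phi>': "(\<phi>' has_real_derivative - (lam * (1 / (sin t)\<^sup>2) - k\<^sup>2) * \<phi> t) (at t)" if "a < t" "t < b" for t
  proof -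
    have "(\<phi>' has_real_derivative - (lam * (1 / (sin t)\<^sup>2) - k\<^sup>2) * \<phi> t) (at t within {a..b})"
      using ode that unfolding ode_solution_def by (metis atLeastAtMost_iff less_imp_le)
    then show ?thesis using at_within_Icc_at[of a t b] that by simp
  qed
  have dsin: "((\<lambda>s. sin (k * s)) has_real_derivative k * cos (k * s)) (at s)" for s
    by (rule DERIV_cong[OF DERIV_chain2[OF DERIV_sin DERIV_cmult[OF DERIV_ident]]]) simp
  have dcos: "((\<lambda>s. k * cos (k * s)) has_real_derivative - k\<^sup>2 * sin (k * s)) (at s)" for s
    by (rule DERIV_cong[OF DERIV_cmult[OF DERIV_chain2[OF DERIV_cos DERIV_cmult[OF DERIV_ident]]]])
      (simp add: power2_eq_square)
  have \<phi>c: "continuous_on {a..b} \<phi>" "continuous_on {a..b} \<phi>'"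
    using ode_solution_continuous[OF ode] by auto
  have c\<phi>: "continuous_on crect (\<lambda>q. \<phi> (snd q))"
    by (rule continuous_on_compose2[OF \<phi>c(1) continuous_on_snd[OF continuous_on_id]]) (auto simp: crect_def)
  have c\<phi>': "continuous_on crect (\<lambda>q. \<phi>' (snd q))"
    by (rule continuous_on_compose2[OF \<phi>c(2) continuous_on_snd[OF continuous_on_id]]) (auto simp: crect_def)
  note cr = continuous_on_subset[OF c\<phi> rect_subset] continuous_on_subset[OF c\<phi>' rect_subset]
  have sin0: "sin (snd q) \<noteq> 0" if "q \<in> rect" for q
    using crect_angle[of q] rect_subset that sin_gt_zero[of "snd q"] by auto
  have c: "continuous_on rect Vs" "continuous_on rect Vt" "continuous_on rect Vss"
      "continuous_on rect Vst" "continuous_on rect Vtt"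
    unfolding Vs_def Vt_def Vss_def Vst_def Vtt_def
    by (intro continuous_intros cr; use sin0 in simp)+
  have in_rect: "a < snd q" "snd q < b" if "q \<in> rect" for q using that by (auto simp: rect_def)
  have d: "((\<lambda>s. V (s, snd q)) has_real_derivative Vs q) (at (fst q))"
      "((\<lambda>t. V (fst q, t)) has_real_derivative Vt q) (at (snd q))"
      "((\<lambda>s. Vs (s, snd q)) has_real_derivative Vss q) (at (fst q))"
      "((\<lambda>t. Vs (fst q, t)) has_real_derivative Vst q) (at (snd q))"
      "((\<lambda>s. Vt (s, snd q)) has_real_derivative Vst q) (at (fst q))"
      "((\<lambda>t. Vt (fst q, t)) has_real_derivative Vtt q) (at (snd q))" if "q \<in> rect" for q
    unfolding V_def Vs_def Vt_def Vss_def Vst_def Vtt_def fst_conv snd_conv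
    by (rule DERIV_cmult_right DERIV_cmult dsin dcos d\<phi>[OF in_rect[OF that]] d\<phi>'[OF in_rect[OF that]])+
  have u: "(\<lambda>p. sin (k * log_radius p) * \<phi> (angle p)) = (\<lambda>p. V (polar_coords p))"
    by (simp add: V_def polar_coords_def)
  show ?thesis
    unfolding dirichlet_eigenfunction_def u
  proof (intro conjI ballI)
    show "C2_on sector (\<lambda>p. V (polar_coords p))"
      by (rule push_forward_C2(1)[OF d c])
    have "continuous_on crect V" unfolding V_def by (intro continuous_intros c\<phi>)
    then show "continuous_on (closure sector) (\<lambda>p. V (polar_coords p))"
    proof (rule continuous_on_compose2)
      show "continuous_on (closure sector) polar_coords"
        by (rule continuous_on_polar_coords) (use polar_crect_upper in \<open>auto simp: closure_sector\<close>)
      show "polar_coords ` closure sector \<subseteq> crect"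
        using polar_coords_polar' by (auto simp: closure_sector)
    qed
    fix p assume "p \<in> frontier sector"
    then obtain q where q: "q \<in> crect" "q \<notin> rect" "p = polar q" by (auto simp: frontier_sector)
    then have "fst q = 0 \<or> fst q = S \<or> snd q = a \<or> snd q = b" by (auto simp: crect_def rect_def)
    then have "V q = 0" using k(2) by (elim disjE) (simp_all add: V_def \<phi>0)
    then show "V (polar_coords p) = 0" using q by (simp add: polar_coords_polar')
  next
    fix p assume p: "p \<in> sector"
    then have "sin (snd (polar_coords p)) \<noteq> 0" by (intro sin0) (simp add: sector_iff)
    then have s: "sin (angle p) \<noteq> 0" by (simp add: polar_coords_def)
    have "laplace_beltrami hyp_metric (\<lambda>p. V (polar_coords p)) p =
        (sin (angle p))\<^sup>2 * (Vss (polar_coords p) + Vtt (polar_coords p))"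
      by (rule push_forward_C2(2)[OF d c p])
    also have "Vss (polar_coords p) + Vtt (polar_coords p) = - lam * (1 / (sin (angle p))\<^sup>2) * V (polar_coords p)"
      by (simp add: Vss_def Vtt_def V_def polar_coords_def algebra_simps)
    finally show "- laplace_beltrami hyp_metric (\<lambda>p. V (polar_coords p)) p = lam * V (polar_coords p)"
      using s by simp
  next
    \<comment> \<open>A witness for nonvanishing. The midpoint can be a zero of the sine, as happens
      for \<open>k = 2 * c\<close>, so \<open>s\<close> is also capped by a quarter period.\<close>
    define s where "s = min (S / 2) (pi / (2 * k))"
    have "s \<le> pi / (2 * k)" by (simp add: s_def)
    then have "k * s \<le> pi / 2" using k by (simp add: field_simps)
    then have ks: "k * s < pi" using pi_gt_zero by linarith
    have "0 < s" using S k by (simp add: s_def)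
    moreover have "s \<le> S / 2" by (simp add: s_def)
    ultimately have s: "0 < s" "s < S" "0 < k * s" "k * s < pi" using S k ks by auto
    have q: "(s, (a + b) / 2) \<in> rect" using s ab by (simp add: rect_def)
    have "V (s, (a + b) / 2) > 0"
      unfolding V_def using s pos[of "(a + b) / 2"] ab by (auto intro!: mult_pos_pos sin_gt_zero)
    then show "\<exists>p\<in>sector. V (polar_coords p) \<noteq> 0"
      using q subsetD[OF rect_subset q]
      by (intro bexI[of _ "polar (s, (a + b) / 2)"]) (auto simp: polar_coords_polar' polar_in_sector_iff)
  qed
qed

lemma sine_coefficient_ode_of_eigenfunction:
  fixes n :: nat
  assumes u: "dirichlet_eigenfunction hyp_metric sector \<mu> u"
    and c: "c > 0" "S = pi / c"
  defines "A \<equiv> \<lambda>t. integral {0..S} (\<lambda>s. u (polar (s, t)) * sin (real n * c * s))"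
  shows "\<exists>A'. ode_solution a b (\<lambda>t. \<mu> * (1 / (sin t)\<^sup>2) - (real n * c)\<^sup>2) A A'"
    and "A a = 0" and "A b = 0"
proof -
  define ux uy where "ux = partial_x u" and "uy = partial_y u"
  have C1: "C1_on sector u" and C1x: "C1_on sector ux" and C1y: "C1_on sector uy"
    using u by (auto simp: dirichlet_eigenfunction_def C2_on_def ux_def uy_def)
  define X Y where "X s t = exp s * cos t" and "Y s t = exp s * sin t" for s t :: real
  have XY: "polar (s, t) = (X s t, Y s t)" for s t by (simp add: polar_def X_def Y_def)
  have in_sector: "(X s t, Y s t) \<in> sector" if "s \<in> {0<..<S}" "t \<in> {a<..<b}" for s t
    using that by (auto simp: sector_def rect_def simp flip: XY)
  have dX: "((\<lambda>s. X s t) has_real_derivative X s t) (at s)" "((\<lambda>s. Y s t) has_real_derivative Y s t) (at s)"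
      "((\<lambda>t. X s t) has_real_derivative - Y s t) (at t)" "((\<lambda>t. Y s t) has_real_derivative X s t) (at t)" for s t
    unfolding X_def Y_def
    by (rule DERIV_cmult_right[OF DERIV_exp] DERIV_cmult[OF DERIV_sin]
        DERIV_cmult[OF DERIV_cos, THEN DERIV_cong] | simp)+
  define v vs vt where "v s t = u (X s t, Y s t)"
    and "vs s t = ux (X s t, Y s t) * X s t + uy (X s t, Y s t) * Y s t"
    and "vt s t = ux (X s t, Y s t) * - Y s t + uy (X s t, Y s t) * X s t" for s t
  define vss where "vss s t =
      (partial_x ux (X s t, Y s t) * X s t + partial_y ux (X s t, Y s t) * Y s t) * X s t + X s t * ux (X s t, Y s t)
    + ((partial_x uy (X s t, Y s t) * X s t + partial_y uy (X s t, Y s t) * Y s t) * Y s t + Y s t * uy (X s t, Y s t))"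
    for s t
  define vtt where "vtt s t =
      (partial_x ux (X s t, Y s t) * - Y s t + partial_y ux (X s t, Y s t) * X s t) * - Y s t + - X s t * ux (X s t, Y s t)
    + ((partial_x uy (X s t, Y s t) * - Y s t + partial_y uy (X s t, Y s t) * X s t) * X s t + - Y s t * uy (X s t, Y s t))"
    for s t
  have Au: "A = (\<lambda>t. integral {0..S} (\<lambda>s. v s t * sin (real n * c * s)))"
    by (simp add: A_def v_def XY)
  have rect_cont: "continuous_on ({0<..<S} \<times> {a<..<b}) (\<lambda>q. g (X (fst q) (snd q), Y (fst q) (snd q)))"
    if "continuous_on sector g" for g :: "real \<times> real \<Rightarrow> real"
    by (rule continuous_on_compose2[OF that])
      (use in_sector in \<open>auto simp: X_def Y_def intro!: continuous_intros\<close>)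
  have cX: "continuous_on ({0<..<S} \<times> {a<..<b}) (\<lambda>q. X (fst q) (snd q))"
    "continuous_on ({0<..<S} \<times> {a<..<b}) (\<lambda>q. Y (fst q) (snd q))"
    unfolding X_def Y_def by (intro continuous_intros)+
  have cu: "continuous_on sector ux" "continuous_on sector uy"
    "continuous_on sector (partial_x ux)" "continuous_on sector (partial_y ux)"
    "continuous_on sector (partial_x uy)" "continuous_on sector (partial_y uy)"
    using C1 C1x C1y by (auto simp: C1_on_def ux_def uy_def)
  have vanish: "v s t = 0" if "(s, t) \<in> crect - rect" for s t
  proof -
    have "polar (s, t) \<in> frontier sector" using that by (auto simp: frontier_sector)
    then show ?thesis using u by (simp add: dirichlet_eigenfunction_def v_def XY)
  qed
  have cv: "continuous_on ({0..S} \<times> {a..b}) (\<lambda>(s, t). v s t)"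
    proof -
      have "continuous_on crect (\<lambda>q. u (polar q))"
        by (rule continuous_on_compose2[OF _ continuous_on_polar, of "closure sector"])
          (use u in \<open>auto simp: dirichlet_eigenfunction_def closure_sector\<close>)
      then show ?thesis by (simp add: crect_def v_def case_prod_beta polar_def X_def Y_def)
    qed
  have dvs: "((\<lambda>s. v s t) has_real_derivative vs s t) (at s)"
      if "s \<in> {0<..<S}" "t \<in> {a<..<b}" for s t
      unfolding v_def vs_def ux_def uy_def
      by (rule C1_on_chain[OF open_sector C1 in_sector[OF that] dX(1,2)])
  have dvt: "((\<lambda>t. v s t) has_real_derivative vt s t) (at t)"
      if "s \<in> {0<..<S}" "t \<in> {a<..<b}" for s t
      unfolding v_def vt_def ux_def uy_def
      by (rule C1_on_chain[OF open_sector C1 in_sector[OF that] dX(3,4)])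
  have dvss: "((\<lambda>s. vs s t) has_real_derivative vss s t) (at s)"
      if "s \<in> {0<..<S}" "t \<in> {a<..<b}" for s t
      unfolding vs_def vss_def
      by (intro DERIV_add DERIV_mult dX(1,2) C1_on_chain[OF open_sector C1x in_sector[OF that] dX(1,2)]
          C1_on_chain[OF open_sector C1y in_sector[OF that] dX(1,2)])
  have dvtt: "((\<lambda>t. vt s t) has_real_derivative vtt s t) (at t)"
      if "s \<in> {0<..<S}" "t \<in> {a<..<b}" for s t
      unfolding vt_def vtt_def
      by (intro DERIV_add DERIV_mult DERIV_minus dX(3,4) C1_on_chain[OF open_sector C1x in_sector[OF that] dX(3,4)]
          C1_on_chain[OF open_sector C1y in_sector[OF that] dX(3,4)])
  \<comment> \<open>First-order terms cancel and each mixed partial derivative cancels against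
    itself, leaving r^2 times the Euclidean Laplacian of \<open>u\<close>; finally r^2 = y^2 / sin^2
    t brings in the hyperbolic one.\<close>
  have pde: "vss s t + vtt s t = - \<mu> * (1 / (sin t)\<^sup>2) * v s t"
      if st: "s \<in> {0<..<S}" "t \<in> {a<..<b}" for s t
    proof -
      let ?p = "(X s t, Y s t)"
      have sin: "sin t > 0" using st a b by (intro sin_gt_zero) auto
      then have "?p \<in> half_plane" by (simp add: half_plane_def Y_def)
      then have lap: "- ((Y s t)\<^sup>2 * (partial_x ux ?p + partial_y uy ?p)) = \<mu> * v s t"
        using u in_sector[OF st]
        by (auto simp: dirichlet_eigenfunction_def laplace_beltrami_hyp_metric v_def ux_def uy_def)
      have "vss s t + vtt s t = ((X s t)\<^sup>2 + (Y s t)\<^sup>2) * (partial_x ux ?p + partial_y uy ?p)"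
        by (simp add: vss_def vtt_def power2_eq_square algebra_simps)
      also have "(X s t)\<^sup>2 + (Y s t)\<^sup>2 = (Y s t)\<^sup>2 / (sin t)\<^sup>2"
        using sin by (simp add: X_def Y_def power_mult_distrib flip: distrib_left)
      finally have "vss s t + vtt s t =
          (Y s t)\<^sup>2 * (partial_x ux ?p + partial_y uy ?p) / (sin t)\<^sup>2" by simp
      also have "(Y s t)\<^sup>2 * (partial_x ux ?p + partial_y uy ?p) = - (\<mu> * v s t)" using lap by linarith
      finally show ?thesis by simp
    qed
  have sin0: "sin t > 0" if "t \<in> {a..b}" for t using that a b by (intro sin_gt_zero) auto
  have wc: "continuous_on {a..b} (\<lambda>t. 1 / (sin t)\<^sup>2)"
    using sin0 by (intro continuous_intros) force
  have v0: "\<And>t. t \<in> {a..b} \<Longrightarrow> v 0 t = 0" "\<And>t. t \<in> {a..b} \<Longrightarrow> v S t = 0"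
    "\<And>s. s \<in> {0..S} \<Longrightarrow> v s a = 0" "\<And>s. s \<in> {0..S} \<Longrightarrow> v s b = 0"
    using S ab by (auto intro!: vanish simp: crect_def rect_def)
  have vtc: "continuous_on ({0<..<S} \<times> {a<..<b}) (\<lambda>(s, t). vt s t)"
    unfolding case_prod_beta vt_def by (intro continuous_intros rect_cont cX cu)
  have vttc: "continuous_on ({0<..<S} \<times> {a<..<b}) (\<lambda>(s, t). vtt s t)"
    unfolding case_prod_beta vtt_def by (intro continuous_intros rect_cont cX cu)
  note result = sine_coefficient_ode[OF c(1) ab c(2) refl cv v0 dvs dvss dvt dvtt vtc vttc wc pde]
  show "\<exists>A'. ode_solution a b (\<lambda>t. \<mu> * (1 / (sin t)\<^sup>2) - (real n * c)\<^sup>2) A A'"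
    unfolding Au by (rule result(1))
  show "A a = 0" unfolding Au by (rule result(2))
  show "A b = 0" unfolding Au by (rule result(3))
qed


text \<open>The rigidity statement. A nonzero coefficient with n at least 2 would contradict
  comparison with \<psi>, and \<open>small(2)\<close> excludes a sign change of the first
  coefficient. Completeness of the sines then recovers \<open>u\<close>, and \<open>u\<close> being
  nonzero forces the eigenvalue to be \<open>lam1\<close>.\<close>

lemma eigenfunction_alternative:
  assumes c: "c > 0" "S = pi / c"
    and w2: "\<And>t. t \<in> {a..b} \<Longrightarrow> 1 / (sin t)\<^sup>2 \<le> 2"
    and \<phi>: "ode_solution a b (\<lambda>t. lam1 * (1 / (sin t)\<^sup>2) - c\<^sup>2) \<phi> \<phi>'" "\<phi> a = 0" "\<phi> b = 0"
      "\<And>t. a < t \<Longrightarrow> t < b \<Longrightarrow> \<phi> t > 0"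
    and \<psi>: "ode_solution a b (\<lambda>t. lam2 * (1 / (sin t)\<^sup>2) - (2 * c)\<^sup>2) \<psi> \<psi>'"
      "\<And>t. a < t \<Longrightarrow> t < b \<Longrightarrow> \<psi> t > 0"
    and u: "dirichlet_eigenfunction hyp_metric sector \<mu> u"
    and small: "\<mu> < lam2" "2 * \<mu> < (2 * pi / (b - a))\<^sup>2 + c\<^sup>2"
  shows "\<mu> = lam1 \<and> (\<exists>\<kappa>. \<forall>p\<in>sector. u p = \<kappa> * (sin (c * log_radius p) * \<phi> (angle p)))"
proof -
  define A where "A n t = integral {0..S} (\<lambda>s. u (polar (s, t)) * sin (real n * c * s))" for n t
  have A: "\<exists>A'. ode_solution a b (\<lambda>t. \<mu> * (1 / (sin t)\<^sup>2) - (real n * c)\<^sup>2) (A n) A'" "A n a = 0" "A n b = 0"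
    for n unfolding A_def by (rule sine_coefficient_ode_of_eigenfunction[OF u c])+
  have sin0: "sin t > 0" if "t \<in> {a..b}" for t using that a b by (intro sin_gt_zero) auto
  have w1: "1 \<le> 1 / (sin t)\<^sup>2" if "t \<in> {a..b}" for t
  proof -
    have "(sin t)\<^sup>2 \<le> 1" by (simp add: abs_square_le_1)
    then show ?thesis using sin0[OF that] by simp
  qed
  have high: "A n t = 0" if n: "n \<ge> 2" and t: "t \<in> {a..b}" for n t
  proof (rule ccontr)
    assume "A n t \<noteq> 0"
    obtain A' where A': "ode_solution a b (\<lambda>t. \<mu> * (1 / (sin t)\<^sup>2) - (real n * c)\<^sup>2) (A n) A'"
      using A(1) by blast
    obtain r where r: "a < r" "r < b"
        "lam2 * (1 / (sin r)\<^sup>2) - (2 * c)\<^sup>2 \<le> \<mu> * (1 / (sin r)\<^sup>2) - (real n * c)\<^sup>2"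
      using dirichlet_solution_comparison[OF A' \<psi>(1) A(2,3) t \<open>A n t \<noteq> 0\<close> \<psi>(2)] by blast
    have "2 * c \<le> real n * c" using n c by (intro mult_right_mono) auto
    then have "(2 * c)\<^sup>2 \<le> (real n * c)\<^sup>2" using c by (intro power_mono) auto
    moreover have "\<mu> * (1 / (sin r)\<^sup>2) < lam2 * (1 / (sin r)\<^sup>2)"
      using small(1) sin0[of r] r by (intro mult_strict_right_mono) auto
    ultimately show False using r(3) by simp
  qed
  obtain A' where A': "ode_solution a b (\<lambda>t. \<mu> * (1 / (sin t)\<^sup>2) - c\<^sup>2) (A 1) A'"
    using A(1)[of 1] by auto
  have c2: "c\<^sup>2 > 0" using c by simp
  have w12: "1 \<le> 1 / (sin t)\<^sup>2 \<and> 1 / (sin t)\<^sup>2 \<le> 2" if "t \<in> {a..b}" for t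
    using w1[OF that] w2[OF that] by blast
  have "(\<mu> = lam1 \<and> (\<exists>k. \<forall>t\<in>{a..b}. A 1 t = k * \<phi> t)) \<or> (\<forall>t\<in>{a..b}. A 1 t = 0)"
    using dirichlet_solution_cases[OF ab A' A(2,3) \<phi> w12 c2] small(2) by auto
  \<comment> \<open>The case of a vanishing first coefficient is absorbed as \<open>k = 0\<close>
    and excluded at the end.\<close>
  then obtain k where k: "\<And>t. t \<in> {a..b} \<Longrightarrow> A 1 t = k * \<phi> t" and dich: "\<mu> = lam1 \<or> k = 0"
    by (metis mult_zero_left)
  \<comment> \<open>The square of sin (c s) integrates to S / 2 over \<open>{0..S}\<close>.\<close>
  define \<kappa> where "\<kappa> = 2 * k / S"
  have uc: "continuous_on crect (\<lambda>q. u (polar q))"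
    by (rule continuous_on_compose2[OF _ continuous_on_polar, of "closure sector"])
      (use u in \<open>auto simp: dirichlet_eigenfunction_def closure_sector\<close>)
  have u_eq: "u (polar (s, t)) = \<kappa> * (sin (c * s) * \<phi> t)" if s: "0 < s" "s < S" and t: "a < t" "t < b" for s t
  proof -
    have vc: "continuous_on {0..S} (\<lambda>s. u (polar (s, t)))"
      by (rule continuous_on_compose2[OF uc, of _ "\<lambda>s. (s, t)"])
        (use t in \<open>auto simp: crect_def intro!: continuous_intros\<close>)
    have "u (polar (s, t)) - \<kappa> * \<phi> t * sin (c * s) = 0"
    proof (rule sine_coefficients_determine[OF c(1),
          where g="\<lambda>s. u (polar (s, t)) - \<kappa> * \<phi> t * sin (c * s)" and s=s])
      show "continuous_on {0..pi / c} (\<lambda>s. u (polar (s, t)) - \<kappa> * \<phi> t * sin (c * s))"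
        using vc by (intro continuous_intros) (simp add: c)
      fix n :: nat assume n: "n \<ge> 1"
      have 1: "((\<lambda>s. u (polar (s, t)) * sin (real n * c * s)) has_integral A n t) {0..S}"
        unfolding A_def by (intro integrable_integral integrable_continuous_real continuous_intros vc)
      have 2: "((\<lambda>s. \<kappa> * \<phi> t * (sin (c * s) * sin (real n * c * s))) has_integral
          \<kappa> * \<phi> t * (if n = 1 then S / 2 else 0)) {0..S}"
        unfolding c(2) by (rule has_integral_mult_right[OF integral_sine_products[OF c(1) n]])
      have "A n t - \<kappa> * \<phi> t * (if n = 1 then S / 2 else 0) = 0"
        using high[of n t] k[of t] n t S by (auto simp: \<kappa>_def)
      then have "((\<lambda>s. u (polar (s, t)) * sin (real n * c * s) - \<kappa> * \<phi> t * (sin (c * s) * sin (real n * c * s)))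
          has_integral 0) {0..S}"
        using has_integral_diff[OF 1 2] by simp
      then show "integral {0..pi / c} (\<lambda>s. (u (polar (s, t)) - \<kappa> * \<phi> t * sin (c * s)) * sin (real n * c * s)) = 0"
        by (intro integral_unique) (simp add: c(2) left_diff_distrib mult.assoc)
    qed (use s c in auto)
    then show ?thesis by simp
  qed
  have on_sector: "u p = \<kappa> * (sin (c * log_radius p) * \<phi> (angle p))" if "p \<in> sector" for p
    using that u_eq[of "log_radius p" "angle p"] polar_polar_coords[of p]
    by (simp add: sector_iff rect_def polar_coords_def)
  have "k \<noteq> 0"
  proof
    assume "k = 0"
    then have "\<forall>p\<in>sector. u p = 0" using on_sector by (simp add: \<kappa>_def)
    then show False using u by (auto simp: dirichlet_eigenfunction_def)
  qed
  then show ?thesis using dich on_sector by blast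
qed

text \<open>The numbers \<open>lam1\<close> and \<open>lam2\<close> are the ground state energies
  for n = 1 and n = 2. The statement keeps what the gap is made of: an upper bound for the first
  eigenvalue, a lower bound for the second, and the distance between the two energies.\<close>

lemma first_two_eigenvalues:
  assumes c: "c > 0" "S = pi / c"
    and w2: "\<And>t. t \<in> {a..b} \<Longrightarrow> 1 / (sin t)\<^sup>2 \<le> 2" and w2': "\<And>t. a < t \<Longrightarrow> t < b \<Longrightarrow> 1 / (sin t)\<^sup>2 < 2"
  shows "\<exists>lam1 lam2. dirichlet_eigenvalue hyp_metric sector 1 \<le> lam1 \<and>
    min lam2 (((2 * pi / (b - a))\<^sup>2 + c\<^sup>2) / 2) \<le> dirichlet_eigenvalue hyp_metric sector 2 \<and>
    lam1 \<le> c\<^sup>2 + (pi / (b - a))\<^sup>2 \<and> lam1 + 3 * c\<^sup>2 / 2 < lam2"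
proof -
  have sin0: "sin t > 0" if "t \<in> {a..b}" for t using that a b by (intro sin_gt_zero) auto
  have w1: "1 \<le> 1 / (sin t)\<^sup>2" if "t \<in> {a..b}" for t
  proof -
    have "(sin t)\<^sup>2 \<le> 1" by (simp add: abs_square_le_1)
    then show ?thesis using sin0[OF that] by simp
  qed
  have wc: "continuous_on {a..b} (\<lambda>t. 1 / (sin t)\<^sup>2)"
    using sin0 by (intro continuous_intros) force
  have c2: "c\<^sup>2 > 0" "(2 * c)\<^sup>2 > 0" using c by auto
  obtain lam1 \<phi> \<phi>' where lam1: "lam1 \<le> c\<^sup>2 + (pi / (b - a))\<^sup>2"
    and \<phi>: "ode_solution a b (\<lambda>t. lam1 * (1 / (sin t)\<^sup>2) - c\<^sup>2) \<phi> \<phi>'" "\<phi> a = 0" "\<phi> b = 0"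
      "\<And>t. a < t \<Longrightarrow> t < b \<Longrightarrow> \<phi> t > 0"
    by (rule ground_state_exists[OF ab wc w1 c2(1)]) (assumption | rule that)+
  obtain lam2 \<psi> \<psi>' where "lam2 \<le> (2 * c)\<^sup>2 + (pi / (b - a))\<^sup>2"
    and \<psi>: "ode_solution a b (\<lambda>t. lam2 * (1 / (sin t)\<^sup>2) - (2 * c)\<^sup>2) \<psi> \<psi>'" "\<psi> a = 0" "\<psi> b = 0"
      "\<And>t. a < t \<Longrightarrow> t < b \<Longrightarrow> \<psi> t > 0"
    by (rule ground_state_exists[OF ab wc w1 c2(2)]) (assumption | rule that)+
  \<comment> \<open>The two ground states are compared with each other. The point \<open>t\<close>
    lies in the interior, where the weight is strictly below 2; this makes the gap strict.\<close>
  have "\<exists>t. a < t \<and> t < b \<and> lam1 * (1 / (sin t)\<^sup>2) - c\<^sup>2 \<le> lam2 * (1 / (sin t)\<^sup>2) - (2 * c)\<^sup>2"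
    by (rule sturm_comparison[OF ab \<psi>(1) \<phi>(1) \<psi>(2,3)]) (use \<psi>(4) \<phi>(4) in auto)
  then obtain t where t: "a < t" "t < b" "3 * c\<^sup>2 \<le> (lam2 - lam1) * (1 / (sin t)\<^sup>2)"
    by (auto simp: power_mult_distrib diff_divide_distrib)
  have gap: "lam1 + 3 * c\<^sup>2 / 2 < lam2"
  proof -
    have "0 < (lam2 - lam1) * (1 / (sin t)\<^sup>2)" using t(3) c2(1) by linarith
    then have "lam2 - lam1 > 0" using sin0[of t] t by (simp add: zero_less_divide_iff)
    then have "(lam2 - lam1) * (1 / (sin t)\<^sup>2) < (lam2 - lam1) * 2"
      using w2' t by (intro mult_strict_left_mono) auto
    then show ?thesis using t by simp
  qed
  define B where "B = min lam2 (((2 * pi / (b - a))\<^sup>2 + c\<^sup>2) / 2)"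
  define U1 U2 where "U1 p = sin (c * log_radius p) * \<phi> (angle p)"
    and "U2 p = sin (2 * c * log_radius p) * \<psi> (angle p)" for p
  have eig1: "dirichlet_eigenfunction hyp_metric sector lam1 U1"
    unfolding U1_def by (rule separated_eigenfunction[OF \<phi>]) (use c in auto)
  have eig2: "dirichlet_eigenfunction hyp_metric sector lam2 U2"
    unfolding U2_def by (rule separated_eigenfunction[OF \<psi>]) (use c in auto)
  have alt: "\<mu> = lam1 \<and> (\<exists>\<kappa>. \<forall>p\<in>sector. u p = \<kappa> * U1 p)"
    if "dirichlet_eigenfunction hyp_metric sector \<mu> u" "\<mu> < B" for \<mu> u
    unfolding U1_def
    by (rule eigenfunction_alternative[OF c w2 \<phi> \<psi>(1,4) that(1)]) (use that(2) in \<open>auto simp: B_def\<close>)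
  have "dirichlet_eigenvalue hyp_metric sector 1 \<le> lam1"
    unfolding dirichlet_eigenvalue_def
  proof (rule cInf_lower)
    have "lin_indep_on sector 1 (\<lambda>_. U1)"
      using eig1 by (auto simp: lin_indep_on_def dirichlet_eigenfunction_def)
    then show "lam1 \<in> {\<Lambda>. \<exists>\<mu> u. (\<forall>i<1. \<mu> i \<le> \<Lambda> \<and> dirichlet_eigenfunction hyp_metric sector (\<mu> i) (u i)) \<and>
        lin_indep_on sector 1 u}"
      using eig1 by (intro CollectI exI[of _ "\<lambda>_. lam1"] exI[of _ "\<lambda>_. U1"]) auto
    \<comment> \<open>\<open>Inf\<close> is a lower bound only for sets bounded below. Here an
      eigenvalue is either \<open>lam1\<close> or at least \<open>B\<close>.\<close>
    show "bdd_below {\<Lambda>. \<exists>\<mu> u. (\<forall>i<1. \<mu> i \<le> \<Lambda> \<and> dirichlet_eigenfunction hyp_metric sector (\<mu> i) (u i)) \<and>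
        lin_indep_on sector 1 u}"
    proof (rule bdd_belowI[of _ "min lam1 B"])
      fix \<Lambda> assume "\<Lambda> \<in> {\<Lambda>. \<exists>\<mu> u. (\<forall>i<1. \<mu> i \<le> \<Lambda> \<and> dirichlet_eigenfunction hyp_metric sector (\<mu> i) (u i)) \<and>
        lin_indep_on sector 1 u}"
      then obtain \<mu> u where "\<mu> 0 \<le> \<Lambda>" "dirichlet_eigenfunction hyp_metric sector (\<mu> 0) (u 0)"
        by (auto simp: less_one)
      then show "min lam1 B \<le> \<Lambda>" using alt[of "\<mu> 0" "u 0"] by (cases "\<mu> 0 < B") auto
    qed
  qed
  moreover have "B \<le> dirichlet_eigenvalue hyp_metric sector 2"
    unfolding dirichlet_eigenvalue_def
  proof (rule cInf_greatest)
    define \<mu> where "\<mu> i = (if i = 0 then lam1 else lam2)" for i :: nat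
    define u where "u i = (if i = 0 then U1 else U2)" for i :: nat
    \<comment> \<open>The set of admissible bounds must be nonempty for its infimum to be
      meaningful; the two separated eigenfunctions show that it contains
      \<open>lam2\<close>.\<close>
    have "lin_indep_on sector 2 u"
      unfolding lin_indep_on_def
    proof (intro allI impI)
      fix \<alpha> :: "nat \<Rightarrow> real" and i :: nat
      assume *: "\<forall>p\<in>sector. (\<Sum>i<2. \<alpha> i * u i p) = 0" and i: "i < 2"
      have **: "\<alpha> 0 * (sin (c * s) * \<phi> ((a + b) / 2)) + \<alpha> 1 * (sin (2 * c * s) * \<psi> ((a + b) / 2)) = 0"
        if s: "0 < s" "s < S" for s
      proof -
        have q: "(s, (a + b) / 2) \<in> rect" using s ab by (simp add: rect_def)
        then have "polar (s, (a + b) / 2) \<in> sector" by (auto simp: sector_def)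
        then have "\<alpha> 0 * U1 (polar (s, (a + b) / 2)) + \<alpha> 1 * U2 (polar (s, (a + b) / 2)) = 0"
          using * by (auto simp: u_def numeral_2_eq_2)
        moreover have "log_radius (polar (s, (a + b) / 2)) = s" "angle (polar (s, (a + b) / 2)) = (a + b) / 2"
          using polar_coords_polar'[OF subsetD[OF rect_subset q]] by (auto simp: polar_coords_def)
        ultimately show ?thesis by (simp add: U1_def U2_def)
      qed
      have p: "\<phi> ((a + b) / 2) > 0" "\<psi> ((a + b) / 2) > 0" using ab by (auto intro!: \<phi>(4) \<psi>(4))
      have h: "c * (S / 2) = pi / 2" "2 * c * (S / 2) = pi" "2 * c * (S / 4) = pi / 2"
        using c by (simp_all add: field_simps)
      \<comment> \<open>At s = S / 2 the sine in \<open>U2\<close> vanishes and the one in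
        \<open>U1\<close> is 1, which isolates the first coefficient; at s = S / 4 the sine in
        \<open>U2\<close> is 1.\<close>
      have "\<alpha> 0 = 0" using **[of "S / 2"] S p unfolding h by simp
      moreover from this have "\<alpha> 1 = 0" using **[of "S / 4"] S p unfolding h by simp
      ultimately show "\<alpha> i = 0" using i by (cases "i = 0") (auto simp: less_2_cases_iff)
    qed
    moreover have "lam1 \<le> lam2" using gap c2(1) by linarith
    ultimately have "lam2 \<in> {\<Lambda>. \<exists>\<mu> u. (\<forall>i<2. \<mu> i \<le> \<Lambda> \<and> dirichlet_eigenfunction hyp_metric sector (\<mu> i) (u i)) \<and>
        lin_indep_on sector 2 u}"
      using eig1 eig2 by (intro CollectI exI[of _ \<mu>] exI[of _ u]) (auto simp: \<mu>_def u_def)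
    then show "{\<Lambda>. \<exists>\<mu> u. (\<forall>i<2. \<mu> i \<le> \<Lambda> \<and> dirichlet_eigenfunction hyp_metric sector (\<mu> i) (u i)) \<and>
        lin_indep_on sector 2 u} \<noteq> {}" by blast
  next
    fix \<Lambda> assume "\<Lambda> \<in> {\<Lambda>. \<exists>\<mu> u. (\<forall>i<2. \<mu> i \<le> \<Lambda> \<and> dirichlet_eigenfunction hyp_metric sector (\<mu> i) (u i)) \<and>
        lin_indep_on sector 2 u}"
    then obtain \<mu> u where \<mu>: "\<And>i. i < 2 \<Longrightarrow> \<mu> i \<le> \<Lambda>"
      and eig: "\<And>i. i < 2 \<Longrightarrow> dirichlet_eigenfunction hyp_metric sector (\<mu> i) (u i)"
      and ind: "lin_indep_on sector 2 u" by blast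
    show "B \<le> \<Lambda>"
    proof (rule ccontr)
      assume "\<not> B \<le> \<Lambda>"
      then have "\<mu> i < B" if "i < 2" for i using \<mu>[OF that] by simp
      then have "\<exists>\<kappa>. \<forall>p\<in>sector. u i p = \<kappa> * U1 p" if "i < 2" for i using alt[OF eig[OF that]] that by blast
      from this[of 0] this[of 1] obtain k0 k1
        where k: "\<And>p. p \<in> sector \<Longrightarrow> u 0 p = k0 * U1 p" "\<And>p. p \<in> sector \<Longrightarrow> u 1 p = k1 * U1 p" by auto
      have zero: "\<alpha> 0 = 0 \<and> \<alpha> 1 = 0" if "\<And>p. p \<in> sector \<Longrightarrow> \<alpha> 0 * u 0 p + \<alpha> 1 * u 1 p = 0" for \<alpha> :: "nat \<Rightarrow> real"
        using ind that unfolding lin_indep_on_def by (auto simp: numeral_2_eq_2)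
      \<comment> \<open>Two multiples of \<open>U1\<close> satisfy the relation k1 u_0 - k0 u_1 = 0.
        Independence makes both factors zero, so both functions vanish on the sector, and then the
        coefficients 1, 1 give a nontrivial relation.\<close>
      have "k1 = 0 \<and> - k0 = 0"
        using zero[of "\<lambda>i. if i = 0 then k1 else - k0"] k by (simp add: mult.left_commute)
      then show False using zero[of "\<lambda>i. 1"] k by simp
    qed
  qed
  ultimately show ?thesis using gap lam1 unfolding B_def by blast
qed

end

section \<open>The diameter\<close>

lemma curve_speed_hyp_metric:
  "curve_speed hyp_metric \<gamma> t =
     sqrt (((fst (vector_derivative \<gamma> (at t)))\<^sup>2 + (snd (vector_derivative \<gamma> (at t)))\<^sup>2) / (snd (\<gamma> t))\<^sup>2)"
  by (simp add: curve_speed_def hyp_metric_def power2_eq_square)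

text \<open>The fundamental theorem of calculus for ln y along the curve; at the finitely many break
  points continuity is enough. The integrand y' / y is at most the hyperbolic speed.\<close>

lemma log_height_le_curve_length:
  assumes "admissible_curve hyp_metric half_plane p q \<gamma>"
  shows "ln (snd q) - ln (snd p) \<le> curve_length hyp_metric \<gamma>"
proof -
  have pw: "\<gamma> piecewise_C1_differentiable_on {0..1}" and im: "\<And>t. t \<in> {0..1} \<Longrightarrow> snd (\<gamma> t) > 0"
    and ends: "\<gamma> 0 = p" "\<gamma> 1 = q" and int: "curve_speed hyp_metric \<gamma> integrable_on {0..1}"
    using assms by (auto simp: admissible_curve_def path_image_def half_plane_def pathstart_def
        pathfinish_def image_subset_iff case_prod_beta)
  obtain K where K: "finite K" and cont: "continuous_on {0..1} \<gamma>"
    and d: "\<And>t. t \<in> {0..1} - K \<Longrightarrow> \<gamma> differentiable at t"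
    using pw unfolding piecewise_C1_differentiable_on_def C1_differentiable_on_eq by blast
  have "((\<lambda>t. snd (vector_derivative \<gamma> (at t)) / snd (\<gamma> t)) has_integral
      (ln (snd (\<gamma> 1)) - ln (snd (\<gamma> 0)))) {0..1}"
  proof (rule fundamental_theorem_of_calculus_interior_strong[OF K])
    fix t assume t: "t \<in> {0<..<1} - K"
    then have "(\<gamma> has_vector_derivative vector_derivative \<gamma> (at t)) (at t)"
      using d[of t] by (simp add: vector_derivative_works)
    then have "((\<lambda>t. snd (\<gamma> t)) has_vector_derivative snd (vector_derivative \<gamma> (at t))) (at t)"
      by (rule bounded_linear.has_vector_derivative[OF bounded_linear_snd])
    then have "((\<lambda>t. snd (\<gamma> t)) has_real_derivative snd (vector_derivative \<gamma> (at t))) (at t)"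
      by (simp add: has_real_derivative_iff_has_vector_derivative)
    from DERIV_chain2[OF DERIV_ln_divide this] im[of t] t
    show "((\<lambda>t. ln (snd (\<gamma> t))) has_vector_derivative
        snd (vector_derivative \<gamma> (at t)) / snd (\<gamma> t)) (at t)"
      by (simp add: has_real_derivative_iff_has_vector_derivative)
  next
    show "continuous_on {0..1} (\<lambda>t. ln (snd (\<gamma> t)))"
      using im by (intro continuous_intros cont) force
  qed simp
  then have "ln (snd (\<gamma> 1)) - ln (snd (\<gamma> 0)) \<le> integral {0..1} (curve_speed hyp_metric \<gamma>)"
  proof (rule has_integral_le[OF _ integrable_integral[OF int]])
    fix t :: real assume t: "t \<in> {0..1}"
    show "snd (vector_derivative \<gamma> (at t)) / snd (\<gamma> t) \<le> curve_speed hyp_metric \<gamma> t"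
      unfolding curve_speed_hyp_metric
      by (rule real_le_rsqrt) (use im[OF t] in \<open>simp add: power_divide divide_right_mono\<close>)
  qed
  then show ?thesis by (simp add: curve_length_def ends)
qed

lemma curve_length_nonneg:
  assumes "admissible_curve hyp_metric half_plane p q \<gamma>"
  shows "0 \<le> curve_length hyp_metric \<gamma>"
  unfolding curve_length_def
  by (rule integral_nonneg) (use assms in \<open>auto simp: admissible_curve_def curve_speed_hyp_metric\<close>)

text \<open>Euclidean segments give crude upper bounds for distances. They ensure that the infimum
  over curves is taken over a nonempty set and that the supremum defining the diameter is
  finite.\<close>

lemma segment_length:
  assumes m: "m > 0" "m \<le> snd p" "m \<le> snd q"
  shows "admissible_curve hyp_metric half_plane p q (linepath p q)"
    and "curve_length hyp_metric (linepath p q) \<le> norm (q - p) / m"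
proof -
  have up: "m \<le> snd (linepath p q t)" if "t \<in> {0..1}" for t
  proof -
    have "(1 - t) * m + t * m \<le> (1 - t) * snd p + t * snd q"
      using that m by (intro add_mono mult_left_mono) auto
    then show ?thesis by (simp add: linepath_def algebra_simps)
  qed
  have sp: "curve_speed hyp_metric (linepath p q) t = norm (q - p) / snd (linepath p q t)"
    if "t \<in> {0..1}" for t
    using up[OF that] m
    by (simp add: curve_speed_hyp_metric real_sqrt_divide norm_prod_def)
  have "linepath p q C1_differentiable_on {0..1}"
    unfolding C1_differentiable_on_def
    by (intro exI[of _ "\<lambda>_. q - p"] conjI ballI has_vector_derivative_linepath_within continuous_on_const)
  then have pw: "linepath p q piecewise_C1_differentiable_on {0..1}"
    by (rule C1_differentiable_imp_piecewise)
  have "continuous_on {0..1} (\<lambda>t. norm (q - p) / snd (linepath p q t))"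
    using up m by (intro continuous_intros) force
  then have "continuous_on {0..1} (curve_speed hyp_metric (linepath p q))"
    by (rule continuous_on_eq) (simp add: sp)
  then have int: "curve_speed hyp_metric (linepath p q) integrable_on {0..1}"
    by (rule integrable_continuous_real)
  show "admissible_curve hyp_metric half_plane p q (linepath p q)"
    unfolding admissible_curve_def
  proof (intro conjI pw int)
    show "path_image (linepath p q) \<subseteq> half_plane"
    proof
      fix z assume "z \<in> path_image (linepath p q)"
      then obtain t where t: "t \<in> {0..1}" "z = linepath p q t" by (auto simp: path_image_def)
      then have "snd z > 0" using up[OF t(1)] m by simp
      then show "z \<in> half_plane" by (cases z) (simp add: half_plane_def)
    qed
  qed auto
  have "integral {0..1} (curve_speed hyp_metric (linepath p q)) \<le> integral {0..1} (\<lambda>t::real. norm (q - p) / m)"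
    by (rule integral_le[OF int]) (use up m in \<open>auto simp: sp intro!: divide_left_mono mult_pos_pos\<close>, force)
  then show "curve_length hyp_metric (linepath p q) \<le> norm (q - p) / m"
    by (simp add: curve_length_def)
qed

context polar_rectangle
begin

lemma diameter_ge:
  assumes "a < pi / 2" "pi / 2 < b"
  shows "S \<le> riemannian_diameter hyp_metric half_plane sector"
proof -
  let ?d = "riemannian_dist hyp_metric half_plane"
  have ne: "crect \<noteq> {}" and comp: "compact crect"
    using S ab by (auto simp: crect_def intro!: compact_Times)
  \<comment> \<open>The lowest height is attained on the compact closed rectangle and is positive,
    which bounds the hyperbolic length of segments between points of the sector.\<close>
  obtain q0 where q0: "q0 \<in> crect" "\<And>q. q \<in> crect \<Longrightarrow> snd (polar q0) \<le> snd (polar q)"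
    using continuous_attains_inf[OF comp ne, of "\<lambda>q. snd (polar q)"]
      continuous_on_snd[OF continuous_on_polar] by blast
  define m where "m = snd (polar q0)"
  have m: "m > 0" unfolding m_def by (rule polar_crect_upper[OF q0(1)])
  have low: "m \<le> snd p" if "p \<in> sector" for p
    using that q0(2) rect_subset by (auto simp: sector_def m_def)
  have "bounded sector"
    by (rule bounded_subset[OF compact_imp_bounded closure_subset])
      (use comp in \<open>simp add: closure_sector compact_continuous_image continuous_on_polar\<close>)
  then obtain M where M: "\<And>p. p \<in> sector \<Longrightarrow> norm p \<le> M" unfolding bounded_iff by blast
  have upper: "?d p q \<le> 2 * M / m" if "p \<in> sector" "q \<in> sector" for p q
  proof -
    have "?d p q \<le> curve_length hyp_metric (linepath p q)"
      unfolding riemannian_dist_def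
    proof (rule cInf_lower)
      show "curve_length hyp_metric (linepath p q) \<in>
          {curve_length hyp_metric \<gamma> |\<gamma>. admissible_curve hyp_metric half_plane p q \<gamma>}"
        using segment_length(1)[OF m low[OF that(1)] low[OF that(2)]] by blast
      show "bdd_below {curve_length hyp_metric \<gamma> |\<gamma>. admissible_curve hyp_metric half_plane p q \<gamma>}"
        using curve_length_nonneg by (intro bdd_belowI[of _ 0]) blast
    qed
    also have "\<dots> \<le> norm (q - p) / m"
      by (rule segment_length(2)[OF m low[OF that(1)] low[OF that(2)]])
    also have "norm (q - p) \<le> 2 * M"
      using norm_triangle_ineq4[of q p] M[OF that(1)] M[OF that(2)] by linarith
    finally show ?thesis using m by (simp add: divide_right_mono)
  qed
  have lower: "ln (snd q) - ln (snd p) \<le> ?d p q" if "p \<in> sector" "q \<in> sector" for p q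
    unfolding riemannian_dist_def
  proof (rule cInf_greatest)
    show "{curve_length hyp_metric \<gamma> |\<gamma>. admissible_curve hyp_metric half_plane p q \<gamma>} \<noteq> {}"
      using segment_length(1)[OF m low[OF that(1)] low[OF that(2)]] by blast
  qed (use log_height_le_curve_length in blast)
  have D: "?d p q \<le> riemannian_diameter hyp_metric half_plane sector" if "p \<in> sector" "q \<in> sector" for p q
    unfolding riemannian_diameter_def
  proof (rule cSup_upper)
    show "?d p q \<in> {?d p q |p q. p \<in> sector \<and> q \<in> sector}" using that by blast
    show "bdd_above {?d p q |p q. p \<in> sector \<and> q \<in> sector}"
      using upper by (intro bdd_aboveI[of _ "2 * M / m"]) blast
  qed
  \<comment> \<open>The end points of the vertical segment lie on the frontier, so the segment is
    shortened by e / 2 in logarithmic height at each end.\<close>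
  have "S - e \<le> riemannian_diameter hyp_metric half_plane sector" if e: "0 < e" "e < S" for e
  proof -
    have in_sector: "polar (s, pi / 2) \<in> sector" if "0 < s" "s < S" for s
      using that assms by (simp add: sector_def rect_def)
    have "S - e = ln (snd (polar (S - e / 2, pi / 2))) - ln (snd (polar (e / 2, pi / 2)))"
      by (simp add: polar_def)
    also have "\<dots> \<le> ?d (polar (e / 2, pi / 2)) (polar (S - e / 2, pi / 2))"
      by (rule lower; rule in_sector) (use e in auto)
    also have "\<dots> \<le> riemannian_diameter hyp_metric half_plane sector"
      by (rule D; rule in_sector) (use e in auto)
    finally show ?thesis .
  qed
  note approx = this
  show ?thesis
  proof (rule field_le_epsilon)
    fix e :: real assume "0 < e"
    then show "S \<le> riemannian_diameter hyp_metric half_plane sector + e"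
      using approx[of e] approx[of "S / 2"] S by (cases "e < S") auto
  qed
qed

end

section \<open>The domain and the numerical estimates\<close>

lemma Omega_eq_sector:
  assumes "polar_rectangle (pi / c) \<theta>\<^sub>0 \<theta>\<^sub>1"
  shows "Omega c \<theta>\<^sub>0 \<theta>\<^sub>1 = polar_rectangle.sector (pi / c) \<theta>\<^sub>0 \<theta>\<^sub>1"
proof -
  interpret polar_rectangle "pi / c" \<theta>\<^sub>0 \<theta>\<^sub>1 by fact
  show ?thesis
  proof
    show "Omega c \<theta>\<^sub>0 \<theta>\<^sub>1 \<subseteq> sector"
    proof
      fix p assume "p \<in> Omega c \<theta>\<^sub>0 \<theta>\<^sub>1"
      then obtain r t where rt: "p = (r * cos t, r * sin t)" "1 < r" "r < exp (pi / c)" "\<theta>\<^sub>0 < t" "t < \<theta>\<^sub>1"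
        by (auto simp: Omega_def)
      then have "ln r < pi / c" by (metis ln_exp ln_less_cancel_iff exp_gt_zero less_trans zero_less_one)
      then have "(ln r, t) \<in> rect" using rt by (simp add: rect_def)
      moreover have "p = polar (ln r, t)" using rt by (simp add: polar_def)
      ultimately show "p \<in> sector" by (auto simp: sector_def)
    qed
    show "sector \<subseteq> Omega c \<theta>\<^sub>0 \<theta>\<^sub>1"
      by (force simp: sector_def rect_def Omega_def polar_def)
  qed
qed

theorem mainTheorem2:
  fixes c \<theta>\<^sub>0 \<theta>\<^sub>1 lam\<^sub>1 lam\<^sub>2 D :: real
  assumes "\<theta>\<^sub>0 = pi / 4"
    and "pi / 2 < \<theta>\<^sub>1" and "\<theta>\<^sub>1 < 3 * pi / 4"
    and "c > 0"
    and "c\<^sup>2 < pi / 5 * cot (19 / 40 * pi) / (1 + pi / 40 * cot (19 / 40 * pi))"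
    and "lam\<^sub>1 = dirichlet_eigenvalue hyp_metric (Omega c \<theta>\<^sub>0 \<theta>\<^sub>1) 1"
    and "lam\<^sub>2 = dirichlet_eigenvalue hyp_metric (Omega c \<theta>\<^sub>0 \<theta>\<^sub>1) 2"
    and "D = riemannian_diameter hyp_metric half_plane (Omega c \<theta>\<^sub>0 \<theta>\<^sub>1)"
  shows "lam\<^sub>2 - lam\<^sub>1 > 3 * pi\<^sup>2 / (2 * D\<^sup>2)"
proof -
  interpret polar_rectangle "pi / c" \<theta>\<^sub>0 \<theta>\<^sub>1
    using assms by unfold_locales auto
  have Om: "Omega c \<theta>\<^sub>0 \<theta>\<^sub>1 = sector" by (rule Omega_eq_sector) unfold_locales
  have sin_half: "sqrt 2 / 2 < sin t" if "pi / 4 < t" "t < 3 * pi / 4" for t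
  proof (cases "t \<le> pi / 2")
    case True
    have "sin (pi / 4) < sin t" using True that by (intro sin_monotone_2pi) auto
    then show ?thesis by (simp add: sin_45)
  next
    case False
    have "sin (pi / 4) < sin (pi - t)" using False that by (intro sin_monotone_2pi) auto
    then show ?thesis by (simp add: sin_45)
  qed
  have w_less: "1 / (sin t)\<^sup>2 < 2" if "pi / 4 < t" "t < 3 * pi / 4" for t
  proof -
    have "(sqrt 2 / 2)\<^sup>2 < (sin t)\<^sup>2" using sin_half[OF that] by (intro power_strict_mono) auto
    then have "1 / 2 < (sin t)\<^sup>2" by (simp add: power_divide)
    moreover from this have "0 < (sin t)\<^sup>2" by linarith
    ultimately show ?thesis by (simp add: divide_less_eq)
  qed
  have w_le: "1 / (sin t)\<^sup>2 \<le> 2" if "t \<in> {\<theta>\<^sub>0..\<theta>\<^sub>1}" for t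
  proof (cases "t = pi / 4")
    case True
    show ?thesis unfolding True by (simp add: sin_45 power_divide)
  next
    case False
    then show ?thesis using w_less[of t] that assms by auto
  qed
  \<comment> \<open>cot (19 pi / 40) = tan (pi / 40) lies between 0 and 1, pi / 5 is below 4 / 5,
    and the denominator exceeds 1.\<close>
  have c1: "c\<^sup>2 < 1"
  proof -
    define C where "C = cot (19 / 40 * pi)"
    have s: "0 < sin (19 / 40 * pi)" by (rule sin_gt_zero) auto
    have "cos (19 / 40 * pi) = sin (pi / 40)"
      unfolding cos_sin_eq by (rule arg_cong[where f=sin]) simp
    moreover have "0 < sin (pi / 40)" by (rule sin_gt_zero) auto
    moreover have "sin (pi / 40) < sin (19 / 40 * pi)" by (intro sin_monotone_2pi) auto
    ultimately have C: "0 < C" "C < 1" using s by (auto simp: C_def cot_def)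
    have "pi / 5 * C \<le> 4 / 5 * 1" using C pi_less_4 by (intro mult_mono) auto
    moreover have "pi / 5 * C / (1 + pi / 40 * C) \<le> pi / 5 * C / 1"
      using C by (intro divide_left_mono) (auto intro: add_pos_pos)
    moreover have "c\<^sup>2 < pi / 5 * C / (1 + pi / 40 * C)" using assms(5) by (simp only: C_def)
    ultimately show ?thesis by linarith
  qed
  obtain l1 l2 where l: "dirichlet_eigenvalue hyp_metric sector 1 \<le> l1"
      "min l2 (((2 * pi / (\<theta>\<^sub>1 - \<theta>\<^sub>0))\<^sup>2 + c\<^sup>2) / 2) \<le> dirichlet_eigenvalue hyp_metric sector 2"
      "l1 \<le> c\<^sup>2 + (pi / (\<theta>\<^sub>1 - \<theta>\<^sub>0))\<^sup>2" "l1 + 3 * c\<^sup>2 / 2 < l2"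
    using first_two_eigenvalues[OF \<open>c > 0\<close> refl w_le] w_less assms by auto
  \<comment> \<open>With L the angular width, the second candidate in the minimum exceeds
    \<open>l1 + 3 * c\<^sup>2 / 2\<close> as soon as pi^2 / L^2 > 2 c^2; the left side is above 4
    and the right side below 2.\<close>
  have "2 < pi / (\<theta>\<^sub>1 - \<theta>\<^sub>0)" using assms by (simp add: field_simps)
  then have "2\<^sup>2 < (pi / (\<theta>\<^sub>1 - \<theta>\<^sub>0))\<^sup>2" by (intro power_strict_mono) auto
  moreover have "(2 * pi / (\<theta>\<^sub>1 - \<theta>\<^sub>0))\<^sup>2 = 4 * (pi / (\<theta>\<^sub>1 - \<theta>\<^sub>0))\<^sup>2"
    by (simp add: power_divide power_mult_distrib)
  ultimately have "l1 + 3 * c\<^sup>2 / 2 < ((2 * pi / (\<theta>\<^sub>1 - \<theta>\<^sub>0))\<^sup>2 + c\<^sup>2) / 2"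
    using l(3) c1 by simp
  then have gap: "3 * c\<^sup>2 / 2 < lam\<^sub>2 - lam\<^sub>1"
    using l assms(6,7) unfolding Om by linarith
  have D: "pi / c \<le> D"
  proof -
    have "\<theta>\<^sub>0 < pi / 2" using assms(1) pi_gt_zero by linarith
    then show ?thesis using diameter_ge assms(2) unfolding assms(8) Om by blast
  qed
  have "0 < pi / c" using assms by simp
  then have "(pi / c)\<^sup>2 \<le> D\<^sup>2" using D by (intro power_mono) auto
  then have "3 * pi\<^sup>2 / (2 * D\<^sup>2) \<le> 3 * pi\<^sup>2 / (2 * (pi / c)\<^sup>2)"
    using \<open>0 < pi / c\<close> D by (intro divide_left_mono mult_pos_pos) auto
  also have "\<dots> = 3 * c\<^sup>2 / 2" using assms(4) by (simp add: power_divide field_simps)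
  finally show ?thesis using gap by simp
qed

end
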